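(* Let $X$ be a compact metric space, let $P_t$, $t\ge 0$, be a Markov semigroup on $C(X)$ with generator $L$. Fix $V\in C(X)$ and suppose $$C\equiv\sup_{t\ge0}\left(e^{-\lambda_Vt}\|P_t^V\|\right)<\infty,$$ and let $\mu$ be an equilibrium measure for $V$. Then there is a ground state $\psi$ for $V$ relative to $\mu$ and a ground measure $\pi$ for $V$ such that (1) $\log\psi\in L^1(\mu)$; (2) $\mu\ll\pi$ and $d\mu/d\pi=\psi$; and (3) $P_t^{V,\psi}$, $t\ge0$, is a Markov semigroup on $L^1(\mu)$, and $\mu$ is invariant under $P_t^{V,\psi}$, $t\ge0$: $$\int_XP_t^{V,\psi}f\,d\mu=\int_Xf\,d\mu,\qquad f\in L^1(\mu),\ t\ge0.$$
   Context: $C(X)$ is the space of real continuous functions on the compact metric space $X$ with the sup norm $\|\cdot\|$ (also used for the operator norm); $M(X)$ is the space of Borel probability measures on $X$ with the topology of weak convergence; $\mu(f)=\int_X f\,d\mu$; $L^1(\mu)$ is the space of $\mu$-integrable Borel functions with norm $\|f\|_{L^1(\mu)}=\mu(|f|)$. A Markov semigroup on $C(X)$ is a semigroup $P_t$, $t\ge0$, of bounded operators on $C(X)$ with $P_tf\ge0$ for $f\ge0$, $\|P_tf-f\|\to0$ as $t\to0+$ for all $f\in C(X)$, and $P_t1=1$. Its generator is $Lf=\lim_{t\to0+}\frac1t(P_tf-f)$ (limit in $C(X)$), defined on the dense domain $\mathcal D\subset C(X)$ where the limit exists. $\mathcal D^+$ is the set of strictly positive functions in $\mathcal D$. For $V\in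 C(X)$, the Schrodinger semigroup $P_t^V$, $t\ge0$, on $C(X)$ is the strongly continuous positive semigroup generated by $L+V$; equivalently $u(t)=P_t^Vf$ is the unique solution of $u(t)=P_tf+\int_0^tP_{t-s}Vu(s)\,ds$, $t\ge0$, for $f\in C(X)$. By positivity $P_t^Vf(x)=\int_X p^V(t,x,dy)f(y)$ for a family of bounded positive measures $p^V(t,x,\cdot)$, so $0\le P_t^Vf(x)\le+\infty$ is defined for every nonnegative Borel $f$. The principal eigenvalue is $\lambda_V=\lim_{t\to\infty}\frac1t\log\|P_t^V\|$; it is given by the Donsker-Varadhan formula $\lambda_V=\sup_{\mu\in M(X)}\left(\int_XV\,d\mu-I(\mu)\right)$, where $I(\mu)=-\inf_{u\in\mathcal D^+}\int_X\frac{Lu}{u}\,d\mu$. An equilibrium measure for $V$ is a $\mu\in M(X)$ with $\lambda_V=\mu(V)-I(\mu)$. A ground measure for $V$ is a $\pi\in M(X)$ with $\int_Xe^{-\lambda_Vt}P_t^Vf\,d\pi=\int_Xf\,d\pi$ for all $t\ge0$, $f\in C(X)$. A ground state for $V$ relative to $\mu\in M(X)$ is a nonnegative Borel function $\psi$ on $X$ with $\psi>0$ $\mu$-a.e. and, for every $t\ge0$, $e^{-\lambda_Vt}P_t^V\psi=\psi$ $\mu$-a.e. For $\psi$ nonnegative Borel, $P_t^{V,\psi}f=\dfrac{e^{-\lambda_Vt}P_t^V(f\psi)}{\psi}$; $P_t^{V,\psi}f(x)$ is defined at a point $x$ if $P_t^V(|f|\psi)(x)<\infty$ and $\psi(x)>0$.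 A Markov semigroup on $L^1(\mu)$ is a semigroup $T_t$, $t\ge0$, of bounded operators on $L^1(\mu)$ with $T_tf\ge0$ $\mu$-a.e. whenever $f\ge0$ $\mu$-a.e., $\|T_tf-f\|_{L^1(\mu)}\to0$ as $t\to0+$ for all $f\in L^1(\mu)$, and $T_t1=1$ $\mu$-a.e. for $t\ge0$. *)

theory Defs
  imports "HOL-Probability.Probability"
begin

text \<open>
  The space \<open>X\<close> is a type \<open>'a::metric_space\<close> whose universe is compact, so that
  \<open>'a \<Rightarrow>\<^sub>C real\<close> (bounded continuous functions, sup norm) is \<open>C(X)\<close> and
  \<open>('a \<Rightarrow>\<^sub>C real) \<Rightarrow>\<^sub>L ('a \<Rightarrow>\<^sub>C real)\<close> is the space of bounded operators on it.
  One-parameter families are indexed by \<open>real\<close>; only the indices \<open>t \<ge> 0\<close> matter.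
\<close>

type_synonym 'a op_family = "real \<Rightarrow> ('a \<Rightarrow>\<^sub>C real) \<Rightarrow>\<^sub>L ('a \<Rightarrow>\<^sub>C real)"

definition positive_C0_semigroup :: "'a::metric_space op_family \<Rightarrow> bool" where
  "positive_C0_semigroup P \<longleftrightarrow>
     P 0 = id_blinfun \<and>
     (\<forall>s\<ge>0. \<forall>t\<ge>0. P (s + t) = P s o\<^sub>L P t) \<and>
     (\<forall>t\<ge>0. \<forall>f. (\<forall>x. 0 \<le> apply_bcontfun f x) \<longrightarrow> (\<forall>x. 0 \<le> P t f x)) \<and>
     (\<forall>f. ((\<lambda>t. norm (P t f - f)) \<longlongrightarrow> 0) (at_right 0))"

definition markov_semigroup :: "'a::metric_space op_family \<Rightarrow> bool" where
  "markov_semigroup P \<longleftrightarrow>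
     positive_C0_semigroup P \<and>
     (\<forall>t\<ge>0. P t (const_bcontfun 1) = const_bcontfun 1)"

definition gen_domain :: "'a::metric_space op_family \<Rightarrow> ('a \<Rightarrow>\<^sub>C real) set" where
  "gen_domain P = {f. \<exists>g. ((\<lambda>t. (P t f - f) /\<^sub>R t) \<longlongrightarrow> g) (at_right 0)}"

definition gen :: "'a::metric_space op_family \<Rightarrow> ('a \<Rightarrow>\<^sub>C real) \<Rightarrow> ('a \<Rightarrow>\<^sub>C real)" where
  "gen P f = Lim (at_right 0) (\<lambda>t. (P t f - f) /\<^sub>R t)"

definition pos_gen_domain :: "'a::metric_space op_family \<Rightarrow> ('a \<Rightarrow>\<^sub>C real) set" where
  "pos_gen_domain P = {u \<in> gen_domain P. \<forall>x. 0 < apply_bcontfun u x}"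

text \<open>
  The generator is \<open>L + V\<close>, with the domain of \<open>L\<close> since multiplication by \<open>V\<close> is bounded.
\<close>

definition is_schrodinger_semigroup ::
    "'a::metric_space op_family \<Rightarrow> ('a \<Rightarrow>\<^sub>C real) \<Rightarrow> 'a op_family \<Rightarrow> bool" where
  "is_schrodinger_semigroup P V Q \<longleftrightarrow>
     positive_C0_semigroup Q \<and>
     gen_domain Q = gen_domain P \<and>
     (\<forall>f\<in>gen_domain P. \<forall>x. gen Q f x = gen P f x + V x * f x)"

text \<open>
  A semigroup is determined by its generator for \<open>t \<ge> 0\<close>, so the choice below affects only
  the irrelevant values at negative times.
\<close>

definition schrodinger :: "'a::metric_space op_family \<Rightarrow> ('a \<Rightarrow>\<^sub>C real) \<Rightarrow> 'a op_family" where
  "schrodinger P V = (SOME Q. is_schrodinger_semigroup P V Q)"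

text \<open>
  The kernel \<open>p\<^sup>V(t,x,\<cdot>)\<close>; the Riesz representation theorem provides it for \<open>t \<ge> 0\<close>, and it is
  unique.
\<close>

definition schrodinger_kernel ::
    "'a::metric_space op_family \<Rightarrow> ('a \<Rightarrow>\<^sub>C real) \<Rightarrow> real \<Rightarrow> 'a \<Rightarrow> 'a measure" where
  "schrodinger_kernel P V t x =
     (SOME m. sets m = sets borel \<and> finite_measure m \<and>
        (\<forall>f :: 'a \<Rightarrow>\<^sub>C real. schrodinger P V t f x = (\<integral>y. f y \<partial>m)))"

definition schrodinger_nn ::
    "'a::metric_space op_family \<Rightarrow> ('a \<Rightarrow>\<^sub>C real) \<Rightarrow> real \<Rightarrow> ('a \<Rightarrow> real) \<Rightarrow> 'a \<Rightarrow> ennreal" where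
  "schrodinger_nn P V t f x = (\<integral>\<^sup>+y. ennreal (f y) \<partial>schrodinger_kernel P V t x)"

definition principal_eigenvalue :: "'a::metric_space op_family \<Rightarrow> ('a \<Rightarrow>\<^sub>C real) \<Rightarrow> real" where
  "principal_eigenvalue P V = Lim at_top (\<lambda>t. ln (norm (schrodinger P V t)) / t)"

definition borel_probability :: "'a::metric_space measure \<Rightarrow> bool" where
  "borel_probability \<mu> \<longleftrightarrow> prob_space \<mu> \<and> sets \<mu> = sets borel"

definition rate_function :: "'a::metric_space op_family \<Rightarrow> 'a measure \<Rightarrow> ereal" where
  "rate_function P \<mu> = - (INF u\<in>pos_gen_domain P. ereal (\<integral>x. gen P u x / u x \<partial>\<mu>))"

definition equilibrium_measure ::
    "'a::metric_space op_family \<Rightarrow> ('a \<Rightarrow>\<^sub>C real) \<Rightarrow> 'a measure \<Rightarrow> bool" where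
  "equilibrium_measure P V \<mu> \<longleftrightarrow>
     borel_probability \<mu> \<and>
     ereal (principal_eigenvalue P V) = ereal (\<integral>x. V x \<partial>\<mu>) - rate_function P \<mu>"

definition ground_measure ::
    "'a::metric_space op_family \<Rightarrow> ('a \<Rightarrow>\<^sub>C real) \<Rightarrow> 'a measure \<Rightarrow> bool" where
  "ground_measure P V \<pi> \<longleftrightarrow>
     borel_probability \<pi> \<and>
     (\<forall>t\<ge>0. \<forall>f :: 'a \<Rightarrow>\<^sub>C real.
        (\<integral>x. exp (- principal_eigenvalue P V * t) * schrodinger P V t f x \<partial>\<pi>) = (\<integral>x. f x \<partial>\<pi>))"

definition ground_state ::
    "'a::metric_space op_family \<Rightarrow> ('a \<Rightarrow>\<^sub>C real) \<Rightarrow> 'a measure \<Rightarrow> ('a \<Rightarrow> real) \<Rightarrow> bool" where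
  "ground_state P V \<mu> \<psi> \<longleftrightarrow>
     \<psi> \<in> borel_measurable borel \<and>
     (\<forall>x. 0 \<le> \<psi> x) \<and>
     (AE x in \<mu>. 0 < \<psi> x) \<and>
     (\<forall>t\<ge>0. AE x in \<mu>.
        ennreal (exp (- principal_eigenvalue P V * t)) * schrodinger_nn P V t \<psi> x = ennreal (\<psi> x))"

text \<open>
  \<open>P\<^sub>t\<^sup>V\<^sup>,\<^sup>\<psi> f\<close> is a partial function: \<open>doob_defined\<close> is its domain, and the value of
  \<open>doob\<close> is meaningful only there.
\<close>

definition doob_defined ::
    "'a::metric_space op_family \<Rightarrow> ('a \<Rightarrow>\<^sub>C real) \<Rightarrow> ('a \<Rightarrow> real) \<Rightarrow> real \<Rightarrow> ('a \<Rightarrow> real) \<Rightarrow> 'a \<Rightarrow> bool" where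
  "doob_defined P V \<psi> t f x \<longleftrightarrow> schrodinger_nn P V t (\<lambda>y. \<bar>f y\<bar> * \<psi> y) x < \<infinity> \<and> 0 < \<psi> x"

definition doob ::
    "'a::metric_space op_family \<Rightarrow> ('a \<Rightarrow>\<^sub>C real) \<Rightarrow> ('a \<Rightarrow> real) \<Rightarrow> real \<Rightarrow> ('a \<Rightarrow> real) \<Rightarrow> 'a \<Rightarrow> real" where
  "doob P V \<psi> t f x =
     exp (- principal_eigenvalue P V * t) * (\<integral>y. f y * \<psi> y \<partial>schrodinger_kernel P V t x) / \<psi> x"

text \<open>
  Operators on \<open>L\<^sup>1(\<mu>)\<close> are represented by maps on integrable functions which respect
  \<open>\<mu>\<close>-a.e. equality; all identities between elements of \<open>L\<^sup>1(\<mu>)\<close> are meant \<open>\<mu>\<close>-a.e.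
\<close>

definition L1_bounded_operator :: "'a measure \<Rightarrow> (('a \<Rightarrow> real) \<Rightarrow> 'a \<Rightarrow> real) \<Rightarrow> bool" where
  "L1_bounded_operator \<mu> T \<longleftrightarrow>
     (\<forall>f. integrable \<mu> f \<longrightarrow> integrable \<mu> (T f)) \<and>
     (\<forall>f g. integrable \<mu> f \<longrightarrow> integrable \<mu> g \<longrightarrow> (AE x in \<mu>. f x = g x) \<longrightarrow>
        (AE x in \<mu>. T f x = T g x)) \<and>
     (\<forall>f g a b. integrable \<mu> f \<longrightarrow> integrable \<mu> g \<longrightarrow>
        (AE x in \<mu>. T (\<lambda>y. a * f y + b * g y) x = a * T f x + b * T g x)) \<and>
     (\<exists>K. \<forall>f. integrable \<mu> f \<longrightarrow> (\<integral>x. \<bar>T f x\<bar> \<partial>\<mu>) \<le> K * (\<integral>x. \<bar>f x\<bar> \<partial>\<mu>))"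

definition L1_markov_semigroup :: "'a measure \<Rightarrow> (real \<Rightarrow> ('a \<Rightarrow> real) \<Rightarrow> 'a \<Rightarrow> real) \<Rightarrow> bool" where
  "L1_markov_semigroup \<mu> T \<longleftrightarrow>
     (\<forall>t\<ge>0. L1_bounded_operator \<mu> (T t)) \<and>
     (\<forall>f. integrable \<mu> f \<longrightarrow> (AE x in \<mu>. T 0 f x = f x)) \<and>
     (\<forall>s\<ge>0. \<forall>t\<ge>0. \<forall>f. integrable \<mu> f \<longrightarrow> (AE x in \<mu>. T (s + t) f x = T s (T t f) x)) \<and>
     (\<forall>t\<ge>0. \<forall>f. integrable \<mu> f \<longrightarrow> (AE x in \<mu>. 0 \<le> f x) \<longrightarrow> (AE x in \<mu>. 0 \<le> T t f x)) \<and>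
     (\<forall>f. integrable \<mu> f \<longrightarrow> ((\<lambda>t. \<integral>x. \<bar>T t f x - f x\<bar> \<partial>\<mu>) \<longlongrightarrow> 0) (at_right 0)) \<and>
     (\<forall>t\<ge>0. AE x in \<mu>. T t (\<lambda>_. 1) x = 1)"

end

theory Submission
  imports Defs
begin

text \<open>
  After division by \<open>exp (\<lambda>\<^sub>V t)\<close> the Schrodinger semigroup becomes a bounded positive semigroup \<open>Q t\<close>
  with principal eigenvalue \<open>0\<close>, and by the definition of the rate function an equilibrium measure
  satisfies \<open>\<integral> A u / u d\<mu> \<ge> 0\<close> for all strictly positive \<open>u\<close> in the domain of the generator \<open>A\<close>.
  Integrating this along an orbit gives the logarithmic inequality
  \<open>\<integral> ln w d\<mu> \<le> \<integral> ln (Q t w) d\<mu>\<close> for strictly positive continuous \<open>w\<close> (\<open>log_inequality\<close>), from which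
  everything else follows.

  By Jensen, each functional \<open>w \<mapsto> \<integral> Q t w d\<mu>\<close> is bounded below by \<open>exp (\<integral> ln w d\<mu>)\<close>.  This bound is
  preserved by time averages and their cluster points, and such a cluster point is an invariant
  positive functional; by the Riesz theorem it is a multiple of a ground measure \<open>\<pi>\<close>
  (\<open>invariant_functional_exists\<close>, \<open>invariant_probability_exists\<close>).  The bound
  \<open>\<integral> ln w d\<mu> \<le> c + ln (\<integral> w d\<pi>)\<close> says that \<open>\<mu>\<close> has finite relative entropy with respect to \<open>\<pi>\<close>: \<open>\<mu>\<close> has
  a density \<open>\<psi>\<close> with respect to \<open>\<pi>\<close>, and \<open>ln \<psi>\<close> is \<open>\<mu>\<close>-integrable.

  To see that \<open>\<psi>\<close> is a ground state, insert \<open>w = \<psi>\<close>: the logarithmic inequality gives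
  \<open>0 \<le> \<integral> ln (Q t \<psi> / \<psi>) d\<mu>\<close>, while invariance of \<open>\<pi>\<close> gives
  \<open>\<integral> Q t \<psi> / \<psi> d\<mu> \<le> \<integral> Q t \<psi> d\<pi> = 1\<close>.  This is the equality case of Jensen's inequality, so
  \<open>Q t \<psi> = \<psi>\<close> holds \<open>\<mu>\<close>-almost everywhere.  As \<open>\<psi>\<close> is neither bounded nor bounded away from \<open>0\<close>,
  the argument is run with truncations and with \<open>ln x \<le> 2 * (sqrt x - 1)\<close>, which makes the equality case
  quantitative (\<open>nn_integral_sqrt_ratio_deviation\<close>, \<open>Q_\<psi>\<close>).

  Finally, multiplication by \<open>\<psi>\<close> embeds \<open>L\<^sup>1(\<mu>)\<close> into \<open>L\<^sup>1(\<pi>)\<close> and intertwines the transformed semigroup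
  with the extension of \<open>Q t\<close> to \<open>L\<^sup>1(\<pi>)\<close>, which is contractive, strongly continuous and preserves
  \<open>\<pi>\<close>.  All assertions about the transformed semigroup follow (\<open>transform_L1_markov_semigroup\<close>).

  Three general facts are developed on the way: the Riesz representation theorem on a compact metric
  space (\<open>riesz_representation\<close>), the generation of a positive semigroup by a bounded perturbation
  (\<open>schrodinger_semigroup_exists\<close>), without which the Schrodinger semigroup and its kernel would be
  arbitrary objects, and the extension of averaging identities and \<open>L\<^sup>1\<close> approximation from continuous to
  Borel functions (\<open>kernel_nn_integral\<close>, \<open>continuous_dense_L1\<close>).
\<close>

section \<open>Positive functionals on \<open>C(X)\<close> are measures\<close>

lemma apply_Bcontfun:
  fixes f :: "'a::metric_space \<Rightarrow> real"
  assumes "compact (UNIV :: 'a set)" "continuous_on UNIV f"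
  shows "apply_bcontfun (Bcontfun f) = f"
  using assms compact_continuous_image[OF assms(2,1)]
  by (intro Bcontfun_inverse) (auto simp: bcontfun_def compact_imp_bounded)

definition increases_to_indicator :: "(nat \<Rightarrow> 'a::metric_space \<Rightarrow>\<^sub>C real) \<Rightarrow> 'a set \<Rightarrow> bool" where
  "increases_to_indicator g U \<longleftrightarrow>
     (\<forall>k x. 0 \<le> apply_bcontfun (g k) x \<and> apply_bcontfun (g k) x \<le> indicator U x) \<and>
     (\<forall>k l x. k \<le> l \<longrightarrow> apply_bcontfun (g k) x \<le> apply_bcontfun (g l) x) \<and>
     (\<forall>x. (\<lambda>k. apply_bcontfun (g k) x) \<longlonglongrightarrow> indicator U x) \<and>
     (\<forall>x\<in>U. \<exists>k. apply_bcontfun (g k) x = 1)"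

lemma open_indicator_increasing_limit:
  assumes "open U"
  shows "\<exists>g. increases_to_indicator g U"
proof (cases "U = UNIV")
  case True
  show ?thesis
    by (rule exI[of _ "\<lambda>_. const_bcontfun 1"]) (simp add: True increases_to_indicator_def)
next
  case False
  define h where "h k x = min 1 (real k * infdist x (- U))" for k :: nat and x
  define g where "g k = Bcontfun (h k)" for k
  have "h k \<in> bcontfun" for k
    unfolding h_def
    by (rule bcontfun_normI[of _ 1]) (auto intro!: continuous_intros simp: infdist_nonneg)
  then have g: "apply_bcontfun (g k) = h k" for k
    unfolding g_def by (rule Bcontfun_inverse)
  have out: "x \<notin> U \<Longrightarrow> h k x = 0" for k x
    by (simp add: h_def)
  have eq1: "\<exists>k. \<forall>l\<ge>k. h l x = 1" if "x \<in> U" for x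
  proof -
    have "infdist x (- U) \<noteq> 0"
      using in_closed_iff_infdist_zero[of "- U" x] assms False that by auto
    then have pos: "0 < infdist x (- U)"
      using infdist_nonneg[of x "- U"] by simp
    then obtain k :: nat where k: "1 < real k * infdist x (- U)"
      using reals_Archimedean3 by blast
    have "1 \<le> real l * infdist x (- U)" if "k \<le> l" for l
    proof -
      have "real k * infdist x (- U) \<le> real l * infdist x (- U)"
        using that pos by (intro mult_right_mono) auto
      then show ?thesis using k by linarith
    qed
    then have "\<forall>l\<ge>k. h l x = 1" by (simp add: h_def)
    then show ?thesis by blast
  qed
  show ?thesis
    unfolding increases_to_indicator_def
  proof (intro exI[of _ g] conjI allI ballI impI, unfold g)
    show "0 \<le> h k x" for k x by (simp add: h_def infdist_nonneg)
    show "h k x \<le> indicator U x" for k x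
      by (cases "x \<in> U") (auto simp: out, simp add: h_def)
    show "h k x \<le> h l x" if "k \<le> l" for k l x
    proof -
      have "real k * infdist x (- U) \<le> real l * infdist x (- U)"
        using that by (intro mult_right_mono) (auto simp: infdist_nonneg)
      then show ?thesis by (auto simp: h_def)
    qed
    show "\<exists>k. h k x = 1" if "x \<in> U" for x using eq1[OF that] by blast
    show "(\<lambda>k. h k x) \<longlonglongrightarrow> indicator U x" for x
    proof (cases "x \<in> U")
      case True
      then show ?thesis using eq1[OF True]
        unfolding eventually_sequentially[symmetric] by (intro tendsto_eventually) simp
    qed (simp add: out)
  qed
qed

text \<open>
  The measure representing \<open>\<phi>\<close> is the Caratheodory restriction of the outer measure that is
  generated by assigning to an open set \<open>U\<close> the supremum of \<open>\<phi>\<close> over the continuous functions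
  between \<open>0\<close> and the indicator of \<open>U\<close>.
\<close>

locale positive_functional =
  fixes \<phi> :: "('a::metric_space \<Rightarrow>\<^sub>C real) \<Rightarrow> real"
  assumes cpt: "compact (UNIV :: 'a set)"
    and lin: "linear \<phi>"
    and pos: "\<And>f. (\<And>x. 0 \<le> apply_bcontfun f x) \<Longrightarrow> 0 \<le> \<phi> f"
begin

lemma mono: "\<phi> f \<le> \<phi> g" if "\<And>x. apply_bcontfun f x \<le> apply_bcontfun g x"
  using pos[of "g - f"] that linear_diff[OF lin, of g f] by simp

definition below :: "'a set \<Rightarrow> ('a \<Rightarrow>\<^sub>C real) set" where
  "below U = {f. \<forall>x. 0 \<le> apply_bcontfun f x \<and> apply_bcontfun f x \<le> indicator U x}"

definition open_mass :: "'a set \<Rightarrow> ennreal" where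
  "open_mass U = (SUP f\<in>below U. ennreal (\<phi> f))"

definition outer :: "'a set \<Rightarrow> ennreal" where
  "outer A = (INF U\<in>{U. open U \<and> A \<subseteq> U}. open_mass U)"

lemma indicator_mono_aux: "U \<subseteq> W \<Longrightarrow> indicator U x \<le> (indicator W x :: real)"
  by (auto simp: indicator_def)

lemma below_mono: "U \<subseteq> W \<Longrightarrow> below U \<subseteq> below W"
  unfolding below_def using order_trans[OF _ indicator_mono_aux[of U W]] by auto

lemma open_mass_mono: "U \<subseteq> W \<Longrightarrow> open_mass U \<le> open_mass W"
  unfolding open_mass_def by (intro SUP_subset_mono below_mono) auto

lemma outer_mono: "A \<subseteq> B \<Longrightarrow> outer A \<le> outer B"
  unfolding outer_def by (intro INF_superset_mono) auto

lemma outer_open: "open U \<Longrightarrow> outer U = open_mass U"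
  unfolding outer_def
  by (intro antisym INF_lower INF_greatest) (auto intro: open_mass_mono)

lemma zero_in_below: "0 \<in> below U"
  by (simp add: below_def)

lemma open_mass_empty: "open_mass {} = 0"
proof -
  have "below {} = {0}"
    by (auto simp: below_def intro!: bcontfun_eqI order_antisym)
  then show ?thesis
    by (simp add: open_mass_def linear_0[OF lin])
qed

lemma open_mass_UNIV: "open_mass UNIV = ennreal (\<phi> (const_bcontfun 1))"
proof (rule antisym)
  show "open_mass UNIV \<le> ennreal (\<phi> (const_bcontfun 1))"
    unfolding open_mass_def by (intro SUP_least ennreal_leI mono) (auto simp: below_def)
  show "ennreal (\<phi> (const_bcontfun 1)) \<le> open_mass UNIV"
    unfolding open_mass_def by (intro SUP_upper) (auto simp: below_def)
qed

lemma \<phi>_le_open_mass: "f \<in> below U \<Longrightarrow> ennreal (\<phi> f) \<le> open_mass U"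
  unfolding open_mass_def by (rule SUP_upper)

text \<open>
  A function below the indicator of \<open>\<Union>i. U i\<close> is, by compactness and up to a uniform error,
  below a finite sum of continuous functions that are below the indicators of the single \<open>U i\<close>.
\<close>

lemma open_mass_UN_le:
  assumes "\<And>i::nat. open (U i)"
  shows "open_mass (\<Union>i. U i) \<le> (\<Sum>i. open_mass (U i))"
  unfolding open_mass_def[of "\<Union>i. U i"]
proof (rule SUP_least)
  fix f assume f: "f \<in> below (\<Union>i. U i)"
  obtain g where "\<And>i. increases_to_indicator (g i) (U i)"
    using open_indicator_increasing_limit[OF assms] by metis
  then have g: "\<And>i k x. 0 \<le> apply_bcontfun (g i k) x"
      "\<And>i k x. apply_bcontfun (g i k) x \<le> indicator (U i) x"
      "\<And>i k l x. k \<le> l \<Longrightarrow> apply_bcontfun (g i k) x \<le> apply_bcontfun (g i l) x"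
      "\<And>i x. x \<in> U i \<Longrightarrow> \<exists>k. apply_bcontfun (g i k) x = 1"
    unfolding increases_to_indicator_def by blast+
  define s where "s k = (\<Sum>i<k. g i k)" for k
  have sum_app: "apply_bcontfun (\<Sum>i<n. h i) x = (\<Sum>i<n. apply_bcontfun (h i) x)"
    for h :: "nat \<Rightarrow> 'a \<Rightarrow>\<^sub>C real" and n x
    by (induct n) simp_all
  have s_mono: "s k x \<le> s l x" if "k \<le> l" for k l x
    unfolding s_def sum_app using that g(1)
    by (intro order_trans[OF sum_mono sum_mono2] g(3)) auto
  show "ennreal (\<phi> f) \<le> (\<Sum>i. open_mass (U i))"
  proof (rule ennreal_le_epsilon)
    fix e :: real assume "0 < e"
    define d where "d = e / (1 + \<phi> (const_bcontfun 1))"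
    have c0: "0 \<le> \<phi> (const_bcontfun 1)" by (rule pos) simp
    have d: "0 < d" "d * \<phi> (const_bcontfun 1) \<le> e"
      using \<open>0 < e\<close> c0 by (auto simp: d_def field_simps)
    define O' where "O' k = {x. apply_bcontfun f x < s k x + d}" for k
    have O_open: "open (O' k)" for k
      unfolding O'_def by (intro open_Collect_less continuous_intros) auto
    have ub: "apply_bcontfun f x \<le> indicator (\<Union>i. U i) x" for x
      using f by (simp only: below_def mem_Collect_eq)
    have "x \<in> (\<Union>k. O' k)" for x
    proof (cases "x \<in> (\<Union>i. U i)")
      case True
      then obtain i where i: "x \<in> U i" by auto
      then obtain k where k: "g i k x = 1" using g(4) by blast
      define l where "l = Suc (max i k)"
      have "f x \<le> 1" using ub True by (metis indicator_simps(1))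
      also have "1 \<le> g i l x" using g(3)[of k l i x] k by (simp add: l_def)
      also have "\<dots> \<le> s l x"
        unfolding s_def sum_app using g(1)
        by (intro member_le_sum) (auto simp: l_def)
      finally show ?thesis using d by (auto simp: O'_def intro!: exI[of _ l])
    next
      case False
      then have "f x \<le> 0" using ub by (metis indicator_simps(2))
      moreover have "0 \<le> s 0 x" by (simp add: s_def)
      ultimately show ?thesis using d by (auto simp: O'_def intro!: exI[of _ 0])
    qed
    then obtain N where N: "finite N" "UNIV \<subseteq> (\<Union>k\<in>N. O' k)"
      using compactE_image[OF cpt, of UNIV O'] O_open by (metis UNIV_I subsetI top_greatest)
    define k where "k = Max (insert 0 N)"
    have "apply_bcontfun f x \<le> s k x + d" for x
    proof -
      obtain l where l: "l \<in> N" "f x < s l x + d" using N(2) by (auto simp: O'_def)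
      have "s l x \<le> s k x" using N(1) l(1) by (intro s_mono) (simp add: k_def)
      with l show ?thesis by simp
    qed
    then have "\<phi> f \<le> \<phi> (s k + d *\<^sub>R const_bcontfun 1)" by (intro mono) simp
    also have "\<dots> = (\<Sum>i<k. \<phi> (g i k)) + d * \<phi> (const_bcontfun 1)"
      by (simp add: linear_add[OF lin] linear_cmul[OF lin] s_def linear_sum[OF lin])
    also have "\<dots> \<le> (\<Sum>i<k. \<phi> (g i k)) + e" using d by simp
    finally have "ennreal (\<phi> f) \<le> ennreal ((\<Sum>i<k. \<phi> (g i k)) + e)"
      by (rule ennreal_leI)
    also have "\<dots> = (\<Sum>i<k. ennreal (\<phi> (g i k))) + ennreal e"
      using \<open>0 < e\<close> g(1) by (subst ennreal_plus) (auto intro!: sum_nonneg pos sum_ennreal[symmetric])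
    also have "(\<Sum>i<k. ennreal (\<phi> (g i k))) \<le> (\<Sum>i<k. open_mass (U i))"
      using g(1,2) by (intro sum_mono \<phi>_le_open_mass) (auto simp: below_def)
    also have "\<dots> \<le> (\<Sum>i. open_mass (U i))"
      by (rule sum_le_suminf) auto
    finally show "ennreal (\<phi> f) \<le> (\<Sum>i. open_mass (U i)) + ennreal e"
      by (simp add: add_right_mono)
  qed
qed

lemma outer_measure_outer: "outer_measure_space (Pow UNIV) outer"
  unfolding outer_measure_space_def positive_def increasing_def countably_subadditive_def
proof (intro conjI allI ballI impI)
  show "outer {} = 0" by (simp add: outer_open open_mass_empty)
  show "outer x \<le> outer y" if "x \<subseteq> y" for x y by (rule outer_mono[OF that])
  fix A :: "nat \<Rightarrow> 'a set"
  show "outer (\<Union>i. A i) \<le> (\<Sum>i. outer (A i))"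
  proof (rule ennreal_le_epsilon)
    fix e :: real assume fin: "(\<Sum>i. outer (A i)) < top" and "0 < e"
    (* the errors e / 2 ^ (i + 1) add up to e *)
    have "\<exists>U. open U \<and> A i \<subseteq> U \<and> open_mass U \<le> outer (A i) + ennreal (e * (1/2) ^ Suc i)" for i
    proof -
      have "outer (A i) \<noteq> top"
        using ennreal_suminf_lessD[OF fin, of i] by simp
      moreover have "0 < e * (1/2) ^ Suc i" using \<open>0 < e\<close> by simp
      ultimately have "\<exists>U\<in>{U. open U \<and> A i \<subseteq> U}. open_mass U < outer (A i) + ennreal (e * (1/2) ^ Suc i)"
        using INF_approx_ennreal[of "e * (1/2) ^ Suc i" "outer (A i)"] outer_def[of "A i"]
        unfolding infinity_ennreal_def by blast
      then show ?thesis by (auto intro: less_imp_le)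
    qed
    then obtain U where U: "\<And>i. open (U i)" "\<And>i. A i \<subseteq> U i"
      "\<And>i. open_mass (U i) \<le> outer (A i) + ennreal (e * (1/2) ^ Suc i)" by metis
    have "outer (\<Union>i. A i) \<le> open_mass (\<Union>i. U i)"
      unfolding outer_def using U by (intro INF_lower) auto
    also have "\<dots> \<le> (\<Sum>i. open_mass (U i))" by (rule open_mass_UN_le[OF U(1)])
    also have "\<dots> \<le> (\<Sum>i. outer (A i) + ennreal (e * (1/2) ^ Suc i))"
      by (intro suminf_le U) auto
    also have "\<dots> = (\<Sum>i. outer (A i)) + (\<Sum>i. ennreal (e * (1/2) ^ Suc i))"
      by (intro suminf_add[symmetric]) auto
    also have "(\<Sum>i. ennreal (e * (1/2) ^ Suc i)) = ennreal e"
      using sums_mult[OF power_half_series, of e] \<open>0 < e\<close>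
      by (intro suminf_ennreal_eq) auto
    finally show "outer (\<Union>i. A i) \<le> (\<Sum>i. outer (A i)) + ennreal e" .
  qed
qed

text \<open>
  Lowering a function \<open>f\<close> below the indicator of \<open>W \<inter> U\<close> by a small constant confines its support to
  a closed set \<open>K \<subseteq> W \<inter> U\<close>.  Every function below the indicator of \<open>W - K\<close>, an open set containing
  \<open>W - U\<close>, can then be added to it without exceeding the indicator of \<open>W\<close>.
\<close>

lemma open_mass_split:
  assumes W: "open W" and U: "open U"
  shows "open_mass (W \<inter> U) + outer (W - U) \<le> open_mass W"
proof -
  have "ennreal (\<phi> f) + outer (W - U) \<le> open_mass W" if f: "f \<in> below (W \<inter> U)" for f
  proof (rule ennreal_le_epsilon)
    fix e :: real assume "0 < e"
    define d where "d = e / (1 + \<phi> (const_bcontfun 1))"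
    have c0: "0 \<le> \<phi> (const_bcontfun 1)" by (rule pos) simp
    have d: "0 < d" "d * \<phi> (const_bcontfun 1) \<le> e"
      using \<open>0 < e\<close> c0 by (auto simp: d_def field_simps)
    define f' where "f' = Bcontfun (\<lambda>x. max (f x - d) 0)"
    have f': "f' x = max (f x - d) 0" for x
      unfolding f'_def by (subst apply_Bcontfun[OF cpt]) (auto intro!: continuous_intros)
    define K where "K = {x. d \<le> f x}"
    have K: "closed K" "K \<subseteq> W \<inter> U"
    proof -
      show "closed K" unfolding K_def by (intro closed_Collect_le continuous_intros) auto
      show "K \<subseteq> W \<inter> U"
      proof
        fix x assume "x \<in> K"
        then have "0 < f x" using d by (auto simp: K_def)
        moreover have "f x \<le> indicator (W \<inter> U) x" using f by (auto simp: below_def)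
        ultimately have "0 < (indicator (W \<inter> U) x :: real)" by linarith
        then show "x \<in> W \<inter> U" by (metis indicator_simps(2) less_irrefl)
      qed
    qed
    have sum_in: "f' + g \<in> below W" if g: "g \<in> below (W - K)" for g
      unfolding below_def
    proof (clarsimp)
      fix x
      have gx: "0 \<le> g x" "g x \<le> indicator (W - K) x"
        and fx: "0 \<le> f x" "f x \<le> indicator (W \<inter> U) x" using f g by (auto simp: below_def)
      show "0 \<le> f' x + g x \<and> f' x + g x \<le> indicator W x"
      proof (cases "x \<in> K")
        case True
        then have W: "indicator W x = (1::real)" and "indicator (W - K) x = (0::real)"
          using K by auto
        then have "g x = 0" using gx by linarith
        moreover have "indicator (W \<inter> U) x \<le> (1::real)" by (rule indicator_le_1)
        then have "f x \<le> 1" using fx(2) by linarith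
        ultimately show ?thesis using d(1) W by (simp add: f')
      next
        case False
        then have "f' x = 0" "indicator (W - K) x = (indicator W x :: real)"
          by (simp_all add: f' K_def indicator_def)
        then show ?thesis using gx by linarith
      qed
    qed
    have "ennreal (\<phi> f') + open_mass (W - K) = (SUP g\<in>below (W - K). ennreal (\<phi> f') + ennreal (\<phi> g))"
      unfolding open_mass_def using zero_in_below by (intro ennreal_SUP_add_right) auto
    also have "\<dots> \<le> open_mass W"
    proof (rule SUP_least)
      fix g assume g: "g \<in> below (W - K)"
      have "ennreal (\<phi> f') + ennreal (\<phi> g) = ennreal (\<phi> (f' + g))"
        using g by (subst ennreal_plus[symmetric]) (auto intro!: pos simp: f' below_def linear_add[OF lin])
      also have "\<dots> \<le> open_mass W" by (rule \<phi>_le_open_mass[OF sum_in[OF g]])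
      finally show "ennreal (\<phi> f') + ennreal (\<phi> g) \<le> open_mass W" .
    qed
    finally have 1: "ennreal (\<phi> f') + open_mass (W - K) \<le> open_mass W" .
    have "outer (W - U) \<le> open_mass (W - K)"
      unfolding outer_def using K W by (intro INF_lower) (auto intro: open_Diff)
    moreover have "\<phi> f \<le> \<phi> (f' + d *\<^sub>R const_bcontfun 1)" by (intro mono) (simp add: f')
    then have "\<phi> f \<le> \<phi> f' + e" using d by (simp add: linear_add[OF lin] linear_cmul[OF lin])
    then have "ennreal (\<phi> f) \<le> ennreal (\<phi> f') + ennreal e"
      using \<open>0 < e\<close> by (subst ennreal_plus[symmetric]) (auto intro!: pos ennreal_leI simp: f')
    ultimately have "ennreal (\<phi> f) + outer (W - U) \<le> ennreal (\<phi> f') + ennreal e + open_mass (W - K)"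
      by (rule add_mono[rotated])
    also have "\<dots> \<le> open_mass W + ennreal e" using 1
      by (metis add.assoc add.commute add_right_mono)
    finally show "ennreal (\<phi> f) + outer (W - U) \<le> open_mass W + ennreal e" .
  qed
  moreover have "open_mass (W \<inter> U) + outer (W - U) = (SUP f\<in>below (W \<inter> U). ennreal (\<phi> f) + outer (W - U))"
    unfolding open_mass_def using zero_in_below by (subst ennreal_SUP_add_left[symmetric]) auto
  ultimately show ?thesis by (auto intro: SUP_least)
qed

lemma outer_split:
  assumes U: "open U"
  shows "outer (U \<inter> A) + outer ((UNIV - U) \<inter> A) = outer A"
proof (rule antisym)
  show "outer (U \<inter> A) + outer ((UNIV - U) \<inter> A) \<le> outer A"
    unfolding outer_def[of A]
  proof (rule INF_greatest, clarsimp)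
    fix W assume W: "open W" "A \<subseteq> W"
    have "outer (U \<inter> A) + outer ((UNIV - U) \<inter> A) \<le> outer (W \<inter> U) + outer (W - U)"
      using W by (intro add_mono outer_mono) auto
    also have "outer (W \<inter> U) = open_mass (W \<inter> U)" using W U by (simp add: outer_open open_Int)
    also have "open_mass (W \<inter> U) + outer (W - U) \<le> open_mass W" by (rule open_mass_split[OF W(1) U])
    finally show "outer (U \<inter> A) + outer ((UNIV - U) \<inter> A) \<le> open_mass W" .
  qed
  interpret sigma_algebra "UNIV :: 'a set" "Pow UNIV" by (rule sigma_algebra_Pow)
  have "subadditive (Pow UNIV) outer"
    using outer_measure_outer unfolding outer_measure_space_def
    by (intro countably_subadditive_subadditive) auto
  then have "outer ((U \<inter> A) \<union> ((UNIV - U) \<inter> A)) \<le> outer (U \<inter> A) + outer ((UNIV - U) \<inter> A)"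
    by (rule subadditiveD) auto
  moreover have "(U \<inter> A) \<union> ((UNIV - U) \<inter> A) = A" by auto
  ultimately show "outer A \<le> outer (U \<inter> A) + outer ((UNIV - U) \<inter> A)" by simp
qed

lemma outer_borel_measure:
  obtains M where "sets M = sets borel" "\<And>U. open U \<Longrightarrow> emeasure M U = open_mass U"
proof -
  interpret sigma_algebra "UNIV :: 'a set" "Pow UNIV" by (rule sigma_algebra_Pow)
  define L where "L = lambda_system UNIV (Pow (UNIV :: 'a set)) outer"
  have ms: "measure_space UNIV L outer"
    unfolding L_def by (rule caratheodory_lemma[OF outer_measure_outer])
  then interpret L: sigma_algebra UNIV L by (simp add: measure_space_def)
  have "{S. open S} \<subseteq> L" by (auto simp: L_def lambda_system_def outer_split)
  then have sub: "sets (borel :: 'a measure) \<subseteq> L"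
    unfolding borel_def by (simp add: L.sigma_sets_subset)
  define M where "M = measure_of UNIV (sets (borel :: 'a measure)) outer"
  have sM: "sets M = sets borel" using sets.sigma_sets_eq[of "borel :: 'a measure"] by (simp add: M_def)
  have "positive (sets M) outer" "countably_additive (sets M) outer"
    using ms sub by (auto simp: measure_space_def sM positive_def countably_additive_def)
  note meas = this
  have emM: "emeasure M A = outer A" if "A \<in> sets borel" for A
    by (rule emeasure_measure_of[OF M_def]) (use that meas in \<open>auto simp: sM\<close>)
  show ?thesis by (rule that[OF sM]) (simp add: outer_open emM)
qed

text \<open>
  The integral against the constructed measure is bounded by the functional: cut \<open>f\<close> horizontally
  into slices of height \<open>1/n\<close> and compare each slice with the indicator of a superlevel set.
\<close>

lemma integral_le_functional:
  assumes M: "sets M = sets borel" "\<And>U. open U \<Longrightarrow> emeasure M U = open_mass U"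
    and f: "\<And>x. 0 \<le> apply_bcontfun f x" "\<And>x. apply_bcontfun f x \<le> 1"
  shows "(\<integral>x. f x \<partial>M) \<le> \<phi> f"
proof (rule field_le_epsilon)
  fix e :: real assume "0 < e"
  have fin: "finite_measure M"
    using M(2)[of UNIV] by (intro finite_measureI) (simp add: open_mass_UNIV sets_eq_imp_space_eq[OF M(1)])
  then interpret finite_measure M .
  have [measurable_cong]: "sets M = sets borel" by (rule M)
  have [measurable]: "apply_bcontfun g \<in> borel_measurable M" for g :: "'a \<Rightarrow>\<^sub>C real"
    by (simp add: borel_measurable_continuous_onI measurable_cong_sets[OF M(1) refl])
  have int: "integrable M (apply_bcontfun g)" for g :: "'a \<Rightarrow>\<^sub>C real"
    using norm_bounded[of g] by (intro integrable_const_bound[of _ "norm g"]) auto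
  (* the slices have height 1 / n, and the error of the comparison is the total mass divided by n *)
  obtain n :: nat where n: "0 < n" "measure M UNIV / e < real n"
    using reals_Archimedean2[of "max 1 (measure M UNIV / e)"] by (metis max_less_iff_conj not_gr_zero of_nat_0 not_one_less_zero)
  define U where "U i = {x. real i / real n < f x}" for i
  have U: "open (U i)" for i unfolding U_def by (intro open_Collect_less continuous_intros) auto
  define s where "s i = Bcontfun (\<lambda>x. min (f x) (real i / real n))" for i
  have s: "s i x = min (f x) (real i / real n)" for i x
    unfolding s_def by (subst apply_Bcontfun[OF cpt]) (auto intro!: continuous_intros)
  have mU: "measure M (U (Suc i)) / real n \<le> \<phi> (s (Suc i) - s i)" for i
  proof -
    have "open_mass (U (Suc i)) \<le> ennreal (\<phi> (real n *\<^sub>R (s (Suc i) - s i)))"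
      unfolding open_mass_def
    proof (intro SUP_least ennreal_leI mono)
      fix g x assume g: "g \<in> below (U (Suc i))"
      then have gx: "g x \<le> indicator (U (Suc i)) x" by (simp add: below_def)
      have nn: "0 \<le> s (Suc i) x - s i x"
        using divide_right_mono[of "real i" "real (Suc i)" "real n"] unfolding s by linarith
      show "apply_bcontfun g x \<le> (real n *\<^sub>R (s (Suc i) - s i)) x"
      proof (cases "x \<in> U (Suc i)")
        case True
        have "real i / real n \<le> real (Suc i)  / real n" by (simp add: divide_right_mono)
        then have "s (Suc i) x - s i x = 1 / real n" using True n by (auto simp: s U_def min_def field_simps)
        then show ?thesis using gx True n by simp
      next
        case False
        then show ?thesis using gx nn by (simp add: order_trans[OF _ mult_nonneg_nonneg])
      qed
    qed
    moreover have "0 \<le> \<phi> (s (Suc i) - s i)" 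
    proof (rule pos)
      show "0 \<le> (s (Suc i) - s i) x" for x
        using divide_right_mono[of "real i" "real (Suc i)" "real n"] unfolding s minus_bcontfun.rep_eq by linarith
    qed
    ultimately have "measure M (U (Suc i)) \<le> real n * \<phi> (s (Suc i) - s i)"
      unfolding M(2)[OF U, symmetric] linear_cmul[OF lin] emeasure_eq_measure
      by (simp add: ennreal_le_iff)
    then show ?thesis using n by (simp add: field_simps)
  qed
  have le: "apply_bcontfun f x \<le> 1 / real n + (\<Sum>i<n. indicator (U (Suc i)) x / real n)" for x
  proof -
    (* x lies in exactly the first k - 1 of the superlevel sets *)
    define k where "k = nat \<lceil>real n * f x\<rceil>"
    have k1: "real n * f x \<le> real k" unfolding k_def by linarith
    have k2: "real k < real n * f x + 1"
    proof -
      have "0 \<le> real n * f x" using f(1)[of x] by simp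
      then show ?thesis unfolding k_def by linarith
    qed
    have sub: "i \<in> {..<n} \<and> x \<in> U (Suc i)" if "i < k - 1" for i
    proof -
      have "real (Suc i) < real n * f x" using that k2 by linarith
      moreover have "real n * f x \<le> real n" using f(2)[of x] by (simp add: mult_left_le)
      ultimately have "real (Suc i) < real n" by linarith
      then show ?thesis using \<open>real (Suc i) < real n * f x\<close> n by (simp add: U_def field_simps)
    qed
    have "real k - 1 \<le> real (card {..<k - 1})" by (simp add: of_nat_diff) 
    also have "\<dots> = (\<Sum>i<k-1. indicator (U (Suc i)) x)" using sub by simp
    also have "\<dots> \<le> (\<Sum>i<n. indicator (U (Suc i)) x)" 
    proof (rule sum_mono2)
      show "{..<k-1} \<subseteq> {..<n}" using sub by (intro subsetI) (simp only: lessThan_iff)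
    qed auto
    finally have "real n * f x \<le> 1 + (\<Sum>i<n. indicator (U (Suc i)) x)" using k1 by simp
    then show ?thesis using n by (simp add: sum_divide_distrib[symmetric] field_simps)
  qed
  have "(\<integral>x. f x \<partial>M) \<le> (\<integral>x. 1 / real n + (\<Sum>i<n. indicator (U (Suc i)) x / real n) \<partial>M)"
    using le U M(1) by (intro integral_mono int) (auto intro!: Bochner_Integration.integrable_add integrable_divide Bochner_Integration.integrable_sum integrable_real_indicator simp: emeasure_eq_measure)
  also have "\<dots> = measure M UNIV / real n + (\<Sum>i<n. measure M (U (Suc i)) / real n)"
    using U M(1) by (subst Bochner_Integration.integral_add) 
      (auto simp: sets_eq_imp_space_eq[OF M(1)] emeasure_eq_measure intro!: integrable_divide Bochner_Integration.integrable_sum integrable_real_indicator)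
  also have "(\<Sum>i<n. measure M (U (Suc i)) / real n) \<le> (\<Sum>i<n. \<phi> (s (Suc i) - s i))" by (intro sum_mono mU)
  also have "\<dots> = \<phi> (s n) - \<phi> (s 0)"
    using sum_lessThan_telescope[of "\<lambda>i. \<phi> (s i)" n] by (simp add: linear_diff[OF lin])
  also have "s n = f" using f n by (intro bcontfun_eqI) (simp add: s min_def)
  also have "s 0 = 0" using f n by (intro bcontfun_eqI) (simp add: s min_absorb2)
  also have "measure M UNIV / real n \<le> e" using n \<open>0 < e\<close> by (simp add: field_simps)
  finally show "(\<integral>x. f x \<partial>M) \<le> \<phi> f + e" by (simp add: linear_0[OF lin])
qed

text \<open>
  For \<open>0 \<le> f \<le> 1\<close> the inequality of \<open>integral_le_functional\<close> holds for \<open>f\<close> and for \<open>1 - f\<close>, and the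
  two sides have the same sum, the total mass; hence both are equalities.
\<close>

theorem riesz_representation:
  obtains M where "sets M = sets borel" "finite_measure M" "\<And>f. \<phi> f = (\<integral>x. apply_bcontfun f x \<partial>M)"
proof -
  obtain M where M: "sets M = sets borel" "\<And>U. open U \<Longrightarrow> emeasure M U = open_mass U"
    using outer_borel_measure by blast
  have spM: "space M = UNIV" using sets_eq_imp_space_eq[OF M(1)] by simp
  have fin: "finite_measure M"
    using M(2)[of UNIV] by (intro finite_measureI) (simp add: open_mass_UNIV spM)
  then interpret finite_measure M .
  have [measurable_cong]: "sets M = sets borel" by (rule M)
  have [measurable]: "apply_bcontfun g \<in> borel_measurable M" for g :: "'a \<Rightarrow>\<^sub>C real"
    by (simp add: borel_measurable_continuous_onI measurable_cong_sets[OF M(1) refl])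
  have int: "integrable M (apply_bcontfun g)" for g :: "'a \<Rightarrow>\<^sub>C real"
    using norm_bounded[of g] by (intro integrable_const_bound[of _ "norm g"]) auto
  have mass: "\<phi> (const_bcontfun 1) = measure M UNIV"
    using M(2)[of UNIV] pos[of "const_bcontfun 1"] by (simp add: open_mass_UNIV emeasure_eq_measure)
  have unit: "\<phi> f = (\<integral>x. f x \<partial>M)" if f: "\<And>x. 0 \<le> apply_bcontfun f x" "\<And>x. apply_bcontfun f x \<le> 1" for f
  proof (rule antisym)
    show "(\<integral>x. f x \<partial>M) \<le> \<phi> f" by (rule integral_le_functional[OF M f])
    have "(\<integral>x. (const_bcontfun 1 - f) x \<partial>M) \<le> \<phi> (const_bcontfun 1 - f)"
      using f by (intro integral_le_functional[OF M]) auto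
    then show "\<phi> f \<le> (\<integral>x. f x \<partial>M)"
      by (simp add: linear_diff[OF lin] mass Bochner_Integration.integral_diff[OF _ int] spM)
  qed
  have "\<phi> f = (\<integral>x. f x \<partial>M)" for f
  proof -
    define c where "c = 2 * norm f + 1"
    have c: "0 < c" by (simp add: c_def add_nonneg_pos)
    define g where "g = (1 / c) *\<^sub>R (f + norm f *\<^sub>R const_bcontfun 1)"
    have fx: "\<bar>f x\<bar> \<le> norm f" for x using norm_bounded[of f x] by simp
    have "\<phi> g = (\<integral>x. g x \<partial>M)"
    proof (rule unit)
      show "0 \<le> g x" for x using fx[of x] c by (simp add: g_def)
      show "g x \<le> 1" for x using fx[of x] c by (simp add: g_def c_def)
    qed
    moreover have "f = c *\<^sub>R g - norm f *\<^sub>R const_bcontfun 1"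
      using c by (intro bcontfun_eqI) (simp add: g_def)
    then have "\<phi> f = \<phi> (c *\<^sub>R g - norm f *\<^sub>R const_bcontfun 1)" by simp
    then have "\<phi> f = c * \<phi> g - norm f * measure M UNIV"
      by (simp add: linear_diff[OF lin] linear_cmul[OF lin] mass)
    moreover have "\<And>x. f x = c * g x - norm f"
      using c by (simp add: g_def)
    ultimately show ?thesis using int[of g] by (simp add: spM)
  qed
  then show ?thesis using that M(1) fin by blast
qed

end

section \<open>Strongly continuous semigroups and their bounded perturbations\<close>

instance bcontfun :: (metric_space, banach) banach ..

text \<open>
  This substitution moves the end point of an integral into the integrand, so that continuity in the
  end point becomes continuity of an integral over a fixed interval in a parameter.
\<close>

lemma integral_rescale:
  fixes g :: "real \<Rightarrow> 'b::banach"
  assumes "0 \<le> t" "continuous_on {a..a+t} g"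
  shows "integral {a..a+t} g = t *\<^sub>R integral {0..1} (\<lambda>\<sigma>. g (a + t * \<sigma>))"
proof (cases "t = 0")
  case False
  then have t: "0 < t" using assms by simp
  have "(g has_integral integral {a..a+t} g) (cbox a (a+t))"
    using integrable_integral[OF integrable_continuous_real[OF assms(2)]] by simp
  from has_integral_affinity'[OF this t, of a]
  have "((\<lambda>\<sigma>. g (a + t * \<sigma>)) has_integral (integral {a..a+t} g /\<^sub>R t)) {0..1}"
    using t by (simp add: add.commute)
  then show ?thesis using t by (simp add: integral_unique)
qed simp

lemma integral_average_tendsto:
  fixes g :: "real \<Rightarrow> 'b::banach"
  assumes "0 \<le> a" "continuous_on {0..} g"
  shows "((\<lambda>t. integral {a..a+t} g /\<^sub>R t) \<longlongrightarrow> g a) (at_right 0)"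
proof -
  have "continuous_on {0..} (\<lambda>t. integral (cbox 0 1) (\<lambda>\<sigma>. g (a + t * \<sigma>)))"
    using assms(1) by (intro integral_continuous_on_param)
      (auto intro!: continuous_intros continuous_on_compose2[OF assms(2)] simp: case_prod_unfold)
  then have "((\<lambda>t. integral (cbox 0 1) (\<lambda>\<sigma>. g (a + t * \<sigma>))) \<longlongrightarrow> integral (cbox 0 1) (\<lambda>\<sigma>. g (a + 0 * \<sigma>))) (at 0 within {0..})"
    unfolding continuous_on_def by (metis atLeast_iff order_refl)
  then have "((\<lambda>t. integral {0..1} (\<lambda>\<sigma>. g (a + t * \<sigma>))) \<longlongrightarrow> g a) (at_right 0)"
    by (intro tendsto_within_subset[of _ _ 0 "{0..}" "{0<..}"]) auto
  then show ?thesis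
  proof (rule Lim_transform_eventually)
    show "\<forall>\<^sub>F t in at_right 0. integral {0..1} (\<lambda>\<sigma>. g (a + t * \<sigma>)) = integral {a..a+t} g /\<^sub>R t"
      unfolding eventually_at_right_field
    proof (intro exI[of _ 1] conjI allI impI)
      fix t :: real assume "0 < t"
      then show "integral {0..1} (\<lambda>\<sigma>. g (a + t * \<sigma>)) = integral {a..a+t} g /\<^sub>R t"
        using assms by (subst integral_rescale) (auto intro: continuous_on_subset)
    qed simp
  qed
qed

definition has_generator_value :: "(real \<Rightarrow> 'b \<Rightarrow>\<^sub>L 'b) \<Rightarrow> 'b::real_normed_vector \<Rightarrow> 'b \<Rightarrow> bool" where
  "has_generator_value P f g \<longleftrightarrow> ((\<lambda>t. (blinfun_apply (P t) f - f) /\<^sub>R t) \<longlongrightarrow> g) (at_right 0)"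

text \<open>
  Adding a constant to the potential, to make it nonnegative, and subtracting the principal eigenvalue
  are both instances of this rescaling.
\<close>

lemma has_generator_value_exp_scale:
  assumes "has_generator_value P f g"
  shows "has_generator_value (\<lambda>t. exp (c * t) *\<^sub>R P t) f (g + c *\<^sub>R f)"
proof -
  have "((\<lambda>t. exp (c * t)) has_real_derivative c) (at 0 within {0<..})"
    by (auto intro!: derivative_eq_intros)
  then have 1: "((\<lambda>t. (exp (c * t) - 1) / t) \<longlongrightarrow> c) (at_right 0)"
    by (simp add: has_field_derivative_iff)
  have 2: "((\<lambda>t. exp (c * t)) \<longlongrightarrow> exp (c * 0)) (at_right 0)"
    by (intro tendsto_intros)
  have "((\<lambda>t. exp (c * t) *\<^sub>R ((P t f - f) /\<^sub>R t) + ((exp (c * t) - 1) / t) *\<^sub>R f)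
    \<longlongrightarrow> exp (c * 0) *\<^sub>R g + c *\<^sub>R f) (at_right 0)"
    using assms unfolding has_generator_value_def by (intro tendsto_intros 1 2)
  moreover have "exp (c * t) *\<^sub>R ((P t f - f) /\<^sub>R t) + ((exp (c * t) - 1) / t) *\<^sub>R f
      = ((exp (c * t) *\<^sub>R P t) f - f) /\<^sub>R t" for t
    by (cases "t = 0") (simp_all add: blinfun.scaleR_left algebra_simps divide_inverse)
  ultimately show ?thesis unfolding has_generator_value_def by simp
qed

locale bounded_semigroup =
  fixes P :: "real \<Rightarrow> 'b::banach \<Rightarrow>\<^sub>L 'b" and C :: real
  assumes zero: "P 0 = id_blinfun"
    and add: "\<And>s t. 0 \<le> s \<Longrightarrow> 0 \<le> t \<Longrightarrow> P (s + t) = P s o\<^sub>L P t"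
    and bound: "\<And>t. 0 \<le> t \<Longrightarrow> norm (P t) \<le> C"
    and cont0: "\<And>f. ((\<lambda>t. blinfun_apply (P t) f) \<longlongrightarrow> f) (at_right 0)"
begin

lemma C_nonneg: "0 \<le> C"
  using order_trans[OF norm_ge_zero bound[of 0]] by simp

lemma norm_apply_le: "norm (P t f) \<le> C * norm f" if "0 \<le> t"
  using order_trans[OF norm_blinfun mult_right_mono[OF bound[OF that]]] by simp

lemma apply_add: "P (s + t) f = P s (P t f)" if "0 \<le> s" "0 \<le> t"
  using add[OF that] by simp

lemma apply_zero [simp]: "P 0 f = f"
  by (simp add: zero)

lemma isCont_abs: "isCont (\<lambda>r. blinfun_apply (P \<bar>r\<bar>) f) 0"
  unfolding isCont_def LIM_eq
proof (intro allI impI)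
  fix e :: real assume "0 < e"
  then have "\<forall>\<^sub>F t in at_right 0. dist (P t f) f < e" using cont0 by (simp add: tendsto_iff)
  then obtain d where "0 < d" "\<And>t. 0 < t \<Longrightarrow> t < d \<Longrightarrow> dist (P t f) f < e"
    unfolding eventually_at_right_field by auto
  then show "\<exists>d>0. \<forall>r. r \<noteq> 0 \<and> norm (r - 0) < d \<longrightarrow> norm (P \<bar>r\<bar> f - P \<bar>0\<bar> f) < e"
    by (intro exI[of _ d]) (auto simp: dist_norm)
qed

lemma norm_diff_le:
  assumes "0 \<le> s" "0 \<le> t"
  shows "norm (P t f - P s f) \<le> C * norm (P \<bar>t - s\<bar> f - f)"
proof -
  have *: "norm (P t f - P s f) \<le> C * norm (P \<bar>t - s\<bar> f - f)" if "0 \<le> s" "s \<le> t" for s t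
  proof -
    have "P t f = P s (P (t - s) f)" using apply_add[of s "t - s"] that by simp
    then have "P t f - P s f = P s (P (t - s) f - f)" by (simp add: blinfun.diff_right)
    then show ?thesis using norm_apply_le[of s] that by simp
  qed
  show ?thesis
    using *[of s t] *[of t s] assms by (cases "s \<le> t") (auto simp: norm_minus_commute abs_minus_commute)
qed

text \<open>
  Uniform boundedness upgrades strong continuity at \<open>0\<close> to joint continuity in time and vector.
\<close>

lemma continuous_on_semigroup:
  fixes g :: "'c::topological_space \<Rightarrow> real"
  assumes g: "continuous_on S g" and h: "continuous_on S h" and nn: "\<And>x. x \<in> S \<Longrightarrow> 0 \<le> g x"
  shows "continuous_on S (\<lambda>x. blinfun_apply (P (g x)) (h x))"
  unfolding continuous_on_def
proof
  fix x assume x: "x \<in> S"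
  have gx: "(g \<longlongrightarrow> g x) (at x within S)" and hx: "(h \<longlongrightarrow> h x) (at x within S)"
    using g h x by (auto simp: continuous_on_def)
  have Pl: "((\<lambda>y. blinfun_apply (P \<bar>g y - g x\<bar>) (h x)) \<longlongrightarrow> P \<bar>g x - g x\<bar> (h x)) (at x within S)"
    using isCont_tendsto_compose[where g = "\<lambda>r. blinfun_apply (P \<bar>r\<bar>) (h x)" and l = 0
        and f = "\<lambda>y. g y - g x" and F = "at x within S"] isCont_abs[of "h x"] tendsto_diff[OF gx tendsto_const[of "g x"]]
    by simp
  have lim: "((\<lambda>y. C * norm (h y - h x) + C * norm (P \<bar>g y - g x\<bar> (h x) - h x))
      \<longlongrightarrow> C * norm (h x - h x) + C * norm (P \<bar>g x - g x\<bar> (h x) - h x)) (at x within S)"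
    by (intro tendsto_add tendsto_mult tendsto_norm tendsto_diff tendsto_const hx Pl)
  have "((\<lambda>y. P (g y) (h y) - P (g x) (h x)) \<longlongrightarrow> 0) (at x within S)"
  proof (rule Lim_null_comparison)
    show "((\<lambda>y. C * norm (h y - h x) + C * norm (P \<bar>g y - g x\<bar> (h x) - h x)) \<longlongrightarrow> 0) (at x within S)"
      using lim by simp
    have "norm (P (g y) (h y) - P (g x) (h x)) \<le> C * norm (h y - h x) + C * norm (P \<bar>g y - g x\<bar> (h x) - h x)"
      if "y \<in> S" for y
    proof -
      have "P (g y) (h y) - P (g x) (h x) = P (g y) (h y - h x) + (P (g y) (h x) - P (g x) (h x))"
        by (simp add: blinfun.diff_right)
      also have "norm \<dots> \<le> C * norm (h y - h x) + C * norm (P \<bar>g y - g x\<bar> (h x) - h x)"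
        using nn x that by (intro order_trans[OF norm_triangle_ineq] add_mono norm_apply_le norm_diff_le) auto
      finally show ?thesis .
    qed
    then show "\<forall>\<^sub>F y in at x within S. norm (P (g y) (h y) - P (g x) (h x))
        \<le> C * norm (h y - h x) + C * norm (P \<bar>g y - g x\<bar> (h x) - h x)"
      by (auto simp: eventually_at_filter intro!: always_eventually)
  qed
  then show "((\<lambda>x. P (g x) (h x)) \<longlongrightarrow> P (g x) (h x)) (at x within S)"
    by (simp add: LIM_zero_iff)
qed

lemma continuous_on_orbit: "continuous_on {0..} (\<lambda>t. blinfun_apply (P t) f)"
  by (intro continuous_on_semigroup continuous_intros) auto

text \<open>
  Shifting the orbit integral by \<open>t\<close> only moves its two end points; this puts the averages of an
  orbit into the domain of the generator and makes that domain dense.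
\<close>

lemma generator_value_orbit_integral:
  assumes h: "0 \<le> h"
  shows "has_generator_value P (integral {0..h} (\<lambda>s. P s f)) (P h f - f)"
proof -
  let ?o = "\<lambda>s. blinfun_apply (P s) f"
  have int: "?o integrable_on {a..b}" if "0 \<le> a" for a b
    using that by (intro integrable_continuous_real continuous_on_subset[OF continuous_on_orbit]) auto
  have "((\<lambda>t. integral {h..h+t} ?o /\<^sub>R t - integral {0..0+t} ?o /\<^sub>R t) \<longlongrightarrow> P h f - P 0 f) (at_right 0)"
    using h by (intro tendsto_diff integral_average_tendsto continuous_on_orbit) auto
  moreover have "\<forall>\<^sub>F t in at_right 0. integral {h..h+t} ?o /\<^sub>R t - integral {0..0+t} ?o /\<^sub>R t
      = (P t (integral {0..h} ?o) - integral {0..h} ?o) /\<^sub>R t"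
    unfolding eventually_at_right_field
  proof (intro exI[of _ 1] conjI allI impI)
    fix t :: real assume t: "0 < t"
    have "P t (integral {0..h} ?o) = integral {0..h} (\<lambda>s. P t (P s f))"
      using integral_linear[OF int[of 0 h] blinfun.bounded_linear_right[of "P t"]] by (simp add: o_def)
    also have "\<dots> = integral {0..h} (\<lambda>s. P (t + s) f)"
      using t by (intro integral_cong) (simp add: apply_add)
    also have "\<dots> = integral {t..t+h} ?o"
    proof -
      have 1: "continuous_on {t..t+h} ?o"
        using t by (intro continuous_on_semigroup continuous_on_id continuous_on_const) auto
      have 2: "continuous_on {0..0+h} (\<lambda>s. blinfun_apply (P (t + s)) f)"
        using t by (intro continuous_on_semigroup continuous_intros) auto
      show ?thesis using integral_rescale[OF h 1] integral_rescale[OF h 2] by simp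
    qed
    finally have 1: "P t (integral {0..h} ?o) = integral {t..t+h} ?o" .
    have cancel: "a + b = d \<Longrightarrow> e + f = d \<Longrightarrow> f - a = b - e" for a b d e f :: 'b
      by (simp add: algebra_simps)
    have 2: "integral {0..t} ?o + integral {t..t+h} ?o = integral {0..t+h} ?o"
      using h t by (intro Henstock_Kurzweil_Integration.integral_combine int) auto
    have 3: "integral {0..h} ?o + integral {h..h+t} ?o = integral {0..h+t} ?o"
      using h t by (intro Henstock_Kurzweil_Integration.integral_combine int) auto
    have "integral {h..h+t} ?o - integral {0..0+t} ?o = integral {t..t+h} ?o - integral {0..h} ?o"
      using cancel[OF 2 3[unfolded add.commute[of h t]]] by (simp add: add.commute[of h t])
    then show "integral {h..h+t} ?o /\<^sub>R t - integral {0..0+t} ?o /\<^sub>R t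
      = (P t (integral {0..h} ?o) - integral {0..h} ?o) /\<^sub>R t"
      unfolding 1 scaleR_diff_right[symmetric] by simp
  qed simp
  ultimately show ?thesis
    unfolding has_generator_value_def by (auto intro: Lim_transform_eventually)
qed

lemma generator_domain_dense:
  "((\<lambda>h. integral {0..h} (\<lambda>s. P s f) /\<^sub>R h) \<longlongrightarrow> f) (at_right 0)"
  using integral_average_tendsto[of 0, OF _ continuous_on_orbit, of f] by simp

lemma has_generator_value_scale:
  assumes "has_generator_value P f g"
  shows "has_generator_value P (c *\<^sub>R f) (c *\<^sub>R g)"
proof -
  have "((\<lambda>t. c *\<^sub>R ((P t f - f) /\<^sub>R t)) \<longlongrightarrow> c *\<^sub>R g) (at_right 0)"
    using assms unfolding has_generator_value_def by (intro tendsto_intros)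
  then show ?thesis
    unfolding has_generator_value_def by (simp add: blinfun.scaleR_right algebra_simps)
qed

lemma has_generator_value_orbit:
  assumes "has_generator_value P f g" "0 \<le> s"
  shows "has_generator_value P (P s f) (P s g)"
proof -
  have "((\<lambda>t. P s ((P t f - f) /\<^sub>R t)) \<longlongrightarrow> P s g) (at_right 0)"
    using assms unfolding has_generator_value_def by (intro tendsto_intros)
  moreover have "\<forall>\<^sub>F t in at_right 0. P s ((P t f - f) /\<^sub>R t) = (P t (P s f) - P s f) /\<^sub>R t"
    unfolding eventually_at_right_field
    using apply_add[of s _ f] apply_add[of _ s f] assms
    by (intro exI[of _ 1]) (auto simp: blinfun.scaleR_right blinfun.diff_right add.commute)
  ultimately show ?thesis
    unfolding has_generator_value_def by (rule Lim_transform_eventually)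
qed

end

text \<open>
  The semigroup generated by \<open>L + W\<close> with \<open>W\<close> bounded is built from the mild equation
  \<open>u t = P t f + conv u t\<close>.  Its generator is read off directly, since
  \<open>(u t - f) / t - (P t f - f) / t = conv u t / t\<close>, which tends to \<open>W f\<close>.
\<close>

locale bounded_perturbation = bounded_semigroup P C
  for P :: "real \<Rightarrow> 'a::banach \<Rightarrow>\<^sub>L 'a" and C +
  fixes W :: "'a \<Rightarrow>\<^sub>L 'a"
begin

text \<open>
  The exponential weight that makes the convolution term a contraction with factor \<open>1/2\<close>; the
  summand \<open>1\<close> keeps it positive when \<open>W = 0\<close>.
\<close>

definition growth :: real where "growth = 2 * C * norm W + 1"

lemma growth: "0 < growth" "2 * (C * norm W) \<le> growth"
  using C_nonneg by (auto simp: growth_def intro!: add_nonneg_pos)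

definition conv :: "(real \<Rightarrow> 'a) \<Rightarrow> real \<Rightarrow> 'a" where
  "conv u t = integral {0..t} (\<lambda>s. P (t - s) (W (u s)))"

lemma conv_integrand_continuous:
  assumes "continuous_on {0..} u"
  shows "continuous_on {0..t} (\<lambda>s. blinfun_apply (P (t - s)) (W (u s)))"
  by (intro continuous_on_semigroup continuous_intros continuous_on_subset[OF assms]) auto

lemma conv_rescale:
  assumes "0 \<le> t" "continuous_on {0..} u"
  shows "conv u t = t *\<^sub>R integral {0..1} (\<lambda>\<sigma>. P (t * (1 - \<sigma>)) (W (u (t * \<sigma>))))"
  using integral_rescale[of t 0 "\<lambda>s. P (t - s) (W (u s))"] conv_integrand_continuous[OF assms(2), of t] assms(1)
  by (simp add: conv_def algebra_simps)

lemma continuous_on_rescaled_conv: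
  assumes "continuous_on {0..} u"
  shows "continuous_on {0..} (\<lambda>t. integral {0..1} (\<lambda>\<sigma>. P (t * (1 - \<sigma>)) (W (u (t * \<sigma>)))))"
proof -
  have "continuous_on ({0..} \<times> cbox 0 1) (\<lambda>(t, \<sigma>). P (t * (1 - \<sigma>)) (W (u (t * \<sigma>))))"
    unfolding case_prod_unfold
    by (intro continuous_on_semigroup continuous_intros continuous_on_compose2[OF assms]) auto
  from integral_continuous_on_param[OF this] show ?thesis by simp
qed

lemma continuous_on_conv:
  assumes "continuous_on {0..} u"
  shows "continuous_on {0..} (conv u)"
proof -
  have "continuous_on {0..} (\<lambda>t. t *\<^sub>R integral {0..1} (\<lambda>\<sigma>. P (t * (1 - \<sigma>)) (W (u (t * \<sigma>)))))"
    by (intro continuous_intros continuous_on_rescaled_conv assms)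
  then show ?thesis
    by (rule continuous_on_eq) (simp add: conv_rescale assms)
qed

lemma norm_conv_le:
  assumes t: "0 \<le> t" and u: "continuous_on {0..} u" and M: "\<And>s. 0 \<le> s \<Longrightarrow> norm (u s) \<le> M * exp (growth * s)"
  shows "norm (conv u t) \<le> M / 2 * exp (growth * t)"
proof -
  have M0: "0 \<le> M" using order_trans[OF norm_ge_zero M[of 0]] by simp
  have int: "((\<lambda>s. C * norm W * M * exp (growth * s)) has_integral
      C * norm W * M * exp (growth * t) / growth - C * norm W * M * exp (growth * 0) / growth) {0..t}"
    using growth(1) t
    by (intro fundamental_theorem_of_calculus)
       (auto intro!: derivative_eq_intros simp flip: has_real_derivative_iff_has_vector_derivative)
  have "norm (conv u t) \<le> integral {0..t} (\<lambda>s. C * norm W * M * exp (growth * s))"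
    unfolding conv_def
  proof (rule integral_norm_bound_integral)
    show "(\<lambda>s. P (t - s) (W (u s))) integrable_on {0..t}"
      by (intro integrable_continuous_real conv_integrand_continuous u)
    show "(\<lambda>s. C * norm W * M * exp (growth * s)) integrable_on {0..t}" using int by blast
    fix s assume s: "s \<in> {0..t}"
    have "norm (P (t - s) (W (u s))) \<le> C * norm (W (u s))" using s by (intro norm_apply_le) auto
    also have "\<dots> \<le> C * (norm W * norm (u s))" by (intro mult_left_mono norm_blinfun C_nonneg)
    also have "\<dots> \<le> C * (norm W * (M * exp (growth * s)))"
      using s by (intro mult_left_mono M C_nonneg) auto
    finally show "norm (P (t - s) (W (u s))) \<le> C * norm W * M * exp (growth * s)" by (simp add: algebra_simps)
  qed
  also have "\<dots> \<le> C * norm W * M * exp (growth * t) / growth"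
    using integral_unique[OF int] growth(1) C_nonneg M0 by simp
  also have "\<dots> = (2 * (C * norm W)) / growth * (M / 2 * exp (growth * t))" by simp
  also have "\<dots> \<le> 1 * (M / 2 * exp (growth * t))"
    using growth M0 by (intro mult_right_mono) auto
  finally show ?thesis by simp
qed

definition mild :: "'a \<Rightarrow> (real \<Rightarrow> 'a) \<Rightarrow> bool" where
  "mild f u \<longleftrightarrow> continuous_on {0..} u \<and> (\<exists>M. \<forall>t\<ge>0. norm (u t) \<le> M * exp (growth * t)) \<and>
     (\<forall>t\<ge>0. u t = P t f + conv u t)"

text \<open>
  Inserting a bound with constant \<open>M\<close> into the mild equation yields one with constant
  \<open>C * norm f + M / 2\<close>; iterating leaves only the fixed point \<open>2 * C * norm f\<close>.  For \<open>f = 0\<close> this is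
  uniqueness.
\<close>

lemma mild_norm_le:
  assumes "mild f u" "0 \<le> t"
  shows "norm (u t) \<le> 2 * C * norm f * exp (growth * t)"
proof -
  obtain M where M: "\<And>t. 0 \<le> t \<Longrightarrow> norm (u t) \<le> M * exp (growth * t)"
    using assms(1) unfolding mild_def by blast
  have u: "continuous_on {0..} u" and eq: "\<And>t. 0 \<le> t \<Longrightarrow> u t = P t f + conv u t"
    using assms(1) by (auto simp: mild_def)
  have step: "norm (u t) \<le> (C * norm f + M' / 2) * exp (growth * t)"
    if "\<And>t. 0 \<le> t \<Longrightarrow> norm (u t) \<le> M' * exp (growth * t)" "0 \<le> t" for M' t
  proof -
    have "norm (u t) \<le> C * norm f + M' / 2 * exp (growth * t)"
      unfolding eq[OF that(2)] using that
      by (intro order_trans[OF norm_triangle_ineq] add_mono norm_apply_le norm_conv_le u)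
    also have "C * norm f \<le> C * norm f * exp (growth * t)"
      using mult_left_mono[of 1 "exp (growth * t)" "C * norm f"] C_nonneg growth that by simp
    finally show ?thesis by (simp add: algebra_simps)
  qed
  have "norm (u t) \<le> (2 * C * norm f + M * (1/2) ^ n) * exp (growth * t)" if "0 \<le> t" for n t
    using that
  proof (induction n arbitrary: t)
    case 0
    have "norm (u t) \<le> M * exp (growth * t)" by (rule M[OF 0])
    also have "\<dots> \<le> (2 * C * norm f + M * (1/2) ^ 0) * exp (growth * t)"
      using C_nonneg by (intro mult_right_mono) auto
    finally show ?case .
  next
    case (Suc n)
    have "norm (u t) \<le> (C * norm f + (2 * C * norm f + M * (1/2) ^ n) / 2) * exp (growth * t)"
      by (rule step[OF Suc])
    then show ?case by (simp add: field_simps)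
  qed
  moreover have "(\<lambda>n. (2 * C * norm f + M * (1/2) ^ n) * exp (growth * t))
      \<longlonglongrightarrow> (2 * C * norm f + M * 0) * exp (growth * t)"
    by (intro tendsto_intros LIMSEQ_power_zero) simp
  ultimately show ?thesis using assms(2)
    by (intro LIMSEQ_le_const[of "\<lambda>n. (2 * C * norm f + M * (1/2) ^ n) * exp (growth * t)"]) auto
qed

lemma conv_lincomb:
  assumes "continuous_on {0..} u" "continuous_on {0..} w"
  shows "conv (\<lambda>s. a *\<^sub>R u s + b *\<^sub>R w s) t = a *\<^sub>R conv u t + b *\<^sub>R conv w t"
proof -
  have int: "(\<lambda>s. P (t - s) (W (v s))) integrable_on {0..t}" if "continuous_on {0..} v" for v
    by (intro integrable_continuous_real conv_integrand_continuous that)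
  show ?thesis
    unfolding conv_def
    using int[OF assms(1)] int[OF assms(2)]
    by (simp add: blinfun.add_right blinfun.scaleR_right integral_add integrable_cmul)
qed

lemma mild_lincomb:
  assumes "mild f u" "mild g w"
  shows "mild (a *\<^sub>R f + b *\<^sub>R g) (\<lambda>t. a *\<^sub>R u t + b *\<^sub>R w t)"
  unfolding mild_def
proof (intro conjI allI impI)
  have cu: "continuous_on {0..} u" and cw: "continuous_on {0..} w"
    using assms by (auto simp: mild_def)
  show "continuous_on {0..} (\<lambda>t. a *\<^sub>R u t + b *\<^sub>R w t)" by (intro continuous_intros cu cw)
  show "\<exists>M. \<forall>t\<ge>0. norm (a *\<^sub>R u t + b *\<^sub>R w t) \<le> M * exp (growth * t)"
  proof (intro exI[of _ "\<bar>a\<bar> * (2 * C * norm f) + \<bar>b\<bar> * (2 * C * norm g)"] allI impI)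
    fix t :: real assume t: "0 \<le> t"
    have "norm (a *\<^sub>R u t + b *\<^sub>R w t) \<le> \<bar>a\<bar> * norm (u t) + \<bar>b\<bar> * norm (w t)"
      using norm_triangle_ineq[of "a *\<^sub>R u t" "b *\<^sub>R w t"] by simp
    also have "\<dots> \<le> \<bar>a\<bar> * (2 * C * norm f * exp (growth * t)) + \<bar>b\<bar> * (2 * C * norm g * exp (growth * t))"
      by (intro add_mono mult_left_mono mild_norm_le[OF _ t] assms) auto
    finally show "norm (a *\<^sub>R u t + b *\<^sub>R w t)
      \<le> (\<bar>a\<bar> * (2 * C * norm f) + \<bar>b\<bar> * (2 * C * norm g)) * exp (growth * t)" by (simp add: algebra_simps)
  qed
  fix t :: real assume "0 \<le> t"
  then have "u t = P t f + conv u t" "w t = P t g + conv w t" using assms by (auto simp: mild_def)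
  then have "a *\<^sub>R u t + b *\<^sub>R w t = a *\<^sub>R (P t f + conv u t) + b *\<^sub>R (P t g + conv w t)" by simp
  then show "a *\<^sub>R u t + b *\<^sub>R w t = P t (a *\<^sub>R f + b *\<^sub>R g) + conv (\<lambda>t. a *\<^sub>R u t + b *\<^sub>R w t) t"
    by (simp add: conv_lincomb[OF cu cw] blinfun.add_right blinfun.scaleR_right algebra_simps)
qed

lemma mild_unique:
  assumes "mild f u" "mild f w" "0 \<le> t"
  shows "u t = w t"
  using mild_norm_le[OF mild_lincomb[OF assms(1,2), of 1 "-1"] assms(3)] by simp

text \<open>
  The mild equation for \<open>u\<close> is a fixed point equation for the bounded continuous function
  \<open>v t = exp (- growth * t) *\<^sub>R u t\<close>, whose right-hand side is a contraction with factor \<open>1/2\<close>.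
  Banach's theorem is applied inside the closed set of functions with values in the cone \<open>K\<close>, so
  that positivity comes with existence; for \<open>F = {}\<close> there is no restriction.
\<close>

lemma mild_exists:
  fixes F :: "('a \<Rightarrow> real) set"
  defines "K \<equiv> {f. \<forall>l\<in>F. 0 \<le> l f}"
  assumes F: "\<And>l. l \<in> F \<Longrightarrow> bounded_linear l"
    and PK: "\<And>t f. 0 \<le> t \<Longrightarrow> f \<in> K \<Longrightarrow> P t f \<in> K"
    and WK: "\<And>f. f \<in> K \<Longrightarrow> W f \<in> K"
    and f: "f \<in> K"
  shows "\<exists>u. mild f u \<and> (\<forall>t\<ge>0. u t \<in> K)"
proof -
  define lift :: "(real \<Rightarrow>\<^sub>C 'a) \<Rightarrow> real \<Rightarrow> 'a" where "lift v s = exp (growth * s) *\<^sub>R v s" for v s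
  define \<Phi>' where "\<Phi>' v t = exp (- growth * max 0 t) *\<^sub>R (P (max 0 t) f + conv (lift v) (max 0 t))" for v and t :: real
  define \<Phi> where "\<Phi> v = Bcontfun (\<Phi>' v)" for v
  have lift_cont: "continuous_on S (lift v)" for S v
    unfolding lift_def by (intro continuous_intros) auto
  have lift_bound: "norm (lift v s) \<le> norm v * exp (growth * s)" for v s
    unfolding lift_def using norm_bounded[of v s] by (simp add: mult.commute)
  have exp1: "exp (- growth * t) * exp (growth * t) = 1" for t
    by (simp add: exp_minus_inverse flip: exp_add)
  have cont: "continuous_on UNIV (\<Phi>' v)" for v
    unfolding \<Phi>'_def
    by (intro continuous_intros continuous_on_semigroup continuous_on_compose2[OF continuous_on_conv[OF lift_cont]]) auto
  have bounded: "norm (\<Phi>' v t) \<le> C * norm f + norm v / 2" for v t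
  proof -
    let ?t = "max 0 t"
    have e: "exp (- growth * ?t) \<le> 1" using growth by simp
    have "norm (\<Phi>' v t) \<le> exp (- growth * ?t) * (C * norm f + norm v / 2 * exp (growth * ?t))"
      unfolding \<Phi>'_def norm_scaleR abs_exp_cancel
      by (intro mult_left_mono order_trans[OF norm_triangle_ineq] add_mono norm_apply_le norm_conv_le lift_bound lift_cont) auto
    also have "\<dots> = exp (- growth * ?t) * (C * norm f) + norm v / 2 * (exp (- growth * ?t) * exp (growth * ?t))"
      by (simp only: algebra_simps)
    also have "\<dots> \<le> 1 * (C * norm f) + norm v / 2 * 1"
      using C_nonneg e unfolding exp1 by (intro add_mono mult_right_mono) auto
    finally show ?thesis by simp
  qed
  have \<Phi>: "apply_bcontfun (\<Phi> v) = \<Phi>' v" for v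
    unfolding \<Phi>_def by (intro Bcontfun_inverse bcontfun_normI[OF cont bounded])
  define S where "S = {v :: real \<Rightarrow>\<^sub>C 'a. \<forall>t. apply_bcontfun v t \<in> K}"
  have "\<exists>!v. v \<in> S \<and> \<Phi> v = v"
  proof (rule Banach_fix[where c = "1/2"])
    show "Topological_Spaces.complete S"
    proof -
      have "closed {v :: real \<Rightarrow>\<^sub>C 'a. 0 \<le> l (apply_bcontfun v t)}" if "l \<in> F" for l t
      proof -
        have "continuous_on UNIV (\<lambda>v :: real \<Rightarrow>\<^sub>C 'a. apply_bcontfun v t)"
          unfolding continuous_on_iff using dist_bounded by (metis le_less_trans)
        then show ?thesis
          by (intro closed_Collect_le continuous_intros bounded_linear.continuous_on[OF F[OF that]])
      qed
      moreover have "S = (\<Inter>l\<in>F. \<Inter>t. {v. 0 \<le> l (apply_bcontfun v t)})"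
        by (auto simp: S_def K_def)
      ultimately have "closed S" by (auto intro!: closed_INT)
      then show ?thesis by (simp add: complete_eq_closed)
    qed
    have "0 \<in> S" using F by (auto simp: S_def K_def linear_0 bounded_linear.linear)
    then show "S \<noteq> {}" by auto
    show "\<Phi> ` S \<subseteq> S"
    proof (intro image_subsetI)
      fix v assume v: "v \<in> S"
      have K_add: "a \<in> K \<Longrightarrow> b \<in> K \<Longrightarrow> a + b \<in> K" for a b
        using F by (auto simp: K_def linear_add bounded_linear.linear)
      have K_scale: "0 \<le> r \<Longrightarrow> a \<in> K \<Longrightarrow> r *\<^sub>R a \<in> K" for a r
        using F by (auto simp: K_def linear_scale bounded_linear.linear)
      have liftK: "lift v s \<in> K" for s
        using v unfolding lift_def by (intro K_scale) (auto simp: S_def)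
      have "conv (lift v) t \<in> K" for t
        unfolding K_def
      proof (intro CollectI ballI)
        fix l assume l: "l \<in> F"
        have int: "(\<lambda>s. P (t - s) (W (lift v s))) integrable_on {0..t}"
          by (intro integrable_continuous_real conv_integrand_continuous lift_cont)
        have "l (conv (lift v) t) = integral {0..t} (\<lambda>s. l (P (t - s) (W (lift v s))))"
          unfolding conv_def using integral_linear[OF int F[OF l]] by (simp add: o_def)
        also have "0 \<le> \<dots>"
        proof (rule Henstock_Kurzweil_Integration.integral_nonneg)
          show "(\<lambda>s. l (P (t - s) (W (lift v s)))) integrable_on {0..t}"
            using integrable_linear[OF int F[OF l]] by (simp add: o_def)
          show "0 \<le> l (P (t - s) (W (lift v s)))" if "s \<in> {0..t}" for s
            using PK[OF _ WK[OF liftK], of "t - s" s] that l by (auto simp: K_def)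
        qed
        finally show "0 \<le> l (conv (lift v) t)" .
      qed
      then have "\<Phi>' v t \<in> K" for t
        unfolding \<Phi>'_def using f by (intro K_scale K_add PK) auto
      then show "\<Phi> v \<in> S" by (simp add: S_def \<Phi>)
    qed
    show "dist (\<Phi> v) (\<Phi> w) \<le> 1/2 * dist v w" for v w
    proof (rule dist_bound)
      fix t :: real
      let ?t = "max 0 t"
      have "\<Phi>' v t - \<Phi>' w t = exp (- growth * ?t) *\<^sub>R (conv (lift v) ?t - conv (lift w) ?t)"
        by (simp add: \<Phi>'_def algebra_simps)
      have lift_diff: "(\<lambda>s. lift v s - lift w s) = lift (v - w)"
        by (simp add: lift_def fun_eq_iff algebra_simps)
      note \<open>\<Phi>' v t - \<Phi>' w t = _\<close>
      also have "conv (lift v) ?t - conv (lift w) ?t = conv (lift (v - w)) ?t"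
        using conv_lincomb[OF lift_cont[of _ v] lift_cont[of _ w], of 1 "-1" ?t]
        by (simp add: lift_diff)
      finally have "norm (\<Phi>' v t - \<Phi>' w t) = exp (- growth * ?t) * norm (conv (lift (v - w)) ?t)"
        by simp
      also have "\<dots> \<le> exp (- growth * ?t) * (norm (v - w) / 2 * exp (growth * ?t))"
        by (intro mult_left_mono norm_conv_le lift_bound lift_cont) auto
      also have "\<dots> = norm (v - w) / 2 * (exp (- growth * ?t) * exp (growth * ?t))"
        by (simp only: algebra_simps)
      also have "\<dots> = 1/2 * dist v w" unfolding exp1 by (simp add: dist_norm)
      finally show "dist (\<Phi> v t) (\<Phi> w t) \<le> 1/2 * dist v w" by (simp add: \<Phi> dist_norm)
    qed
  qed auto
  then obtain v where v: "v \<in> S" "\<Phi> v = v" by auto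
  have "mild f (lift v)"
    unfolding mild_def
  proof (intro conjI exI[of _ "norm v"] allI impI lift_cont lift_bound)
    fix t :: real assume t: "0 \<le> t"
    have "v t = \<Phi>' v t" using v \<Phi> by metis
    then show "lift v t = P t f + conv (lift v) t"
      using t exp1[of t] by (simp add: lift_def[of v t] \<Phi>'_def mult.commute)
  qed
  moreover have "lift v t \<in> K" for t
    using v(1) F by (auto simp: S_def K_def lift_def linear_scale bounded_linear.linear)
  ultimately show ?thesis by blast
qed

lemma mild_ex: "\<exists>u. mild f u"
  using mild_exists[of "{}" f] by auto

definition solution :: "'a \<Rightarrow> real \<Rightarrow> 'a" where
  "solution f = (SOME u. mild f u)"

lemma mild_solution: "mild f (solution f)"
  unfolding solution_def using mild_ex by (rule someI_ex)

definition perturbed :: "real \<Rightarrow> 'a \<Rightarrow>\<^sub>L 'a" where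
  "perturbed t = Blinfun (\<lambda>f. solution f t)"

lemma perturbed_apply: "perturbed t f = solution f t" if "0 \<le> t"
proof -
  have lc: "solution (a *\<^sub>R f + b *\<^sub>R g) t = a *\<^sub>R solution f t + b *\<^sub>R solution g t" for a b f g
    by (rule mild_unique[OF mild_solution mild_lincomb[OF mild_solution mild_solution] that])
  have "bounded_linear (\<lambda>f. solution f t)"
  proof (rule bounded_linear_intro[where K = "2 * C * exp (growth * t)"])
    show "solution (f + g) t = solution f t + solution g t" for f g using lc[of 1 f 1 g] by simp
    show "solution (r *\<^sub>R f) t = r *\<^sub>R solution f t" for r f using lc[of r f 0 f] by simp
    show "norm (solution f t) \<le> norm f * (2 * C * exp (growth * t))" for f
      using mild_norm_le[OF mild_solution that, of f] by (simp add: mult_ac)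
  qed
  then show ?thesis unfolding perturbed_def by (simp add: bounded_linear_Blinfun_apply)
qed

lemma solution_0: "solution f 0 = f"
  using mild_solution[of f] by (auto simp: mild_def conv_def)

lemma perturbed_0: "perturbed 0 = id_blinfun"
  by (rule blinfun_eqI) (simp add: perturbed_apply solution_0)

text \<open>
  The convolution integral over \<open>[0, t + r]\<close> is cut at \<open>r\<close>, and \<open>P t\<close> is pulled out of the first part.
  With uniqueness this gives the semigroup law for the solutions.
\<close>

lemma mild_shift:
  assumes "mild f u" "0 \<le> r"
  shows "mild (u r) (\<lambda>t. u (t + r))"
  unfolding mild_def
proof (intro conjI allI impI)
  have u: "continuous_on {0..} u" and eq: "\<And>t. 0 \<le> t \<Longrightarrow> u t = P t f + conv u t"
    using assms(1) by (auto simp: mild_def)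
  show cs: "continuous_on {0..} (\<lambda>t. u (t + r))"
    using assms(2) by (intro continuous_on_compose2[OF u] continuous_intros) auto
  show "\<exists>M. \<forall>t\<ge>0. norm (u (t + r)) \<le> M * exp (growth * t)"
    using mild_norm_le[OF assms(1), of "_ + r"] assms(2)
    by (intro exI[of _ "2 * C * norm f * exp (growth * r)"])
       (auto simp: exp_add[symmetric] distrib_left add.commute mult.assoc)
  fix t :: real assume t: "0 \<le> t"
  let ?g = "\<lambda>s. blinfun_apply (P (t + r - s)) (W (u s))"
  have g: "continuous_on {0..t+r} ?g" by (rule conv_integrand_continuous[OF u])
  have "integral {0..r} ?g + integral {r..t+r} ?g = integral {0..t+r} ?g"
    using t assms(2) integrable_continuous_real[OF g]
    by (intro Henstock_Kurzweil_Integration.integral_combine) auto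
  then have "conv u (t + r) = integral {0..r} ?g + integral {r..r+t} ?g"
    by (simp add: conv_def add.commute[of r t])
  also have "integral {0..r} ?g = integral {0..r} (\<lambda>s. P t (P (r - s) (W (u s))))"
    using t by (intro integral_cong) (auto simp flip: apply_add simp: add_diff_eq)
  also have "\<dots> = P t (conv u r)"
    unfolding conv_def
    using integral_linear[OF integrable_continuous_real[OF conv_integrand_continuous[OF u, of r]] blinfun.bounded_linear_right[of "P t"]]
    by (simp add: o_def)
  also have "integral {r..r+t} ?g = conv (\<lambda>t. u (t + r)) t"
  proof -
    have "continuous_on {r..r+t} ?g" using assms(2) by (intro continuous_on_subset[OF g]) auto
    from integral_rescale[OF t this] show ?thesis
      unfolding conv_rescale[OF t cs] by (simp add: algebra_simps)
  qed
  finally have "conv u (t + r) = P t (conv u r) + conv (\<lambda>t. u (t + r)) t" .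
  then show "u (t + r) = P t (u r) + conv (\<lambda>t. u (t + r)) t"
    using eq[of "t + r"] eq[of r] t assms(2) by (simp add: apply_add blinfun.add_right)
qed

lemma perturbed_add:
  assumes "0 \<le> s" "0 \<le> t"
  shows "perturbed (s + t) = perturbed s o\<^sub>L perturbed t"
proof (rule blinfun_eqI)
  fix f
  have "solution (solution f t) s = solution f (s + t)"
    by (rule mild_unique[OF mild_solution mild_shift[OF mild_solution assms(2)] assms(1)])
  then show "perturbed (s + t) f = (perturbed s o\<^sub>L perturbed t) f"
    using assms by (simp add: perturbed_apply)
qed

lemma perturbed_cont0: "((\<lambda>t. perturbed t f) \<longlongrightarrow> f) (at_right 0)"
proof -
  have "continuous_on {0..} (solution f)" using mild_solution[of f] by (simp add: mild_def)
  then have "(solution f \<longlongrightarrow> solution f 0) (at 0 within {0..})" by (simp add: continuous_on_def)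
  then have "(solution f \<longlongrightarrow> f) (at_right 0)"
    unfolding solution_0 by (rule tendsto_within_subset) auto
  then show ?thesis
    by (rule Lim_transform_eventually)
       (auto simp: eventually_at_right_field perturbed_apply intro!: exI[of _ 1])
qed

lemma perturbed_generator:
  "((\<lambda>t. (perturbed t f - f) /\<^sub>R t - (P t f - f) /\<^sub>R t) \<longlongrightarrow> W f) (at_right 0)"
proof -
  let ?u = "solution f"
  let ?c = "\<lambda>t. integral {0..1} (\<lambda>\<sigma>. P (t * (1 - \<sigma>)) (W (?u (t * \<sigma>))))"
  have u: "continuous_on {0..} ?u" and eq: "\<And>t. 0 \<le> t \<Longrightarrow> ?u t = P t f + conv ?u t"
    using mild_solution[of f] by (auto simp: mild_def)
  have "\<forall>x\<in>{0..}. (?c \<longlongrightarrow> ?c x) (at x within {0..})"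
    using continuous_on_rescaled_conv[OF u] unfolding continuous_on_def .
  then have lim: "(?c \<longlongrightarrow> ?c 0) (at 0 within {0..})" by (rule bspec) simp
  have "?c 0 = W f" by (simp add: solution_0)
  then have "(?c \<longlongrightarrow> W f) (at 0 within {0..})" using lim by (simp only:)
  then have "(?c \<longlongrightarrow> W f) (at_right 0)"
    by (rule tendsto_within_subset) auto
  then show ?thesis
  proof (rule Lim_transform_eventually)
    have "?c t = (perturbed t f - f) /\<^sub>R t - (P t f - f) /\<^sub>R t" if "0 < t" for t
    proof -
      have "perturbed t f = P t f + t *\<^sub>R ?c t"
        using that eq[of t] conv_rescale[OF _ u, of t] by (simp add: perturbed_apply)
      then have "(perturbed t f - f) /\<^sub>R t - (P t f - f) /\<^sub>R t = (t *\<^sub>R ?c t) /\<^sub>R t"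
        by (simp add: algebra_simps)
      then show ?thesis using that by simp
    qed
    then show "\<forall>\<^sub>F t in at_right 0. ?c t = (perturbed t f - f) /\<^sub>R t - (P t f - f) /\<^sub>R t"
      unfolding eventually_at_right_field by (intro exI[of _ 1]) simp
  qed
qed

lemma perturbed_preserves_cone:
  fixes F :: "('a \<Rightarrow> real) set"
  assumes "\<And>l. l \<in> F \<Longrightarrow> bounded_linear l"
    and "\<And>t f. 0 \<le> t \<Longrightarrow> \<forall>l\<in>F. 0 \<le> l f \<Longrightarrow> \<forall>l\<in>F. 0 \<le> l (P t f)"
    and "\<And>f. \<forall>l\<in>F. 0 \<le> l f \<Longrightarrow> \<forall>l\<in>F. 0 \<le> l (W f)"
    and "\<forall>l\<in>F. 0 \<le> l f" "0 \<le> t" "l \<in> F"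
  shows "0 \<le> l (perturbed t f)"
proof -
  have "\<exists>u. mild f u \<and> (\<forall>t\<ge>0. u t \<in> {f. \<forall>l\<in>F. 0 \<le> l f})"
    by (rule mild_exists) (simp_all add: assms(1-4))
  then obtain u where u: "mild f u" "\<forall>t\<ge>0. u t \<in> {f. \<forall>l\<in>F. 0 \<le> l f}" by (elim exE conjE)
  have "0 \<le> l (u t)" using u(2) assms(5,6) by simp
  then show ?thesis
    using mild_unique[OF mild_solution u(1) assms(5)] by (simp add: perturbed_apply assms(5))
qed

end

section \<open>Existence of the Schrodinger semigroup\<close>

lemma gen_domain_iff: "f \<in> gen_domain P \<longleftrightarrow> (\<exists>g. has_generator_value P f g)"
  by (simp add: gen_domain_def has_generator_value_def)

lemma gen_eq: "gen P f = g" if "has_generator_value P f g"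
  using that unfolding gen_def has_generator_value_def
  by (intro tendsto_Lim) (auto simp: trivial_limit_at_right_real)

lemma bounded_semigroup_positive_C0:
  assumes "positive_C0_semigroup Q" "\<And>t. 0 \<le> t \<Longrightarrow> norm (exp (c * t) *\<^sub>R Q t) \<le> C"
  shows "bounded_semigroup (\<lambda>t. exp (c * t) *\<^sub>R Q t) C"
proof
  show "exp (c * 0) *\<^sub>R Q 0 = id_blinfun" using assms(1) by (simp add: positive_C0_semigroup_def)
  show "exp (c * (s + t)) *\<^sub>R Q (s + t) = (exp (c * s) *\<^sub>R Q s) o\<^sub>L (exp (c * t) *\<^sub>R Q t)"
    if "0 \<le> s" "0 \<le> t" for s t
  proof (rule blinfun_eqI)
    fix f
    have "Q (s + t) = Q s o\<^sub>L Q t" using assms(1) that by (simp add: positive_C0_semigroup_def)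
    then show "(exp (c * (s + t)) *\<^sub>R Q (s + t)) f = ((exp (c * s) *\<^sub>R Q s) o\<^sub>L (exp (c * t) *\<^sub>R Q t)) f"
      by (simp add: blinfun.scaleR_left blinfun.scaleR_right distrib_left exp_add)
  qed
  show "norm (exp (c * t) *\<^sub>R Q t) \<le> C" if "0 \<le> t" for t using assms(2)[OF that] .
  fix f
  have "((\<lambda>t. norm (Q t f - f)) \<longlongrightarrow> 0) (at_right 0)"
    using assms(1) by (simp add: positive_C0_semigroup_def)
  then have "((\<lambda>t. Q t f) \<longlongrightarrow> f) (at_right 0)"
    by (simp add: tendsto_norm_zero_iff LIM_zero_iff)
  moreover have "((\<lambda>t. exp (c * t)) \<longlongrightarrow> exp (c * 0)) (at_right 0)"
    by (intro tendsto_exp tendsto_mult tendsto_const tendsto_ident_at)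
  ultimately have "((\<lambda>t. exp (c * t) *\<^sub>R Q t f) \<longlongrightarrow> exp (c * 0) *\<^sub>R f) (at_right 0)"
    by (intro tendsto_scaleR)
  then show "((\<lambda>t. (exp (c * t) *\<^sub>R Q t) f) \<longlongrightarrow> f) (at_right 0)"
    by (simp add: blinfun.scaleR_left)
qed

lemma markov_semigroup_contraction:
  assumes "markov_semigroup P" "0 \<le> t"
  shows "norm (P t) \<le> 1"
proof (rule norm_blinfun_bound)
  fix f
  let ?one = "const_bcontfun 1 :: 'a \<Rightarrow>\<^sub>C real"
  have pos: "0 \<le> P t h x" if "\<And>x. 0 \<le> apply_bcontfun h x" for h x
    using assms that by (simp add: markov_semigroup_def positive_C0_semigroup_def)
  have one: "P t ?one = ?one" using assms by (simp add: markov_semigroup_def)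
  show "norm (P t f) \<le> 1 * norm f"
  proof (rule norm_bound)
    fix x
    have fx: "\<bar>f x\<bar> \<le> norm f" for x using norm_bounded[of f x] by simp
    have "0 \<le> P t (norm f *\<^sub>R ?one - f) x"
      by (rule pos) (use fx in \<open>simp add: abs_le_iff\<close>)
    moreover have "0 \<le> P t (norm f *\<^sub>R ?one + f) x"
      by (rule pos) (use fx in \<open>simp add: abs_le_iff, smt (verit)\<close>)
    ultimately show "norm (P t f x) \<le> 1 * norm f"
      by (simp add: blinfun.diff_right blinfun.add_right blinfun.scaleR_right one abs_le_iff)
  qed
qed simp

lemma multiplication_operator:
  fixes a :: "'a::metric_space \<Rightarrow>\<^sub>C real"
  obtains W :: "('a \<Rightarrow>\<^sub>C real) \<Rightarrow>\<^sub>L ('a \<Rightarrow>\<^sub>C real)" where "\<And>f x. W f x = a x * f x"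
proof -
  define w :: "('a \<Rightarrow>\<^sub>C real) \<Rightarrow> ('a \<Rightarrow>\<^sub>C real)" where "w f = Bcontfun (\<lambda>x. a x * f x)" for f
  have bd: "norm (a x * f x) \<le> norm a * norm f" for f :: "'a \<Rightarrow>\<^sub>C real" and x
    unfolding norm_mult by (intro mult_mono norm_bounded) auto
  have w: "w f x = a x * f x" for f x
    unfolding w_def
    by (subst Bcontfun_inverse) (auto intro!: bcontfun_normI[OF _ bd] continuous_intros)
  have "bounded_linear w"
  proof (rule bounded_linear_intro[where K = "norm a"])
    show "w (f + g) = w f + w g" for f g by (rule bcontfun_eqI) (simp add: w algebra_simps)
    show "w (r *\<^sub>R f) = r *\<^sub>R w f" for r f by (rule bcontfun_eqI) (simp add: w algebra_simps)
    show "norm (w f) \<le> norm f * norm a" for f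
      by (rule norm_bound) (use bd[of _ f] in \<open>simp only: w mult.commute[of "norm f"]\<close>)
  qed
  then show ?thesis using that[of "Blinfun w"] by (simp add: bounded_linear_Blinfun_apply w)
qed

text \<open>
  Bounded perturbation preserves positivity if the perturbing operator is positive, so \<open>L + V\<close> is
  written as \<open>(L - c) + (V + c)\<close> with \<open>c = norm V\<close>.
\<close>

theorem schrodinger_semigroup_exists:
  fixes P :: "'a::metric_space op_family"
  assumes P: "markov_semigroup P"
  shows "\<exists>Q. is_schrodinger_semigroup P V Q"
proof -
  define c where "c = norm V"
  have C0: "positive_C0_semigroup P" using P by (simp add: markov_semigroup_def)
  define R where "R t = exp ((- c) * t) *\<^sub>R P t" for t
  have "norm (exp ((- c) * t) *\<^sub>R P t) \<le> 1" if "0 \<le> t" for t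
  proof -
    have "exp ((- c) * t) * norm (P t) \<le> 1 * 1"
      using that markov_semigroup_contraction[OF P that] by (intro mult_mono) (auto simp: c_def)
    then show ?thesis by simp
  qed
  then have "bounded_semigroup (\<lambda>t. exp ((- c) * t) *\<^sub>R P t) 1"
    by (rule bounded_semigroup_positive_C0[OF C0])
  then interpret R: bounded_semigroup R 1
    unfolding R_def .
  obtain W :: "('a \<Rightarrow>\<^sub>C real) \<Rightarrow>\<^sub>L ('a \<Rightarrow>\<^sub>C real)" where "\<And>f x. W f x = (V + c *\<^sub>R const_bcontfun 1) x * f x"
    using multiplication_operator[of "V + c *\<^sub>R const_bcontfun 1"] by metis
  then have W: "W f x = (V x + c) * f x" for f x by simp
  interpret R: bounded_perturbation R 1 W ..
  let ?Q = "R.perturbed"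
  let ?F = "range (\<lambda>x f. apply_bcontfun f x) :: (('a \<Rightarrow>\<^sub>C real) \<Rightarrow> real) set"
  have bl: "bounded_linear (\<lambda>f :: 'a \<Rightarrow>\<^sub>C real. apply_bcontfun f x)" for x
    by (rule bounded_linear_intro[where K = 1]) (auto simp: norm_bounded[where 'b = real, unfolded real_norm_def])
  have Rf: "R t f x = exp (- c * t) * P t f x" for t f x
    by (simp add: R_def blinfun.scaleR_left)
  have posP: "0 \<le> P t h x" if "\<And>x. 0 \<le> apply_bcontfun h x" "0 \<le> t" for h x t
    using C0 that by (simp add: positive_C0_semigroup_def)
  have pos: "0 \<le> ?Q t f x" if f: "\<And>x. 0 \<le> apply_bcontfun f x" and t: "0 \<le> t" for f t x
  proof (rule R.perturbed_preserves_cone[where F = ?F and l = "\<lambda>f. apply_bcontfun f x" and t = t])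
    show "bounded_linear l" if "l \<in> ?F" for l using that bl by auto
    show "\<forall>l\<in>?F. 0 \<le> l (R t f)" if "0 \<le> t" "\<forall>l\<in>?F. 0 \<le> l f" for t f
      using that posP[of f t] by (auto simp: Rf)
    show "\<forall>l\<in>?F. 0 \<le> l (W f)" if "\<forall>l\<in>?F. 0 \<le> l f" for f
    proof -
      have "0 \<le> V x + c" for x using norm_bounded[of V x] by (simp add: c_def abs_le_iff)
      then show ?thesis using that by (auto simp: W)
    qed
  qed (use f t in auto)
  have Qpos: "positive_C0_semigroup ?Q"
    unfolding positive_C0_semigroup_def
    using R.perturbed_0 R.perturbed_add pos R.perturbed_cont0
    by (auto simp: tendsto_norm_zero_iff LIM_zero_iff)
  have PR: "has_generator_value R f (g - c *\<^sub>R f)" if "has_generator_value P f g" for f g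
  proof -
    have "R = (\<lambda>t. exp ((- c) * t) *\<^sub>R P t)" by (simp add: R_def fun_eq_iff)
    then show ?thesis using has_generator_value_exp_scale[OF that, of "- c"] by simp
  qed
  have RP: "has_generator_value P f (g + c *\<^sub>R f)" if "has_generator_value R f g" for f g
  proof -
    have "(\<lambda>t. exp (c * t) *\<^sub>R R t) = P"
      by (simp add: R_def fun_eq_iff flip: exp_add)
    then show ?thesis using has_generator_value_exp_scale[OF that, of c] by simp
  qed
  have RQ: "has_generator_value ?Q f (g + W f)" if "has_generator_value R f g" for f g
    using tendsto_add[OF that[unfolded has_generator_value_def] R.perturbed_generator[of f]]
    by (simp add: has_generator_value_def)
  have QR: "has_generator_value R f (g - W f)" if "has_generator_value ?Q f g" for f g
    using tendsto_diff[OF that[unfolded has_generator_value_def] R.perturbed_generator[of f]]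
    by (simp add: has_generator_value_def)
  have dom: "gen_domain ?Q = gen_domain P"
    using PR RP RQ QR by (auto simp: gen_domain_iff set_eq_iff; blast)
  have "gen ?Q f x = gen P f x + V x * f x" if f: "f \<in> gen_domain P" for f x
  proof -
    obtain g where g: "has_generator_value P f g" using f by (auto simp: gen_domain_iff)
    have "gen ?Q f = g - c *\<^sub>R f + W f" by (rule gen_eq[OF RQ[OF PR[OF g]]])
    then have "gen ?Q f x = (g - c *\<^sub>R f + W f) x" by (simp only:)
    then show ?thesis using gen_eq[OF g] by (simp add: W algebra_simps)
  qed
  then have "is_schrodinger_semigroup P V ?Q"
    unfolding is_schrodinger_semigroup_def using Qpos dom by blast
  then show ?thesis by (intro exI[of _ ?Q])
qed

section \<open>The logarithmic inequality for equilibrium measures\<close>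

text \<open>
  After adding \<open>d * s\<close> to \<open>F s\<close>, the last point of \<open>[0, t]\<close> at which \<open>F\<close> has not dropped below its
  initial value must be \<open>t\<close>.
\<close>

lemma nondecreasing_from_right_slope:
  fixes F :: "real \<Rightarrow> real"
  assumes cont: "continuous_on {0..} F"
    and slope: "\<And>s e. 0 \<le> s \<Longrightarrow> 0 < e \<Longrightarrow> \<forall>\<^sub>F h in at_right 0. F s - e * h \<le> F (s + h)"
    and t: "0 \<le> t"
  shows "F 0 \<le> F t"
proof (rule field_le_epsilon)
  fix e :: real assume e: "0 < e"
  define d where "d = e / (t + 1)"
  have d: "0 < d" "d * t \<le> e" using e t by (auto simp: d_def field_simps)
  define S where "S = {s \<in> {0..t}. F 0 \<le> F s + d * s}"
  have "closed S"
  proof -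
    have "continuous_on {0..t} (\<lambda>s. F s + d * s)"
      by (intro continuous_intros continuous_on_subset[OF cont]) auto
    then have "closed ({0..t} \<inter> (\<lambda>s. F s + d * s) -` {F 0..})"
      by (intro continuous_closed_preimage) auto
    moreover have "S = {0..t} \<inter> (\<lambda>s. F s + d * s) -` {F 0..}" by (auto simp: S_def)
    ultimately show ?thesis by simp
  qed
  then have "compact S" 

  proof -
    have "bounded S" by (rule bounded_subset[OF bounded_closed_interval[of 0 t]]) (auto simp: S_def)
    with \<open>closed S\<close> show ?thesis by (simp add: compact_eq_bounded_closed)
  qed
  moreover have "0 \<in> S" using t by (simp add: S_def)
  ultimately obtain s where s: "s \<in> S" "\<And>r. r \<in> S \<Longrightarrow> r \<le> s"
    using compact_attains_sup[of S] by blast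
  have "s = t"
  proof (rule ccontr)
    assume "s \<noteq> t"
    then have st: "0 \<le> s" "s < t" using s by (auto simp: S_def)
    obtain b where b: "0 < b" "\<And>h. 0 < h \<Longrightarrow> h < b \<Longrightarrow> F s - d * h \<le> F (s + h)"
      using slope[OF st(1) d(1)] unfolding eventually_at_right_field by auto
    (* a step to the right of s that stays in [0, t] contradicts the choice of s *)
    define h where "h = min (b / 2) (t - s)"
    have h: "0 < h" "h < b" "s + h \<le> t" using b st by (auto simp: h_def)
    have "s + h \<in> S" using s(1) st h b(2)[OF h(1,2)] by (auto simp: S_def algebra_simps)
    then show False using s(2)[of "s + h"] h by simp
  qed
  then show "F 0 \<le> F t + e" using s(1) d by (auto simp: S_def)
qed

lemma abs_ln_diff_le:
  fixes a b m :: real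
  assumes "0 < m" "m \<le> a" "m \<le> b"
  shows "\<bar>ln a - ln b\<bar> \<le> \<bar>a - b\<bar> / m"
proof -
  have *: "ln a - ln b \<le> \<bar>a - b\<bar> / m" if "m \<le> a" "m \<le> b" for a b
  proof -
    have "ln a - ln b = ln (a / b)" using that assms(1) by (simp add: ln_div)
    also have "\<dots> \<le> a / b - 1" using that assms(1) by (intro ln_le_minus_one) auto
    also have "\<dots> = (a - b) / b" using that assms(1) by (simp add: field_simps)
    also have "\<dots> \<le> \<bar>a - b\<bar> / m" using that assms(1) by (intro frac_le) auto
    finally show ?thesis .
  qed
  show ?thesis using *[OF assms(2,3)] *[OF assms(3,2)] by (simp add: abs_le_iff abs_minus_commute)
qed

locale positive_semigroup = bounded_semigroup Q C
  for Q :: "'a::metric_space op_family" and C +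
  assumes cpt: "compact (UNIV :: 'a set)"
    and pos: "\<And>t f x. 0 \<le> t \<Longrightarrow> (\<And>x. 0 \<le> apply_bcontfun f x) \<Longrightarrow> 0 \<le> Q t f x"
begin

lemma Q_mono: "Q t f x \<le> Q t g x" if "0 \<le> t" "\<And>x. apply_bcontfun f x \<le> apply_bcontfun g x"
  using pos[OF that(1), of "g - f" x] that(2) by (simp add: blinfun.diff_right)

lemma positive_lower_bound:
  fixes w :: "'a \<Rightarrow>\<^sub>C real"
  assumes "\<And>x. 0 < apply_bcontfun w x"
  obtains m where "0 < m" "\<And>x. m \<le> apply_bcontfun w x"
  using continuous_attains_inf[OF cpt _ continuous_on_apply_bcontfun, of w] assms by auto

text \<open>
  By strong continuity \<open>Q s 1 > 1/2\<close> for small \<open>s\<close>, so small time steps preserve strict positivity, and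
  every time is a multiple of a small step.
\<close>

lemma strictly_positive:
  fixes w :: "'a \<Rightarrow>\<^sub>C real"
  assumes t: "0 \<le> t" and w: "\<And>x. 0 < apply_bcontfun w x"
  shows "0 < Q t w x"
proof -
  let ?one = "const_bcontfun 1 :: 'a \<Rightarrow>\<^sub>C real"
  have "\<forall>\<^sub>F s in at_right 0. dist (Q s ?one) ?one < 1/2"
    using tendstoD[OF cont0[of ?one], of "1/2"] by simp
  then obtain b where b: "0 < b" "\<And>s. 0 < s \<Longrightarrow> s < b \<Longrightarrow> dist (Q s ?one) ?one < 1/2"
    unfolding eventually_at_right_field by auto
  have step: "0 < Q s w x" if h: "0 < s" "s < b" "\<And>x. 0 < apply_bcontfun w x" for s w x
  proof -
    obtain m where m: "0 < m" "\<And>x. m \<le> apply_bcontfun w x" using positive_lower_bound[of w] h(3) by blast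
    have "dist (Q s ?one x) (?one x) < 1/2"
      using b(2)[OF h(1,2)] dist_bounded[of "Q s ?one" x ?one] by linarith
    then have "1/2 < Q s ?one x" by (simp add: dist_real_def abs_if split: if_splits)
    then have "0 < m * Q s ?one x" using m by simp
    also have "\<dots> = Q s (m *\<^sub>R ?one) x" by (simp add: blinfun.scaleR_right)
    also have "\<dots> \<le> Q s w x" using h m by (intro Q_mono) auto
    finally show ?thesis .
  qed
  obtain n :: nat where n: "t / b < real n" using reals_Archimedean2 by blast
  have n0: "0 < real n" using n t b by (smt (verit) divide_nonneg_pos)
  define s where "s = t / n"
  have s: "0 \<le> s" "s < b" using n n0 t b by (auto simp: s_def field_simps)
  have "\<forall>x. 0 < Q (real k * s) w x" for k
  proof (induction k)
    case (Suc k)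
    have "Q (real (Suc k) * s) w = Q s (Q (real k * s) w)"
      using apply_add[of s "real k * s" w] s by (simp add: algebra_simps)
    then show ?case using step[of s "Q (real k * s) w"] Suc s
      by (cases "s = 0") auto
  qed (use w in simp)
  from this[of n] show ?thesis using n0 by (simp add: s_def)
qed

end

text \<open>
  The situation after the principal eigenvalue has been normalised to \<open>0\<close>: \<open>Q\<close> is the normalised
  Schrodinger semigroup with generator \<open>A = L + V - \<lambda>\<^sub>V\<close>, and the condition on \<open>\<mu>\<close> is what being an
  equilibrium measure says about \<open>\<integral> A u / u d\<mu>\<close>.
\<close>

locale equilibrium = positive_semigroup Q C + prob_space \<mu>
  for Q :: "'a::metric_space op_family" and C and \<mu> :: "'a measure" +
  assumes sets_\<mu>: "sets \<mu> = sets borel"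
    and generator_integral_nonneg: "\<And>u g. has_generator_value Q u g \<Longrightarrow> (\<And>x. 0 < apply_bcontfun u x) \<Longrightarrow>
      0 \<le> (\<integral>x. g x / u x \<partial>\<mu>)"
begin

lemma space_\<mu>: "space \<mu> = UNIV"
  using sets_eq_imp_space_eq[OF sets_\<mu>] by simp

lemma borel_\<mu>: "f \<in> borel_measurable \<mu> \<longleftrightarrow> f \<in> borel_measurable borel"
  by (rule arg_cong[of _ _ "\<lambda>S. f \<in> S", OF measurable_cong_sets[OF sets_\<mu> refl]])

lemma borel_bcontfun: "apply_bcontfun f \<in> borel_measurable borel" for f :: "'a \<Rightarrow>\<^sub>C real"
  by (intro borel_measurable_continuous_onI) auto

lemma integrable_bounded: "f \<in> borel_measurable borel \<Longrightarrow> (\<And>x. \<bar>f x\<bar> \<le> B) \<Longrightarrow> integrable \<mu> (f :: 'a \<Rightarrow> real)"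
  by (rule integrable_const_bound[of _ B]) (auto simp: borel_\<mu>)

lemma integrable_ln: 
  assumes "f \<in> borel_measurable borel" "0 < m" "\<And>x. m \<le> f x" "\<And>x. f x \<le> (B :: real)"
  shows "integrable \<mu> (\<lambda>x. ln (f x))"
proof (rule integrable_bounded)
  show "(\<lambda>x. ln (f x)) \<in> borel_measurable borel" using assms(1) by measurable
  fix x
  have "ln m \<le> ln (f x)" "ln (f x) \<le> ln B"
    using assms(2) assms(3)[of x] assms(4)[of x] by auto
  then show "\<bar>ln (f x)\<bar> \<le> max \<bar>ln m\<bar> \<bar>ln B\<bar>" by linarith
qed

lemma ln_integral_lipschitz:
  assumes "f \<in> borel_measurable borel" "g \<in> borel_measurable borel" "0 < m"
    "\<And>x. m \<le> f x" "\<And>x. f x \<le> (B :: real)" "\<And>x. m \<le> g x" "\<And>x. g x \<le> B"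
  shows "\<bar>(\<integral>x. ln (f x) \<partial>\<mu>) - (\<integral>x. ln (g x) \<partial>\<mu>)\<bar> \<le> (\<integral>x. \<bar>f x - g x\<bar> \<partial>\<mu>) / m"
proof -
  note i = integrable_ln[OF assms(1,3,4,5)] integrable_ln[OF assms(2,3,6,7)]
  have d: "integrable \<mu> (\<lambda>x. \<bar>f x - g x\<bar>)"
  proof (rule integrable_bounded)
    show "(\<lambda>x. \<bar>f x - g x\<bar>) \<in> borel_measurable borel" using assms(1,2) by measurable
    show "\<bar>\<bar>f x - g x\<bar>\<bar> \<le> B" for x using assms(3) assms(4-7)[of x] by (auto simp: abs_le_iff)
  qed
  have "\<bar>\<integral>x. ln (f x) - ln (g x) \<partial>\<mu>\<bar> \<le> (\<integral>x. \<bar>ln (f x) - ln (g x)\<bar> \<partial>\<mu>)"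
    by (rule integral_abs_bound)
  also have "\<dots> \<le> (\<integral>x. \<bar>f x - g x\<bar> / m \<partial>\<mu>)"
    using i d assms by (intro integral_mono abs_ln_diff_le integrable_abs Bochner_Integration.integrable_diff) auto
  finally show ?thesis using i by simp
qed

lemma ln_integral_tendsto:
  fixes w :: "'a \<Rightarrow>\<^sub>C real"
  assumes lim: "(v \<longlongrightarrow> w) F" and w: "\<And>x. 0 < apply_bcontfun w x"
  shows "((\<lambda>h. \<integral>x. ln (v h x) \<partial>\<mu>) \<longlongrightarrow> (\<integral>x. ln (w x) \<partial>\<mu>)) F"
proof -
  obtain m where m: "0 < m" "\<And>x. m \<le> apply_bcontfun w x" using positive_lower_bound[of w] w by blast
  have ev: "\<forall>\<^sub>F h in F. dist (v h) w < m / 2" using tendstoD[OF lim, of "m / 2"] m(1) by simp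
  have "((\<lambda>h. (\<integral>x. ln (v h x) \<partial>\<mu>) - (\<integral>x. ln (w x) \<partial>\<mu>)) \<longlongrightarrow> 0) F"
  proof (rule Lim_null_comparison)
    have "((\<lambda>h. dist (v h) w / (m / 2)) \<longlongrightarrow> 0 / (m / 2)) F"
      using m by (intro tendsto_divide tendsto_const iffD1[OF tendsto_dist_iff lim]) auto
    then show "((\<lambda>h. dist (v h) w / (m / 2)) \<longlongrightarrow> 0) F" by simp
    show "\<forall>\<^sub>F h in F. norm ((\<integral>x. ln (v h x) \<partial>\<mu>) - (\<integral>x. ln (w x) \<partial>\<mu>)) \<le> dist (v h) w / (m / 2)"
      using ev
    proof eventually_elim
      case (elim h)
      have d: "\<bar>v h x - w x\<bar> \<le> dist (v h) w" for x
        using dist_bounded[of "v h" x w] by (simp add: dist_real_def)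
      have lb: "m / 2 \<le> v h x" for x using d[of x] elim m(2)[of x] m(1) by linarith
      have "\<bar>(\<integral>x. ln (v h x) \<partial>\<mu>) - (\<integral>x. ln (w x) \<partial>\<mu>)\<bar> \<le> (\<integral>x. \<bar>v h x - w x\<bar> \<partial>\<mu>) / (m / 2)"
      proof (rule ln_integral_lipschitz[where B = "max (norm (v h)) (norm w)"])
        show "v h x \<le> max (norm (v h)) (norm w)" for x using norm_bounded[of "v h" x] by auto
        show "w x \<le> max (norm (v h)) (norm w)" for x using norm_bounded[of w x] by auto
        show "m / 2 \<le> w x" for x using m(1) m(2)[of x] by linarith
      qed (use m lb borel_bcontfun in auto)
      also have "(\<integral>x. \<bar>v h x - w x\<bar> \<partial>\<mu>) \<le> dist (v h) w"
        using d by (intro integral_le_const integrable_bounded[of _ "dist (v h) w"]) (auto intro!: borel_measurable_abs borel_measurable_diff borel_bcontfun)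
      finally show ?case using m by (simp add: divide_right_mono)
    qed
  qed
  then show ?thesis by (simp add: LIM_zero_iff)
qed

lemma ratio_integral_tendsto:
  fixes w k :: "'a \<Rightarrow>\<^sub>C real"
  assumes gk: "(g \<longlongrightarrow> k) F" and vw: "(v \<longlongrightarrow> w) F" and w: "\<And>x. 0 < apply_bcontfun w x"
  shows "((\<lambda>h. \<integral>x. g h x / v h x \<partial>\<mu>) \<longlongrightarrow> (\<integral>x. k x / w x \<partial>\<mu>)) F"
proof -
  obtain m where m: "0 < m" "\<And>x. m \<le> apply_bcontfun w x" using positive_lower_bound[of w] w by blast
  have ev: "\<forall>\<^sub>F h in F. dist (v h) w < m / 2" using tendstoD[OF vw, of "m / 2"] m(1) by simp
  let ?b = "\<lambda>h. dist (g h) k / (m / 2) + norm k * dist (v h) w / (m * (m / 2))"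
  have ratio: "integrable \<mu> (\<lambda>x. f x / u x)" if "0 < r" "\<And>x. r \<le> u x" for f u :: "'a \<Rightarrow>\<^sub>C real" and r
  proof (rule integrable_bounded)
    show "(\<lambda>x. f x / u x) \<in> borel_measurable borel"
      by (intro borel_measurable_divide borel_bcontfun)
    show "\<bar>f x / u x\<bar> \<le> norm f / r" for x
      using norm_bounded[of f x] that(2)[of x] that(1) by (simp add: frac_le)
  qed
  have "((\<lambda>h. (\<integral>x. g h x / v h x \<partial>\<mu>) - (\<integral>x. k x / w x \<partial>\<mu>)) \<longlongrightarrow> 0) F"
  proof (rule Lim_null_comparison)
    have "(?b \<longlongrightarrow> 0 / (m / 2) + norm k * 0 / (m * (m / 2))) F"
      using m by (intro tendsto_add tendsto_divide tendsto_mult tendsto_const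
          iffD1[OF tendsto_dist_iff gk] iffD1[OF tendsto_dist_iff vw]) auto
    then show "(?b \<longlongrightarrow> 0) F" by simp
    show "\<forall>\<^sub>F h in F. norm ((\<integral>x. g h x / v h x \<partial>\<mu>) - (\<integral>x. k x / w x \<partial>\<mu>)) \<le> ?b h"
      using ev
    proof eventually_elim
      case (elim h)
      have dv: "\<bar>v h x - w x\<bar> \<le> dist (v h) w" for x
        using dist_bounded[of "v h" x w] by (simp add: dist_real_def)
      have dg: "\<bar>g h x - k x\<bar> \<le> dist (g h) k" for x
        using dist_bounded[of "g h" x k] by (simp add: dist_real_def)
      have lb: "m / 2 \<le> v h x" for x using dv[of x] elim m(2)[of x] m(1) by linarith
      have pw: "\<bar>g h x / v h x - k x / w x\<bar> \<le> ?b h" for x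
      proof -
        have vp: "0 < v h x" "0 < w x" using lb[of x] m w by (auto intro: less_le_trans[of 0 "m/2"])
        have "g h x / v h x - k x / w x = (g h x - k x) / v h x + k x * (w x - v h x) / (w x * v h x)"
          using vp by (simp add: field_simps)
        also have "\<bar>\<dots>\<bar> \<le> \<bar>g h x - k x\<bar> / v h x + \<bar>k x\<bar> * \<bar>w x - v h x\<bar> / (w x * v h x)"
          using vp by (intro order_trans[OF abs_triangle_ineq]) (simp add: abs_mult)
        also have "\<dots> \<le> ?b h"
          using vp m lb[of x] m(2)[of x] dv[of x] dg[of x] norm_bounded[of k x]
          by (intro add_mono frac_le mult_mono)
             (auto simp: abs_minus_commute intro: order_trans[OF less_imp_le[OF m(1)] m(2)])
        finally show ?thesis .
      qed
      have "norm ((\<integral>x. g h x / v h x \<partial>\<mu>) - (\<integral>x. k x / w x \<partial>\<mu>))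
          = \<bar>\<integral>x. g h x / v h x - k x / w x \<partial>\<mu>\<bar>"
        using ratio[of "m/2" "v h" "g h"] ratio[of m w k] m lb by simp
      also have "\<dots> \<le> (\<integral>x. \<bar>g h x / v h x - k x / w x\<bar> \<partial>\<mu>)" by (rule integral_abs_bound)
      also have "\<dots> \<le> ?b h"
        using pw ratio[of "m/2" "v h" "g h"] ratio[of m w k] m lb
        by (intro integral_le_const integrable_abs Bochner_Integration.integrable_diff) auto
      finally show ?case .
    qed
  qed
  then show ?thesis by (simp add: LIM_zero_iff)
qed

text \<open>
  Since \<open>ln x \<ge> 1 - 1 / x\<close>, the function \<open>t \<mapsto> \<integral> ln (Q t u) d\<mu>\<close> has right slope at least
  \<open>\<integral> A (Q t u) / Q t u d\<mu> \<ge> 0\<close>, where \<open>A\<close> is the generator.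
\<close>

lemma log_inequality_domain:
  assumes gen: "has_generator_value Q u g" and u: "\<And>x. 0 < apply_bcontfun u x" and t: "0 \<le> t"
  shows "(\<integral>x. ln (u x) \<partial>\<mu>) \<le> (\<integral>x. ln (Q t u x) \<partial>\<mu>)"
proof -
  define F where "F s = (\<integral>x. ln (Q s u x) \<partial>\<mu>)" for s
  have "F 0 \<le> F t"
  proof (rule nondecreasing_from_right_slope[OF _ _ t])
    show "continuous_on {0..} F"
      unfolding continuous_on_def F_def
    proof
      fix s :: real assume s: "s \<in> {0..}"
      then have "((\<lambda>t. Q t u) \<longlongrightarrow> Q s u) (at s within {0..})"
        using continuous_on_orbit[of u] by (simp add: continuous_on_def)
      then show "((\<lambda>s. \<integral>x. ln (Q s u x) \<partial>\<mu>) \<longlongrightarrow> (\<integral>x. ln (Q s u x) \<partial>\<mu>)) (at s within {0..})"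
        using s by (intro ln_integral_tendsto strictly_positive u) auto
    qed
    fix s e :: real assume s: "0 \<le> s" and e: "0 < e"
    let ?w = "Q s u" and ?v = "\<lambda>h. Q h (Q s u)" and ?d = "\<lambda>h. (Q h (Q s u) - Q s u) /\<^sub>R h"
    have w: "0 < ?w x" for x by (rule strictly_positive[OF s u])
    have "((\<lambda>h. \<integral>x. ?d h x / ?v h x \<partial>\<mu>) \<longlongrightarrow> (\<integral>x. Q s g x / ?w x \<partial>\<mu>)) (at_right 0)"
      using has_generator_value_orbit[OF gen s]
      by (intro ratio_integral_tendsto cont0 w) (simp add: has_generator_value_def)
    moreover have "- e < (\<integral>x. Q s g x / ?w x \<partial>\<mu>)"
      using generator_integral_nonneg[OF has_generator_value_orbit[OF gen s] w] e by linarith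
    ultimately have "\<forall>\<^sub>F h in at_right 0. - e < (\<integral>x. ?d h x / ?v h x \<partial>\<mu>)"
      by (rule order_tendstoD(1))
    moreover have "\<forall>\<^sub>F h in at_right (0::real). 0 < h"
      by (simp add: eventually_at_right_less)
    ultimately show "\<forall>\<^sub>F h in at_right 0. F s - e * h \<le> F (s + h)"
    proof eventually_elim
      case (elim h)
      have v: "0 < ?v h x" for x using elim by (intro strictly_positive w) auto
      obtain r where r: "0 < r" "\<And>x. r \<le> ?w x" using positive_lower_bound[of ?w] w by blast
      obtain m where m: "0 < m" "\<And>x. m \<le> ?v h x" using positive_lower_bound[of "?v h"] v by blast
      have ub: "f x \<le> norm f" for f :: "'a \<Rightarrow>\<^sub>C real" and x using norm_bounded[of f x] by simp
      have i: "integrable \<mu> (\<lambda>x. ln (?w x))" "integrable \<mu> (\<lambda>x. ln (?v h x))"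
        using integrable_ln[OF borel_bcontfun r ub] integrable_ln[OF borel_bcontfun m ub] by auto
      have di: "integrable \<mu> (\<lambda>x. ?d h x / ?v h x)"
      proof (rule integrable_bounded)
        show "(\<lambda>x. ?d h x / ?v h x) \<in> borel_measurable borel"
          by (intro borel_measurable_divide borel_bcontfun)
        show "\<bar>?d h x / ?v h x\<bar> \<le> norm (?d h) / m" for x
          using norm_bounded[of "?d h" x] m(2)[of x] m(1) by (simp add: frac_le)
      qed
      have le: "h * (?d h x / ?v h x) \<le> ln (?v h x) - ln (?w x)" for x
      proof -
        have "ln (?w x) - ln (?v h x) = ln (?w x / ?v h x)" using w[of x] v[of x] by (simp add: ln_div)
        also have "\<dots> \<le> ?w x / ?v h x - 1" using w[of x] v[of x] by (intro ln_le_minus_one) simp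
        also have "\<dots> = - (h * (?d h x / ?v h x))" using v[of x] elim by (simp add: field_simps)
        finally show ?thesis by simp
      qed
      have "h * (- e) \<le> h * (\<integral>x. ?d h x / ?v h x \<partial>\<mu>)"
        using elim by (intro mult_left_mono) auto
      also have "\<dots> = (\<integral>x. h * (?d h x / ?v h x) \<partial>\<mu>)" by (simp only: integral_mult_right_zero)
      also have "\<dots> \<le> (\<integral>x. ln (?v h x) - ln (?w x) \<partial>\<mu>)"
        using i di le by (intro integral_mono integrable_mult_right Bochner_Integration.integrable_diff) auto
      also have "\<dots> = F (s + h) - F s"
        using i apply_add[of h s u] elim s by (simp add: F_def add.commute)
      finally show ?case by (simp add: mult.commute)
    qed
  qed
  then show ?thesis by (simp add: F_def)
qed

text \<open>
  Both sides are continuous in \<open>w\<close> for the sup norm, and \<open>w\<close> is a limit of orbit averages, which lie in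
  the domain of the generator and are strictly positive for short times.
\<close>

theorem log_inequality:
  assumes w: "\<And>x. 0 < apply_bcontfun w x" and t: "0 \<le> t"
  shows "(\<integral>x. ln (w x) \<partial>\<mu>) \<le> (\<integral>x. ln (Q t w x) \<partial>\<mu>)"
proof -
  define a where "a h = integral {0..h} (\<lambda>s. Q s w) /\<^sub>R h" for h
  have lim: "(a \<longlongrightarrow> w) (at_right 0)" unfolding a_def by (rule generator_domain_dense)
  obtain m where m: "0 < m" "\<And>x. m \<le> apply_bcontfun w x" using positive_lower_bound[of w] w by blast
  have "\<forall>\<^sub>F h in at_right 0. dist (a h) w < m" using tendstoD[OF lim m(1)] .
  moreover have "\<forall>\<^sub>F h in at_right (0::real). 0 < h"
    by (simp add: eventually_at_right_less)
  ultimately have ev: "\<forall>\<^sub>F h in at_right 0. (\<integral>x. ln (a h x) \<partial>\<mu>) \<le> (\<integral>x. ln (Q t (a h) x) \<partial>\<mu>)"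
  proof eventually_elim
    case (elim h)
    have "0 < a h x" for x
      using dist_bounded[of "a h" x w] m(2)[of x] elim by (simp add: dist_real_def)
    moreover have "has_generator_value Q (a h) ((Q h w - w) /\<^sub>R h)"
      unfolding a_def using elim by (intro has_generator_value_scale generator_value_orbit_integral) auto
    ultimately show ?case by (intro log_inequality_domain t)
  qed
  have "((\<lambda>h. Q t (a h)) \<longlongrightarrow> Q t w) (at_right 0)"
    by (intro blinfun.tendsto tendsto_const lim)
  then have 2: "((\<lambda>h. \<integral>x. ln (Q t (a h) x) \<partial>\<mu>) \<longlongrightarrow> (\<integral>x. ln (Q t w x) \<partial>\<mu>)) (at_right 0)"
    by (intro ln_integral_tendsto strictly_positive w t)
  show ?thesis
    by (rule tendsto_le[OF _ 2 ln_integral_tendsto[OF lim w] ev]) (simp add: trivial_limit_at_right_real)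
qed

end

section \<open>The ground measure as a limit of time averages\<close>

text \<open>
  By Tychonoff's theorem a pointwise bounded sequence of functionals has a cluster point for pointwise
  convergence; it inherits every closed condition that holds eventually along the sequence.
\<close>

lemma cluster_point_functional:
  fixes \<phi> :: "nat \<Rightarrow> 'b \<Rightarrow> real"
  assumes "\<And>n f. \<bar>\<phi> n f\<bar> \<le> b f"
  shows "\<exists>\<psi>. \<forall>S. closed S \<longrightarrow> eventually (\<lambda>n. \<phi> n \<in> S) sequentially \<longrightarrow> \<psi> \<in> S"
proof -
  define K where "K = PiE UNIV (\<lambda>f. {- b f..b f})"
  have "compactin (product_topology (\<lambda>f :: 'b. euclidean :: real topology) UNIV) K"
    unfolding K_def compactin_PiE by simp
  then have "compact K" by (simp add: euclidean_product_topology)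
  moreover have "eventually (\<lambda>x. x \<in> K) (filtermap \<phi> sequentially)"
    using assms by (auto simp: eventually_filtermap K_def abs_le_iff minus_le_iff intro!: always_eventually)
  ultimately obtain \<psi> where \<psi>: "inf (nhds \<psi>) (filtermap \<phi> sequentially) \<noteq> bot"
    unfolding compact_filter using filtermap_bot_iff sequentially_bot by blast
  have "\<psi> \<in> S" if "closed S" "eventually (\<lambda>n. \<phi> n \<in> S) sequentially" for S
  proof (rule ccontr)
    assume "\<psi> \<notin> S"
    then have "eventually (\<lambda>x. x \<in> - S) (nhds \<psi>)"
      using that(1) by (intro eventually_nhds_in_open) auto
    moreover have "eventually (\<lambda>x. x \<in> S) (filtermap \<phi> sequentially)"
      using that(2) by (simp add: eventually_filtermap)
    ultimately have "eventually (\<lambda>x. False) (inf (nhds \<psi>) (filtermap \<phi> sequentially))"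
      unfolding eventually_inf by (metis ComplD)
    with \<psi> show False by (simp add: trivial_limit_def)
  qed
  then show ?thesis by blast
qed

context equilibrium
begin

definition mean :: "('a \<Rightarrow>\<^sub>C real) \<Rightarrow> real" where
  "mean f = (\<integral>x. f x \<partial>\<mu>)"

lemma integrable_bcontfun: "integrable \<mu> (apply_bcontfun f)" for f :: "'a \<Rightarrow>\<^sub>C real"
  using norm_bounded[of f] by (intro integrable_bounded[of _ "norm f"] borel_bcontfun) auto

lemma mean_le: "\<bar>mean f\<bar> \<le> norm f"
proof -
  have "\<bar>mean f\<bar> \<le> (\<integral>x. \<bar>f x\<bar> \<partial>\<mu>)" unfolding mean_def by (rule integral_abs_bound)
  also have "\<dots> \<le> norm f"
    using norm_bounded[of f] by (intro integral_le_const integrable_abs integrable_bcontfun) auto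
  finally show ?thesis .
qed

lemma bounded_linear_mean: "bounded_linear mean"
proof (rule bounded_linear_intro[where K = 1])
  show "mean (f + g) = mean f + mean g" for f g
    by (simp add: mean_def integrable_bcontfun)
  show "mean (r *\<^sub>R f) = r *\<^sub>R mean f" for r f by (simp add: mean_def)
  show "norm (mean f) \<le> norm f * 1" for f using mean_le[of f] by simp
qed

text \<open>
  Jensen's inequality, obtained by integrating the tangent line inequality for \<open>exp\<close> at \<open>\<integral> ln w d\<mu>\<close>.
\<close>

lemma exp_log_le_mean:
  assumes w: "\<And>x. 0 < apply_bcontfun w x"
  shows "exp (\<integral>x. ln (w x) \<partial>\<mu>) \<le> mean w"
proof -
  obtain m where m: "0 < m" "\<And>x. m \<le> apply_bcontfun w x" using positive_lower_bound[of w] w by blast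
  have ub: "w x \<le> norm w" for x using norm_bounded[of w x] by simp
  note i = integrable_ln[OF borel_bcontfun m ub]
  define L where "L = (\<integral>x. ln (w x) \<partial>\<mu>)"
  have "exp L = (\<integral>x. exp L * (1 + (ln (w x) - L)) \<partial>\<mu>)"
    using i by (simp add: L_def prob_space)
  also have "\<dots> \<le> (\<integral>x. w x \<partial>\<mu>)"
  proof (rule integral_mono)
    show "integrable \<mu> (\<lambda>x. exp L * (1 + (ln (w x) - L)))" using i by simp
    fix x
    have "exp L * (1 + (ln (w x) - L)) \<le> exp L * exp (ln (w x) - L)"
      by (intro mult_left_mono exp_ge_add_one_self) auto
    also have "\<dots> = w x" using w[of x] by (simp flip: exp_add)
    finally show "exp L * (1 + (ln (w x) - L)) \<le> w x" .
  qed (rule integrable_bcontfun)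
  finally show ?thesis by (simp add: L_def mean_def)
qed

definition time_average :: "nat \<Rightarrow> ('a \<Rightarrow>\<^sub>C real) \<Rightarrow> real" where
  "time_average n f = integral {0..real (Suc n)} (\<lambda>s. mean (Q s f)) / real (Suc n)"

lemma integrable_orbit_mean: "(\<lambda>s. mean (Q s f)) integrable_on {a..b}" if "0 \<le> a"
  using that
  by (intro integrable_continuous_real bounded_linear.continuous_on[OF bounded_linear_mean]
      continuous_on_subset[OF continuous_on_orbit]) auto

lemma orbit_mean_le: "\<bar>mean (Q s f)\<bar> \<le> C * norm f" if "0 \<le> s"
  using order_trans[OF mean_le norm_apply_le[OF that]] .

lemma integral_orbit_mean_le:
  assumes "0 \<le> a" "a \<le> b"
  shows "\<bar>integral {a..b} (\<lambda>s. mean (Q s f))\<bar> \<le> C * norm f * (b - a)"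
proof -
  have "norm (integral {a..b} (\<lambda>s. mean (Q s f))) \<le> C * norm f * (b - a)"
    using assms orbit_mean_le
    by (intro integral_bound bounded_linear.continuous_on[OF bounded_linear_mean]
        continuous_on_subset[OF continuous_on_orbit]) auto
  then show ?thesis by simp
qed

lemma time_average_le: "\<bar>time_average n f\<bar> \<le> C * norm f"
  using integral_orbit_mean_le[of 0 "real (Suc n)" f]
  by (simp add: time_average_def field_simps del: of_nat_Suc)

lemma time_average_lincomb:
  "time_average n (a *\<^sub>R f + b *\<^sub>R g) = a * time_average n f + b * time_average n g"
proof -
  have "mean (Q s (a *\<^sub>R f + b *\<^sub>R g)) = a * mean (Q s f) + b * mean (Q s g)" for s
    using bounded_linear.linear[OF bounded_linear_mean]
    by (simp add: blinfun.add_right blinfun.scaleR_right linear_add linear_scale)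
  then have "time_average n (a *\<^sub>R f + b *\<^sub>R g)
      = integral {0..real (Suc n)} (\<lambda>s. a * mean (Q s f) + b * mean (Q s g)) / real (Suc n)"
    by (simp only: time_average_def)
  also have "integral {0..real (Suc n)} (\<lambda>s. a * mean (Q s f) + b * mean (Q s g))
      = a * integral {0..real (Suc n)} (\<lambda>s. mean (Q s f)) + b * integral {0..real (Suc n)} (\<lambda>s. mean (Q s g))"
    using integrable_orbit_mean[of 0 f] integrable_orbit_mean[of 0 g]
    by (subst integral_add) (auto intro!: integrable_on_mult_right simp del: of_nat_Suc)
  finally show ?thesis by (simp add: time_average_def add_divide_distrib del: of_nat_Suc)
qed

lemma time_average_lower_bound:
  assumes "\<And>s. 0 \<le> s \<Longrightarrow> c \<le> mean (Q s f)"
  shows "c \<le> time_average n f"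
proof -
  have "integral {0..real (Suc n)} (\<lambda>s. c) \<le> integral {0..real (Suc n)} (\<lambda>s. mean (Q s f))"
    using integrable_orbit_mean[of 0 f] assms by (intro integral_le) auto
  then show ?thesis by (simp add: time_average_def field_simps del: of_nat_Suc)
qed

text \<open>
  Shifting the time window by \<open>t\<close> changes the integral only near its two end points, by an amount
  that is bounded independently of the length of the window.
\<close>

lemma time_average_almost_invariant:
  assumes t: "0 \<le> t"
  shows "\<bar>time_average n (Q t f) - time_average n f\<bar> \<le> 2 * C * norm f * t / real (Suc n)"
proof -
  let ?o = "\<lambda>s. mean (Q s f)" and ?T = "real (Suc n)"
  have T: "0 < ?T" by simp
  have 1: "integral {0..?T} (\<lambda>s. mean (Q s (Q t f))) = integral {t..t+?T} ?o"
  proof -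
    have cont: "continuous_on {a..b} ?o" if "0 \<le> a" for a b
      using that by (intro bounded_linear.continuous_on[OF bounded_linear_mean]
        continuous_on_subset[OF continuous_on_orbit]) auto
    have cont': "continuous_on {0..0+?T} (\<lambda>s. ?o (t + s))"
      using t by (intro continuous_on_compose2[OF cont[of 0 "t + ?T"]] continuous_intros) auto
    have "integral {0..?T} (\<lambda>s. mean (Q s (Q t f))) = integral {0..?T} (\<lambda>s. ?o (t + s))"
      using t by (intro integral_cong) (simp add: add.commute flip: apply_add)
    also have "\<dots> = integral {t..t+?T} ?o"
      using integral_rescale[OF less_imp_le[OF T] cont'] integral_rescale[OF less_imp_le[OF T] cont[OF t]]
      by simp
    finally show ?thesis .
  qed
  have 2: "integral {0..t} ?o + integral {t..t+?T} ?o = integral {0..t+?T} ?o"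
    using t T by (intro Henstock_Kurzweil_Integration.integral_combine integrable_orbit_mean) auto
  have 3: "integral {0..?T} ?o + integral {?T..t+?T} ?o = integral {0..t+?T} ?o"
    using t T by (intro Henstock_Kurzweil_Integration.integral_combine integrable_orbit_mean) auto
  have "\<bar>integral {t..t+?T} ?o - integral {0..?T} ?o\<bar> \<le> 2 * C * norm f * t"
    using 2 3 integral_orbit_mean_le[of 0 t f] integral_orbit_mean_le[of ?T "t+?T" f] t T
    by (simp add: abs_le_iff)
  then have "\<bar>integral {t..t+?T} ?o - integral {0..?T} ?o\<bar> / ?T \<le> 2 * C * norm f * t / ?T"
    using T by (intro divide_right_mono) auto
  then show ?thesis
    using T unfolding time_average_def 1 by (simp add: diff_divide_distrib[symmetric] del: of_nat_Suc)
qed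

text \<open>
  Invariance, positivity and the lower bound by \<open>exp (\<integral> ln w d\<mu>)\<close> are closed conditions, and the time
  averages satisfy them, the first one asymptotically; so a cluster point has them all.
  The lower bound holds for each \<open>mean \<circ> Q s\<close> by Jensen and the logarithmic inequality.
\<close>

theorem invariant_functional_exists:
  "\<exists>\<phi>. positive_functional \<phi> \<and> (\<forall>t\<ge>0. \<forall>f. \<phi> (Q t f) = \<phi> f) \<and>
    (\<forall>w. (\<forall>x. 0 < apply_bcontfun w x) \<longrightarrow> exp (\<integral>x. ln (w x) \<partial>\<mu>) \<le> \<phi> w)"
proof -
  have "\<exists>\<phi>. \<forall>S. closed S \<longrightarrow> eventually (\<lambda>n. time_average n \<in> S) sequentially \<longrightarrow> \<phi> \<in> S"
    by (rule cluster_point_functional[OF time_average_le])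
  then obtain \<phi> where "\<forall>S. closed S \<longrightarrow> eventually (\<lambda>n. time_average n \<in> S) sequentially \<longrightarrow> \<phi> \<in> S" ..
  then have cl: "\<And>S. closed S \<Longrightarrow> eventually (\<lambda>n. time_average n \<in> S) sequentially \<Longrightarrow> \<phi> \<in> S"
    by (elim allE impE)
  have coord: "continuous_on UNIV (\<lambda>F :: ('a \<Rightarrow>\<^sub>C real) \<Rightarrow> real. F f)" for f by simp
  have lower: "c \<le> \<phi> f" if "\<And>s. 0 \<le> s \<Longrightarrow> c \<le> mean (Q s f)" for c f
  proof -
    have "closed {F :: ('a \<Rightarrow>\<^sub>C real) \<Rightarrow> real. c \<le> F f}"
      by (intro closed_Collect_le continuous_on_const coord)
    from cl[OF this] show ?thesis using time_average_lower_bound[OF that] by simp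
  qed
  have lc: "\<phi> (a *\<^sub>R f + b *\<^sub>R g) = a * \<phi> f + b * \<phi> g" for a b f g
  proof -
    have "closed {F :: ('a \<Rightarrow>\<^sub>C real) \<Rightarrow> real. F (a *\<^sub>R f + b *\<^sub>R g) = a * F f + b * F g}"
      by (intro closed_Collect_eq continuous_on_add continuous_on_mult continuous_on_const coord)
    from cl[OF this] show ?thesis by (simp add: time_average_lincomb)
  qed
  have inv: "\<phi> (Q t f) = \<phi> f" if t: "0 \<le> t" for t f
  proof -
    have "\<bar>\<phi> (Q t f) - \<phi> f\<bar> \<le> 0 + e" if e: "0 < e" for e
    proof -
      have "closed {F :: ('a \<Rightarrow>\<^sub>C real) \<Rightarrow> real. \<bar>F (Q t f) - F f\<bar> \<le> e}"
        by (intro closed_Collect_le continuous_on_const continuous_on_rabs continuous_on_diff coord)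
      moreover have "(\<lambda>n. 2 * C * norm f * t / real (Suc n)) \<longlonglongrightarrow> 0"
        by (rule LIMSEQ_Suc[OF lim_const_over_n])
      then have "eventually (\<lambda>n. 2 * C * norm f * t / real (Suc n) < e) sequentially"
        using e by (rule order_tendstoD(2))
      then have "eventually (\<lambda>n. \<bar>time_average n (Q t f) - time_average n f\<bar> \<le> e) sequentially"
        using time_average_almost_invariant[OF t, of _ f]
        by (auto elim!: eventually_mono intro: order_trans less_imp_le)
      ultimately show ?thesis using cl[of "{F. \<bar>F (Q t f) - F f\<bar> \<le> e}"] by simp
    qed
    then have "\<bar>\<phi> (Q t f) - \<phi> f\<bar> \<le> 0" by (rule field_le_epsilon)
    then show ?thesis by simp
  qed
  have pf: "positive_functional \<phi>"
  proof
    show "\<phi> (f + g) = \<phi> f + \<phi> g" for f g using lc[of 1 f 1 g] by simp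
    show "\<phi> (r *\<^sub>R f) = r *\<^sub>R \<phi> f" for r f using lc[of r f 0 f] by simp
    show "0 \<le> \<phi> f" if "\<And>x. 0 \<le> apply_bcontfun f x" for f
      using pos that by (intro lower) (auto simp: mean_def intro!: Bochner_Integration.integral_nonneg)
  qed (rule cpt)
  have lb: "exp (\<integral>x. ln (w x) \<partial>\<mu>) \<le> \<phi> w" if w: "\<And>x. 0 < apply_bcontfun w x" for w
  proof (rule lower)
    fix s :: real assume s: "0 \<le> s"
    have "exp (\<integral>x. ln (w x) \<partial>\<mu>) \<le> exp (\<integral>x. ln (Q s w x) \<partial>\<mu>)"
      using log_inequality[OF w s] by simp
    also have "\<dots> \<le> mean (Q s w)" by (intro exp_log_le_mean strictly_positive s w)
    finally show "exp (\<integral>x. ln (w x) \<partial>\<mu>) \<le> mean (Q s w)" .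
  qed
  show ?thesis using pf inv lb by (intro exI[of _ \<phi>]) simp
qed

end

section \<open>From continuous to Borel functions\<close>

lemma borel_induct_open [consumes 1, case_names basic empty compl union]:
  assumes "A \<in> sets (borel :: 'a::topological_space measure)"
    and "\<And>U. open U \<Longrightarrow> R U" "R {}"
    and "\<And>A. A \<in> sets borel \<Longrightarrow> R A \<Longrightarrow> R (UNIV - A)"
    and "\<And>A. disjoint_family A \<Longrightarrow> range A \<subseteq> sets borel \<Longrightarrow> (\<And>i::nat. R (A i)) \<Longrightarrow> R (\<Union>i. A i)"
  shows "R (A :: 'a set)"
proof -
  have eq: "sets borel = sigma_sets UNIV {S :: 'a set. open S}" by (simp add: borel_def)
  have "A \<in> sigma_sets UNIV {S. open S}" using assms(1) eq by simp
  show ?thesis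
  proof (rule sigma_sets_induct_disjoint[where G = "{S. open S}" and \<Omega> = UNIV and P = R and A = A])
    show "Int_stable {S :: 'a set. open S}" by (auto simp: Int_stable_def)
    show "{S :: 'a set. open S} \<subseteq> Pow UNIV" by simp
    show "A \<in> sigma_sets UNIV {S. open S}" by fact
    show "R U" if "U \<in> {S. open S}" for U using that assms(2) by simp
    show "R {}" by fact
    show "R (UNIV - B)" if "B \<in> sigma_sets UNIV {S. open S}" "R B" for B
      using that unfolding eq[symmetric] by (rule assms(4))
    show "R (\<Union>i. B i)" if "disjoint_family B" "range B \<subseteq> sigma_sets UNIV {S. open S}" "\<And>i. R (B i)"
      for B :: "nat \<Rightarrow> 'a set"
      using that unfolding eq[symmetric] by (rule assms(5))
  qed
qed

lemma integrable_bcontfun_finite: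
  fixes f :: "'a::metric_space \<Rightarrow>\<^sub>C real"
  assumes "finite_measure M" "sets M = sets borel"
  shows "integrable M (apply_bcontfun f)"
proof -
  interpret finite_measure M by fact
  have "apply_bcontfun f \<in> borel_measurable M"
    unfolding measurable_cong_sets[OF assms(2) refl] by (intro borel_measurable_continuous_onI) auto
  then show ?thesis using norm_bounded[of f] by (intro integrable_const_bound[of _ "norm f"]) auto
qed

lemma nn_integral_bcontfun_finite:
  fixes f :: "'a::metric_space \<Rightarrow>\<^sub>C real"
  assumes "finite_measure M" "sets M = sets borel" "\<And>x. 0 \<le> f x"
  shows "(\<integral>\<^sup>+x. ennreal (f x) \<partial>M) = ennreal (\<integral>x. f x \<partial>M)"
  using assms by (intro nn_integral_eq_integral integrable_bcontfun_finite) auto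

lemma emeasure_open_eq_SUP:
  assumes M: "finite_measure M" "sets M = sets borel" and g: "increases_to_indicator g U"
  shows "emeasure M U = (SUP k. ennreal (\<integral>x. apply_bcontfun (g k) x \<partial>M))"
proof -
  have [measurable_cong]: "sets M = sets borel" by fact
  have gm: "apply_bcontfun f \<in> borel_measurable M" for f :: "'a \<Rightarrow>\<^sub>C real"
    unfolding measurable_cong_sets[OF M(2) refl] by (intro borel_measurable_continuous_onI) auto
  have g0: "0 \<le> g k x" for k x using g by (simp add: increases_to_indicator_def)
  have lim: "(SUP k. ennreal (g k x)) = indicator U x" for x
  proof (rule LIMSEQ_unique[OF LIMSEQ_SUP])
    show "incseq (\<lambda>k. ennreal (g k x))"
      using g by (auto simp: incseq_def increases_to_indicator_def intro!: ennreal_leI)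
    have "(\<lambda>k. ennreal (g k x)) \<longlonglongrightarrow> ennreal (indicator U x)"
      using g by (intro tendsto_ennrealI) (simp add: increases_to_indicator_def)
    then show "(\<lambda>k. ennreal (g k x)) \<longlonglongrightarrow> indicator U x" by (simp add: ennreal_indicator)
  qed
  have U: "U \<in> sets M"
  proof -
    have "(\<lambda>x. SUP k. ennreal (g k x)) \<in> borel_measurable M" using gm by measurable
    then have "(indicator U :: 'a \<Rightarrow> ennreal) \<in> borel_measurable M" by (simp add: lim)
    then have "{x \<in> space M. indicator U x = (1::ennreal)} \<in> sets M" by measurable
    moreover have "{x \<in> space M. indicator U x = (1::ennreal)} = U"
      using sets_eq_imp_space_eq[OF M(2)] by (auto simp: indicator_def)
    ultimately show ?thesis by simp
  qed
  have "emeasure M U = (\<integral>\<^sup>+x. indicator U x \<partial>M)" using U by simp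
  also have "\<dots> = (\<integral>\<^sup>+x. (SUP k. ennreal (g k x)) \<partial>M)" by (simp add: lim)
  also have "\<dots> = (SUP k. \<integral>\<^sup>+x. ennreal (g k x) \<partial>M)"
    using g gm by (intro nn_integral_monotone_convergence_SUP)
      (auto simp: incseq_def le_fun_def increases_to_indicator_def intro!: ennreal_leI)
  also have "\<dots> = (SUP k. ennreal (\<integral>x. g k x \<partial>M))"
    using g0 by (simp add: nn_integral_bcontfun_finite[OF M])
  finally show ?thesis .
qed

text \<open>
  A family of finite measures \<open>k x\<close> acting on \<open>C(X)\<close>.  The aim is to show that an identity
  \<open>\<integral> T f dM = \<integral> f dN\<close> for continuous \<open>f\<close> extends to Borel functions.  It is used with \<open>M = N = \<pi>\<close>
  for invariance, with \<open>M = k s x\<close> and \<open>N = k (s + t) x\<close> for the semigroup law, and with \<open>M = \<mu>\<close> for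
  the logarithmic inequality.
\<close>

locale kernel =
  fixes k :: "'a::metric_space \<Rightarrow> 'a measure" and T :: "('a \<Rightarrow>\<^sub>C real) \<Rightarrow> 'a \<Rightarrow>\<^sub>C real"
  assumes sets_k: "sets (k x) = sets borel"
    and finite_k: "finite_measure (k x)"
    and T: "T f x = (\<integral>y. f y \<partial>k x)"
begin

lemma kernel_induct:
  assumes M: "finite_measure M" "sets M = sets borel" and N: "finite_measure N" "sets N = sets borel"
    and MN: "\<And>f. (\<integral>x. T f x \<partial>M) = (\<integral>x. f x \<partial>N)"
    and A: "A \<in> sets borel"
  shows "(\<lambda>x. emeasure (k x) A) \<in> borel_measurable borel \<and> (\<integral>\<^sup>+x. emeasure (k x) A \<partial>M) = emeasure N A"
  using A
proof (induction rule: borel_induct_open)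
  case (basic U)
  obtain g where g: "increases_to_indicator g U" using open_indicator_increasing_limit[OF basic] ..
  have g0: "0 \<le> g i x" for i x using g by (simp add: increases_to_indicator_def)
  have T0: "0 \<le> T (g i) x" for i x using g0 by (simp add: T)
  have Tmono: "T (g i) x \<le> T (g j) x" if "i \<le> j" for i j x
    unfolding T using g that
    by (intro integral_mono integrable_bcontfun_finite finite_k sets_k) (auto simp: increases_to_indicator_def)
  have eq: "emeasure (k x) U = (SUP i. ennreal (T (g i) x))" for x
    unfolding T by (rule emeasure_open_eq_SUP[OF finite_k sets_k g])
  have bT: "apply_bcontfun f \<in> borel_measurable borel" for f :: "'a \<Rightarrow>\<^sub>C real"
    by (intro borel_measurable_continuous_onI) auto
  have mT: "apply_bcontfun f \<in> borel_measurable M" for f :: "'a \<Rightarrow>\<^sub>C real"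
    unfolding measurable_cong_sets[OF M(2) refl] by (rule bT)
  have "(\<integral>\<^sup>+x. emeasure (k x) U \<partial>M) = (SUP i. \<integral>\<^sup>+x. ennreal (T (g i) x) \<partial>M)"
    unfolding eq using Tmono mT
    by (intro nn_integral_monotone_convergence_SUP) (auto simp: incseq_def le_fun_def intro!: ennreal_leI)
  also have "\<dots> = (SUP i. ennreal (\<integral>x. g i x \<partial>N))"
    using T0 by (simp add: nn_integral_bcontfun_finite[OF M] MN)
  also have "\<dots> = emeasure N U" by (rule emeasure_open_eq_SUP[OF N g, symmetric])
  finally have "(\<integral>\<^sup>+x. emeasure (k x) U \<partial>M) = emeasure N U" .
  moreover have "(\<lambda>x. emeasure (k x) U) \<in> borel_measurable borel"
    unfolding eq using bT by measurable
  ultimately show ?case by simp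
next
  case empty
  show ?case by simp
next
  case (compl A)
  have UNIV: "(\<lambda>x. emeasure (k x) UNIV) \<in> borel_measurable borel \<and> (\<integral>\<^sup>+x. emeasure (k x) UNIV \<partial>M) = emeasure N UNIV"
  proof -
    have T1: "0 \<le> T (const_bcontfun 1) x" for x by (simp add: T)
    have eq: "emeasure (k x) UNIV = ennreal (T (const_bcontfun 1) x)" for x
      using sets_eq_imp_space_eq[OF sets_k[of x]]
      by (simp add: T finite_measure.emeasure_eq_measure[OF finite_k])
    have "(\<integral>\<^sup>+x. emeasure (k x) UNIV \<partial>M) = ennreal (\<integral>x. 1 \<partial>N)"
      unfolding eq using T1 by (simp add: nn_integral_bcontfun_finite[OF M] MN)
    also have "\<dots> = emeasure N UNIV"
      using sets_eq_imp_space_eq[OF N(2)] by (simp add: finite_measure.emeasure_eq_measure[OF N(1)])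
    moreover have "apply_bcontfun (T (const_bcontfun 1)) \<in> borel_measurable borel"
      by (intro borel_measurable_continuous_onI) auto
    ultimately show ?thesis unfolding eq by (auto intro: measurable_compose[OF _ measurable_ennreal])
  qed
  have meas: "f \<in> borel_measurable borel \<Longrightarrow> f \<in> borel_measurable M" for f :: "'a \<Rightarrow> ennreal"
    by (simp add: measurable_cong_sets[OF M(2) refl])
  have eq: "emeasure (k x) (UNIV - A) = emeasure (k x) UNIV - emeasure (k x) A" for x
    using compl finite_measure.emeasure_finite[OF finite_k]
    by (intro emeasure_Diff) (auto simp: sets_k)
  have "(\<integral>\<^sup>+x. emeasure (k x) (UNIV - A) \<partial>M) = emeasure N UNIV - emeasure N A"
    unfolding eq using UNIV compl finite_measure.emeasure_finite[OF N(1)]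
    by (subst nn_integral_diff) (auto intro!: meas emeasure_mono simp: sets_k)
  also have "\<dots> = emeasure N (UNIV - A)"
    using compl finite_measure.emeasure_finite[OF N(1)] by (intro emeasure_Diff[symmetric]) (auto simp: N(2))
  finally show ?case using UNIV compl unfolding eq by auto
next
  case (union A)
  have meas: "f \<in> borel_measurable borel \<Longrightarrow> f \<in> borel_measurable M" for f :: "'a \<Rightarrow> ennreal"
    by (simp add: measurable_cong_sets[OF M(2) refl])
  have eq: "emeasure (k x) (\<Union>i. A i) = (\<Sum>i. emeasure (k x) (A i))" for x
    using union by (intro suminf_emeasure[symmetric]) (auto simp: sets_k)
  have "(\<integral>\<^sup>+x. emeasure (k x) (\<Union>i. A i) \<partial>M) = (\<Sum>i. emeasure N (A i))"
    unfolding eq using union by (subst nn_integral_suminf) (auto intro!: meas)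
  also have "\<dots> = emeasure N (\<Union>i. A i)" using union by (intro suminf_emeasure) (auto simp: N(2))
  moreover have "(\<lambda>x. \<Sum>i. emeasure (k x) (A i)) \<in> borel_measurable borel"
    using union by (intro borel_measurable_suminf_order) auto
  ultimately show ?case unfolding eq by simp
qed

lemma kernel_nn_integral_induct:
  assumes M: "finite_measure M" "sets M = sets borel" and N: "finite_measure N" "sets N = sets borel"
    and MN: "\<And>f. (\<integral>x. T f x \<partial>M) = (\<integral>x. f x \<partial>N)"
    and u: "u \<in> borel_measurable borel"
  shows "(\<lambda>x. \<integral>\<^sup>+y. u y \<partial>k x) \<in> borel_measurable borel \<and>
    (\<integral>\<^sup>+x. (\<integral>\<^sup>+y. u y \<partial>k x) \<partial>M) = (\<integral>\<^sup>+x. u x \<partial>N)"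
  using u
proof (induction rule: borel_measurable_induct)
  case (cong f g)
  then show ?case by simp
next
  case (set A)
  then show ?case using kernel_induct[OF M N MN] by (simp add: sets_k N(2))
next
  case (mult u c)
  have m: "u \<in> borel_measurable (k x)" "u \<in> borel_measurable N" for x
    using mult by (simp_all add: measurable_cong_sets[OF sets_k refl] measurable_cong_sets[OF N(2) refl])
  have m': "(\<lambda>x. \<integral>\<^sup>+y. u y \<partial>k x) \<in> borel_measurable M"
    using mult by (simp add: measurable_cong_sets[OF M(2) refl])
  have "(\<lambda>x. c * \<integral>\<^sup>+y. u y \<partial>k x) \<in> borel_measurable borel"
    using mult by (intro borel_measurable_times_ennreal) auto
  then show ?case using mult m' by (simp add: nn_integral_cmult m)
next
  case (add u v)
  have m: "u \<in> borel_measurable (k x)" "u \<in> borel_measurable N" "v \<in> borel_measurable (k x)" "v \<in> borel_measurable N" for x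
    using add by (simp_all add: measurable_cong_sets[OF sets_k refl] measurable_cong_sets[OF N(2) refl])
  have m': "(\<lambda>x. \<integral>\<^sup>+y. u y \<partial>k x) \<in> borel_measurable M" "(\<lambda>x. \<integral>\<^sup>+y. v y \<partial>k x) \<in> borel_measurable M"
    using add by (simp_all add: measurable_cong_sets[OF M(2) refl])
  have "(\<lambda>x. (\<integral>\<^sup>+y. v y \<partial>k x) + (\<integral>\<^sup>+y. u y \<partial>k x)) \<in> borel_measurable borel"
    using add by (intro borel_measurable_add) auto
  then show ?case using add m' by (simp add: nn_integral_add m)
next
  case (seq U)
  have m: "U i \<in> borel_measurable (k x)" "U i \<in> borel_measurable N" for x i
    using seq by (simp_all add: measurable_cong_sets[OF sets_k refl] measurable_cong_sets[OF N(2) refl])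
  have m': "(\<lambda>x. \<integral>\<^sup>+y. U i y \<partial>k x) \<in> borel_measurable M" for i
    using seq by (simp add: measurable_cong_sets[OF M(2) refl])
  have eq: "(\<integral>\<^sup>+y. (SUP i. U i) y \<partial>k x) = (SUP i. \<integral>\<^sup>+y. U i y \<partial>k x)" for x
    using seq m by (simp add: nn_integral_monotone_convergence_SUP image_comp)
  have inc: "incseq (\<lambda>i x. \<integral>\<^sup>+y. U i y \<partial>k x)"
    using seq by (auto simp: incseq_def le_fun_def intro!: nn_integral_mono)
  have "(\<integral>\<^sup>+x. (\<integral>\<^sup>+y. (SUP i. U i) y \<partial>k x) \<partial>M) = (SUP i. \<integral>\<^sup>+x. (\<integral>\<^sup>+y. U i y \<partial>k x) \<partial>M)"
    unfolding eq by (rule nn_integral_monotone_convergence_SUP[OF inc m'])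
  also have "\<dots> = (\<integral>\<^sup>+x. (SUP i. U i) x \<partial>N)"
    using seq m by (simp add: nn_integral_monotone_convergence_SUP image_comp)
  moreover have "(\<lambda>x. SUP i. \<integral>\<^sup>+y. U i y \<partial>k x) \<in> borel_measurable borel"
    using seq by (intro borel_measurable_SUP) auto
  ultimately show ?case unfolding seq(5) eq by simp
qed

text \<open>
  Taking the null measure for both \<open>M\<close> and \<open>N\<close> isolates the measurability from the induction.
\<close>

lemma borel_measurable_kernel_nn_integral:
  assumes "u \<in> borel_measurable borel"
  shows "(\<lambda>x. \<integral>\<^sup>+y. u y \<partial>k x) \<in> borel_measurable borel"
proof -
  have "finite_measure (null_measure borel :: 'a measure)" by (intro finite_measureI) simp
  moreover have "(\<integral>x. f x \<partial>null_measure borel) = 0" for f :: "'a \<Rightarrow> real"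
    by (intro integral_eq_zero_AE AE_I[of _ _ UNIV]) auto
  ultimately show ?thesis
    using kernel_nn_integral_induct[of "null_measure borel" "null_measure borel" u] assms by auto
qed

lemmas kernel_nn_integral = kernel_nn_integral_induct[THEN conjunct2]

end

text \<open>
  One continuous function has to approximate in the \<open>L\<^sup>1\<close> norms of several measures at once: the entropy
  inequality compares integrals against \<open>\<mu>\<close> and \<open>\<pi>\<close>, and the logarithmic inequality compares integrals
  against \<open>\<mu>\<close> and its image under the kernel.
\<close>

locale finite_borel_measures =
  fixes \<M> :: "'a::metric_space measure set"
  assumes finite_\<M>: "finite \<M>"
    and finite_measure_\<M>: "M \<in> \<M> \<Longrightarrow> finite_measure M"
    and sets_\<M>: "M \<in> \<M> \<Longrightarrow> sets M = sets borel"
begin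

definition L1 :: "('a \<Rightarrow> real) set" where
  "L1 = {f \<in> borel_measurable borel. \<forall>M\<in>\<M>. integrable M f}"

definition approximable :: "('a \<Rightarrow> real) \<Rightarrow> bool" where
  "approximable f \<longleftrightarrow> (\<forall>e>0. \<exists>g. \<forall>M\<in>\<M>. (\<integral>x. \<bar>f x - apply_bcontfun g x\<bar> \<partial>M) < e)"

lemma bcontfun_L1: "apply_bcontfun g \<in> L1" for g :: "'a \<Rightarrow>\<^sub>C real"
  using finite_measure_\<M> sets_\<M>
  by (auto simp: L1_def intro!: integrable_bcontfun_finite borel_measurable_continuous_onI)

lemma indicator_L1: "A \<in> sets borel \<Longrightarrow> indicator A \<in> L1"
  using finite_measure_\<M> sets_\<M>
  by (auto simp: L1_def less_top[symmetric] finite_measure.emeasure_finite intro!: integrable_real_indicator)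

lemma L1_add: "f \<in> L1 \<Longrightarrow> g \<in> L1 \<Longrightarrow> (\<lambda>x. f x + g x) \<in> L1"
  by (auto simp: L1_def)

lemma L1_cmult: "f \<in> L1 \<Longrightarrow> (\<lambda>x. c * f x) \<in> L1"
  by (auto simp: L1_def)

lemma integrable_abs_diff: "f \<in> L1 \<Longrightarrow> g \<in> L1 \<Longrightarrow> M \<in> \<M> \<Longrightarrow> integrable M (\<lambda>x. \<bar>f x - g x\<bar>)"
  by (auto simp: L1_def)

lemma approximable_bcontfun: "approximable (apply_bcontfun g)"
  by (auto simp: approximable_def intro!: exI[of _ g])

lemma approximable_limit:
  assumes f: "f \<in> L1" and h: "\<And>e. 0 < e \<Longrightarrow> \<exists>h\<in>L1. approximable h \<and> (\<forall>M\<in>\<M>. (\<integral>x. \<bar>f x - h x\<bar> \<partial>M) < e)"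
  shows "approximable f"
  unfolding approximable_def
proof (intro allI impI)
  fix e :: real assume "0 < e"
  then obtain h where hh: "h \<in> L1" "approximable h" "\<And>M. M \<in> \<M> \<Longrightarrow> (\<integral>x. \<bar>f x - h x\<bar> \<partial>M) < e / 2"
    using h[of "e / 2"] by auto
  then obtain g where g: "\<And>M. M \<in> \<M> \<Longrightarrow> (\<integral>x. \<bar>h x - apply_bcontfun g x\<bar> \<partial>M) < e / 2"
    using \<open>0 < e\<close> unfolding approximable_def by (metis half_gt_zero)
  have "(\<integral>x. \<bar>f x - apply_bcontfun g x\<bar> \<partial>M) < e" if M: "M \<in> \<M>" for M
  proof -
    have "(\<integral>x. \<bar>f x - apply_bcontfun g x\<bar> \<partial>M) \<le> (\<integral>x. \<bar>f x - h x\<bar> + \<bar>h x - apply_bcontfun g x\<bar> \<partial>M)"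
      using f hh(1) bcontfun_L1 M
      by (intro integral_mono Bochner_Integration.integrable_add integrable_abs_diff) auto
    also have "\<dots> = (\<integral>x. \<bar>f x - h x\<bar> \<partial>M) + (\<integral>x. \<bar>h x - apply_bcontfun g x\<bar> \<partial>M)"
      using f hh(1) bcontfun_L1 M by (intro Bochner_Integration.integral_add integrable_abs_diff) auto
    also have "\<dots> < e" using hh(3)[OF M] g[OF M] by simp
    finally show ?thesis .
  qed
  then show "\<exists>g. \<forall>M\<in>\<M>. (\<integral>x. \<bar>f x - apply_bcontfun g x\<bar> \<partial>M) < e" by blast
qed

lemma approximable_dominated_limit:
  assumes U: "\<And>i. U i \<in> L1" "\<And>i. approximable (U i)" and f: "f \<in> L1" and w: "w \<in> L1"
    and dom: "\<And>i x. \<bar>U i x\<bar> \<le> w x" and lim: "\<And>x. (\<lambda>i::nat. U i x) \<longlonglongrightarrow> f x"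
  shows "approximable f"
proof (rule approximable_limit[OF f])
  fix e :: real assume "0 < e"
  have conv: "eventually (\<lambda>i. (\<integral>x. \<bar>f x - U i x\<bar> \<partial>M) < e) sequentially" if M: "M \<in> \<M>" for M
  proof -
    have wf: "\<bar>f x\<bar> \<le> w x" for x
      using tendsto_rabs[OF lim[of x]] dom by (intro LIMSEQ_le_const2[of "\<lambda>i. \<bar>U i x\<bar>"]) auto
    have "(\<lambda>i. \<integral>x. \<bar>f x - U i x\<bar> \<partial>M) \<longlonglongrightarrow> (\<integral>x. 0 \<partial>M)"
    proof (rule integral_dominated_convergence[where w = "\<lambda>x. 2 * w x"])
      show "integrable M (\<lambda>x. 2 * w x)" using w M by (simp add: L1_def)
      show "(\<lambda>x. \<bar>f x - U i x\<bar>) \<in> borel_measurable M" for i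
        using f U(1) M by (intro borel_measurable_integrable integrable_abs_diff)
      show "AE x in M. (\<lambda>i. \<bar>f x - U i x\<bar>) \<longlonglongrightarrow> 0"
      proof (rule AE_I2)
        fix x
        have "(\<lambda>i. \<bar>f x - U i x\<bar>) \<longlonglongrightarrow> \<bar>f x - f x\<bar>" by (intro tendsto_intros lim)
        then show "(\<lambda>i. \<bar>f x - U i x\<bar>) \<longlonglongrightarrow> 0" by simp
      qed
      show "AE x in M. norm \<bar>f x - U i x\<bar> \<le> 2 * w x" for i
      proof (rule AE_I2)
        fix x show "norm \<bar>f x - U i x\<bar> \<le> 2 * w x" using wf[of x] dom[of i x] by simp
      qed
    qed simp
    then show ?thesis using \<open>0 < e\<close> by (intro order_tendstoD(2)) auto
  qed
  then have "eventually (\<lambda>i. \<forall>M\<in>\<M>. (\<integral>x. \<bar>f x - U i x\<bar> \<partial>M) < e) sequentially"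
    using finite_\<M> by (simp add: eventually_ball_finite_distrib)
  then obtain i where "\<forall>M\<in>\<M>. (\<integral>x. \<bar>f x - U i x\<bar> \<partial>M) < e"
    using eventually_happens'[OF sequentially_bot] by blast
  then show "\<exists>h\<in>L1. approximable h \<and> (\<forall>M\<in>\<M>. (\<integral>x. \<bar>f x - h x\<bar> \<partial>M) < e)"
    using U by blast
qed

lemma approximable_add:
  assumes f: "f \<in> L1" "approximable f" and h: "h \<in> L1" "approximable h"
  shows "approximable (\<lambda>x. f x + h x)"
  unfolding approximable_def
proof (intro allI impI)
  fix e :: real assume "0 < e"
  then obtain u v where uv: "\<And>M. M \<in> \<M> \<Longrightarrow> (\<integral>x. \<bar>f x - apply_bcontfun u x\<bar> \<partial>M) < e / 2"
    "\<And>M. M \<in> \<M> \<Longrightarrow> (\<integral>x. \<bar>h x - apply_bcontfun v x\<bar> \<partial>M) < e / 2"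
    using f(2) h(2) unfolding approximable_def by (metis half_gt_zero)
  have "(\<integral>x. \<bar>f x + h x - apply_bcontfun (u + v) x\<bar> \<partial>M) < e" if M: "M \<in> \<M>" for M
  proof -
    have "(\<integral>x. \<bar>f x + h x - apply_bcontfun (u + v) x\<bar> \<partial>M)
        \<le> (\<integral>x. \<bar>f x - apply_bcontfun u x\<bar> + \<bar>h x - apply_bcontfun v x\<bar> \<partial>M)"
      using f h bcontfun_L1 M
      by (intro integral_mono Bochner_Integration.integrable_add integrable_abs_diff L1_add) (auto intro!: L1_add)
    also have "\<dots> = (\<integral>x. \<bar>f x - apply_bcontfun u x\<bar> \<partial>M) + (\<integral>x. \<bar>h x - apply_bcontfun v x\<bar> \<partial>M)"
      using f h bcontfun_L1 M by (intro Bochner_Integration.integral_add integrable_abs_diff) auto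
    also have "\<dots> < e" using uv M by fastforce
    finally show ?thesis .
  qed
  then show "\<exists>g. \<forall>M\<in>\<M>. (\<integral>x. \<bar>f x + h x - apply_bcontfun g x\<bar> \<partial>M) < e" by blast
qed

lemma approximable_cmult:
  assumes f: "f \<in> L1" "approximable f"
  shows "approximable (\<lambda>x. c * f x)"
  unfolding approximable_def
proof (intro allI impI)
  fix e :: real assume e: "0 < e"
  then obtain u where u: "\<And>M. M \<in> \<M> \<Longrightarrow> (\<integral>x. \<bar>f x - apply_bcontfun u x\<bar> \<partial>M) < e / (\<bar>c\<bar> + 1)"
    using f(2) unfolding approximable_def by (metis abs_ge_zero add_nonneg_pos divide_pos_pos zero_less_one)
  have "(\<integral>x. \<bar>c * f x - apply_bcontfun (c *\<^sub>R u) x\<bar> \<partial>M) < e" if M: "M \<in> \<M>" for M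
  proof -
    have "(\<integral>x. \<bar>c * f x - apply_bcontfun (c *\<^sub>R u) x\<bar> \<partial>M) = (\<integral>x. \<bar>c\<bar> * \<bar>f x - apply_bcontfun u x\<bar> \<partial>M)"
      by (simp add: abs_mult flip: right_diff_distrib)
    also have "\<dots> = \<bar>c\<bar> * (\<integral>x. \<bar>f x - apply_bcontfun u x\<bar> \<partial>M)" by simp
    also have "\<dots> \<le> \<bar>c\<bar> * (e / (\<bar>c\<bar> + 1))" using u[OF M] by (intro mult_left_mono) auto
    also have "\<dots> < e" using e by (simp add: field_simps)
    finally show ?thesis .
  qed
  then show "\<exists>g. \<forall>M\<in>\<M>. (\<integral>x. \<bar>c * f x - apply_bcontfun g x\<bar> \<partial>M) < e" by blast
qed

lemma approximable_indicator:
  assumes "A \<in> sets borel"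
  shows "approximable (indicator A)"
  using assms
proof (induction rule: borel_induct_open)
  case (basic U)
  obtain g where g: "increases_to_indicator g U" using open_indicator_increasing_limit[OF basic] ..
  show ?case
  proof (rule approximable_dominated_limit[of "\<lambda>i. apply_bcontfun (g i)" _ "indicator U"])
    show "\<bar>g i x\<bar> \<le> indicator U x" for i x using g by (simp add: increases_to_indicator_def)
    show "(\<lambda>i. g i x) \<longlonglongrightarrow> indicator U x" for x using g by (simp add: increases_to_indicator_def)
  qed (use basic in \<open>auto intro: bcontfun_L1 approximable_bcontfun indicator_L1\<close>)
next
  case empty
  show ?case using approximable_bcontfun[of 0] by (simp add: zero_bcontfun.rep_eq)
next
  case (compl A)
  have "approximable (\<lambda>x. apply_bcontfun (const_bcontfun 1) x + (-1) * indicator A x)"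
    using compl by (intro approximable_add approximable_cmult bcontfun_L1 approximable_bcontfun L1_cmult indicator_L1)
  moreover have "(\<lambda>x. apply_bcontfun (const_bcontfun 1) x + (-1) * indicator A x) = (indicator (UNIV - A) :: 'a \<Rightarrow> real)"
    by (auto simp: indicator_def)
  ultimately show ?case by simp
next
  case (union A)
  have fin: "(\<lambda>x. \<Sum>i<n. indicator (A i) x) \<in> L1 \<and> approximable (\<lambda>x. \<Sum>i<n. indicator (A i) x)" for n
  proof (induction n)
    case 0
    then show ?case using approximable_bcontfun[of 0] bcontfun_L1[of 0] by simp
  next
    case (Suc n)
    then show ?case using union by (auto intro!: L1_add approximable_add indicator_L1)
  qed
  have sum_eq: "(\<Sum>i<n. indicator (A i) x) = (indicator (\<Union>i<n. A i) x :: real)" for n x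
    using union(1) by (intro indicator_UN_disjoint[symmetric]) (auto simp: disjoint_family_on_def)
  show ?case
  proof (rule approximable_dominated_limit[of "\<lambda>n x. \<Sum>i<n. indicator (A i) x" _ "indicator UNIV"])
    show "\<bar>\<Sum>i<n. indicator (A i) x\<bar> \<le> (indicator UNIV x :: real)" for n x
      unfolding sum_eq by (simp add: indicator_def)
    show "(\<lambda>n. \<Sum>i<n. indicator (A i) x) \<longlonglongrightarrow> (indicator (\<Union>i. A i) x :: real)" for x
      unfolding sum_eq by (rule LIMSEQ_indicator_UN)
    show "(indicator UNIV :: 'a \<Rightarrow> real) \<in> L1" by (rule indicator_L1) simp
  qed (use fin union in \<open>auto intro!: indicator_L1\<close>)
qed

lemma approximable_nonneg:
  assumes u: "u \<in> L1" and nn: "\<And>x. 0 \<le> u x"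
  shows "approximable u"
proof -
  have um: "u \<in> borel_measurable borel" using u by (simp add: L1_def)
  have dom: "v \<in> L1" if "v \<in> borel_measurable borel" "\<And>x. 0 \<le> v x" "w \<in> L1" "\<And>x. v x \<le> w x" for v w
  proof -
    have "integrable M v" if M: "M \<in> \<M>" for M
    proof (rule Bochner_Integration.integrable_bound)
      show "integrable M w" using \<open>w \<in> L1\<close> M by (simp add: L1_def)
      show "v \<in> borel_measurable M"
        using \<open>v \<in> borel_measurable borel\<close> by (simp add: measurable_cong_sets[OF sets_\<M>[OF M] refl])
      show "AE x in M. norm (v x) \<le> norm (w x)"
        using \<open>\<And>x. 0 \<le> v x\<close> \<open>\<And>x. v x \<le> w x\<close> by (intro AE_I2) (simp add: order_trans[OF _ abs_ge_self])
    qed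
    then show ?thesis using \<open>v \<in> borel_measurable borel\<close> by (simp add: L1_def)
  qed
  have "u \<in> L1 \<longrightarrow> approximable u" using um nn
  proof (induction rule: borel_measurable_induct_real)
    case (set A)
    then show ?case by (simp add: approximable_indicator)
  next
    case (mult u c)
    show ?case
    proof (cases "c = 0")
      case True
      then show ?thesis using approximable_bcontfun[of 0] by simp
    next
      case False
      show ?thesis
      proof
        assume "(\<lambda>x. c * u x) \<in> L1"
        from L1_cmult[OF this, of "1 / c"] have "u \<in> L1" using False by simp
        then show "approximable (\<lambda>x. c * u x)" using mult by (simp add: approximable_cmult)
      qed
    qed
  next
    case (add u v)
    show ?case
    proof
      assume vu: "(\<lambda>x. v x + u x) \<in> L1"
      have "u \<in> L1" "v \<in> L1" using add by (auto intro!: dom[OF _ _ vu])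
      then show "approximable (\<lambda>x. v x + u x)" using add by (simp add: approximable_add)
    qed
  next
    case (seq U)
    show ?case
    proof
      assume u: "u \<in> L1"
      have lim: "(\<lambda>i. U i x) \<longlonglongrightarrow> u x" for x using seq by simp
      have le: "U i x \<le> u x" for i x
        using seq lim[of x] by (intro incseq_le) (auto simp: incseq_def le_fun_def)
      have "U i \<in> L1" for i using seq by (intro dom[OF _ _ u le]) auto
      then show "approximable u"
        using seq le u lim by (intro approximable_dominated_limit[of U u u]) auto
    qed
  qed
  then show ?thesis using u by simp
qed

theorem continuous_dense_L1:
  fixes f :: "'a \<Rightarrow> real"
  assumes f: "f \<in> borel_measurable borel" "\<And>M. M \<in> \<M> \<Longrightarrow> integrable M f" and e: "0 < e"
  obtains g where "\<And>M. M \<in> \<M> \<Longrightarrow> (\<integral>x. \<bar>f x - apply_bcontfun g x\<bar> \<partial>M) < e"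
proof -
  let ?p = "\<lambda>x. max 0 (f x)" and ?n = "\<lambda>x. max 0 (- f x)"
  have L: "?p \<in> L1" "?n \<in> L1" using f by (auto simp: L1_def)
  have "approximable (\<lambda>x. ?p x + (-1) * ?n x)"
    using L by (intro approximable_add approximable_cmult approximable_nonneg L1_cmult) auto
  moreover have "(\<lambda>x. ?p x + (-1) * ?n x) = f" by (auto simp: max_def)
  ultimately have "approximable f" by simp
  then show ?thesis using that e unfolding approximable_def by blast
qed

end

context kernel
begin

lemma borel_measurable_kernel_integral:
  fixes h :: "'a \<Rightarrow> real"
  assumes h: "h \<in> borel_measurable borel"
  shows "(\<lambda>x. \<integral>y. h y \<partial>k x) \<in> borel_measurable borel"
proof -
  have hk: "h \<in> borel_measurable (k x)" for x
    using h by (simp add: measurable_cong_sets[OF sets_k refl])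
  let ?a = "\<lambda>x. \<integral>\<^sup>+y. ennreal \<bar>h y\<bar> \<partial>k x" and ?p = "\<lambda>x. \<integral>\<^sup>+y. ennreal (h y) \<partial>k x"
    and ?n = "\<lambda>x. \<integral>\<^sup>+y. ennreal (- h y) \<partial>k x"
  have "(\<integral>y. h y \<partial>k x) = (if ?a x < \<infinity> then enn2real (?p x) - enn2real (?n x) else 0)" for x
    using hk[of x]
    by (auto simp: real_lebesgue_integral_def integrable_iff_bounded intro!: not_integrable_integral_eq)
  moreover have "?a \<in> borel_measurable borel" "?p \<in> borel_measurable borel" "?n \<in> borel_measurable borel"
    using h by (auto intro!: borel_measurable_kernel_nn_integral)
  then have "(\<lambda>x. if ?a x < \<infinity> then enn2real (?p x) - enn2real (?n x) else 0) \<in> borel_measurable borel"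
    by measurable
  ultimately show ?thesis by simp
qed

lemma abs_kernel_integral_le:
  "ennreal \<bar>\<integral>y. h y \<partial>k x\<bar> \<le> (\<integral>\<^sup>+y. ennreal \<bar>h y\<bar> \<partial>k x)"
proof (cases "integrable (k x) h")
  case True
  then show ?thesis using integral_norm_bound_ennreal[OF True] by simp
qed (simp add: not_integrable_integral_eq)

lemma kernel_integrable_AE:
  fixes h :: "'a \<Rightarrow> real"
  assumes M: "finite_measure M" "sets M = sets borel" and N: "finite_measure N" "sets N = sets borel"
    and MN: "\<And>f. (\<integral>x. T f x \<partial>M) = (\<integral>x. f x \<partial>N)"
    and h: "h \<in> borel_measurable borel" "integrable N h"
  shows "AE x in M. (\<integral>\<^sup>+y. ennreal \<bar>h y\<bar> \<partial>k x) < \<infinity>"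
proof -
  have hm: "(\<lambda>x. ennreal \<bar>h x\<bar>) \<in> borel_measurable borel" using h(1) by measurable
  have "(\<integral>\<^sup>+x. (\<integral>\<^sup>+y. ennreal \<bar>h y\<bar> \<partial>k x) \<partial>M) = (\<integral>\<^sup>+x. ennreal \<bar>h x\<bar> \<partial>N)"
    by (rule kernel_nn_integral[OF M N MN hm])
  also have "\<dots> < \<infinity>" using h(2) by (simp add: integrable_iff_bounded)
  finally have "(\<integral>\<^sup>+x. (\<integral>\<^sup>+y. ennreal \<bar>h y\<bar> \<partial>k x) \<partial>M) \<noteq> \<infinity>" by simp
  then have "AE x in M. (\<integral>\<^sup>+y. ennreal \<bar>h y\<bar> \<partial>k x) \<noteq> \<infinity>"
    using borel_measurable_kernel_nn_integral[OF hm]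
    by (intro nn_integral_PInf_AE) (simp_all add: measurable_cong_sets[OF M(2) refl])
  then show ?thesis by (simp add: less_top)
qed

lemma integrable_kernel:
  assumes "h \<in> borel_measurable borel" "(\<integral>\<^sup>+y. ennreal \<bar>h y\<bar> \<partial>k x) < \<infinity>"
  shows "integrable (k x) h"
  using assms by (simp add: integrable_iff_bounded measurable_cong_sets[OF sets_k refl])

text \<open>
  The identity for nonnegative functions, applied to \<open>\<bar>h\<bar>\<close>, shows that \<open>h\<close> is integrable with respect
  to \<open>k x\<close> for \<open>M\<close>-almost every \<open>x\<close>; then it can be applied to the positive and negative parts of \<open>h\<close>.
\<close>

lemma kernel_integral_L1:
  fixes h :: "'a \<Rightarrow> real"
  assumes M: "finite_measure M" "sets M = sets borel" and N: "finite_measure N" "sets N = sets borel"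
    and MN: "\<And>f. (\<integral>x. T f x \<partial>M) = (\<integral>x. f x \<partial>N)"
    and h: "h \<in> borel_measurable borel" "integrable N h"
  shows "integrable M (\<lambda>x. \<integral>y. h y \<partial>k x)"
    and "(\<integral>x. \<bar>\<integral>y. h y \<partial>k x\<bar> \<partial>M) \<le> (\<integral>x. \<bar>h x\<bar> \<partial>N)"
    and "(\<integral>x. (\<integral>y. h y \<partial>k x) \<partial>M) = (\<integral>x. h x \<partial>N)"
proof -
  have meas: "f \<in> borel_measurable borel \<Longrightarrow> f \<in> borel_measurable M" for f :: "'a \<Rightarrow> real"
    by (simp add: measurable_cong_sets[OF M(2) refl])
  have abs: "(\<integral>\<^sup>+x. ennreal \<bar>\<integral>y. f y \<partial>k x\<bar> \<partial>M) \<le> (\<integral>\<^sup>+x. ennreal \<bar>f x\<bar> \<partial>N)"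
    if f: "f \<in> borel_measurable borel" for f :: "'a \<Rightarrow> real"
  proof -
    have "(\<integral>\<^sup>+x. ennreal \<bar>\<integral>y. f y \<partial>k x\<bar> \<partial>M) \<le> (\<integral>\<^sup>+x. (\<integral>\<^sup>+y. ennreal \<bar>f y\<bar> \<partial>k x) \<partial>M)"
      by (intro nn_integral_mono abs_kernel_integral_le)
    also have "\<dots> = (\<integral>\<^sup>+x. ennreal \<bar>f x\<bar> \<partial>N)"
      using f by (intro kernel_nn_integral[OF M N MN]) measurable
    finally show ?thesis .
  qed
  have int: "integrable M (\<lambda>x. \<integral>y. f y \<partial>k x)" if f: "f \<in> borel_measurable borel" "integrable N f" for f :: "'a \<Rightarrow> real"
    unfolding integrable_iff_bounded
    using meas[OF borel_measurable_kernel_integral[OF f(1)]] abs[OF f(1)] f(2)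
    by (auto simp: integrable_iff_bounded intro: le_less_trans)
  show int_h: "integrable M (\<lambda>x. \<integral>y. h y \<partial>k x)" by (rule int[OF h])
  have "ennreal (\<integral>x. \<bar>\<integral>y. h y \<partial>k x\<bar> \<partial>M) \<le> ennreal (\<integral>x. \<bar>h x\<bar> \<partial>N)"
    using abs[OF h(1)] int_h h(2) by (simp add: nn_integral_eq_integral)
  then show "(\<integral>x. \<bar>\<integral>y. h y \<partial>k x\<bar> \<partial>M) \<le> (\<integral>x. \<bar>h x\<bar> \<partial>N)"
    by (simp add: ennreal_le_iff Bochner_Integration.integral_nonneg)
  have nonneg: "(\<integral>x. (\<integral>y. f y \<partial>k x) \<partial>M) = (\<integral>x. f x \<partial>N)"
    if f: "f \<in> borel_measurable borel" "integrable N f" and nn: "\<And>x. 0 \<le> f x" for f :: "'a \<Rightarrow> real"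
  proof -
    have "ennreal (\<integral>x. (\<integral>y. f y \<partial>k x) \<partial>M) = (\<integral>\<^sup>+x. ennreal (\<integral>y. f y \<partial>k x) \<partial>M)"
      using nn by (intro nn_integral_eq_integral[symmetric] int f) (simp add: Bochner_Integration.integral_nonneg)
    also have "\<dots> = (\<integral>\<^sup>+x. (\<integral>\<^sup>+y. ennreal (f y) \<partial>k x) \<partial>M)"
    proof (rule nn_integral_cong_AE)
      show "AE x in M. ennreal (\<integral>y. f y \<partial>k x) = (\<integral>\<^sup>+y. ennreal (f y) \<partial>k x)"
        using kernel_integrable_AE[OF M N MN f]
      proof eventually_elim
        case (elim x)
        then show ?case
          using nn by (intro nn_integral_eq_integral[symmetric] integrable_kernel f(1)) auto
      qed
    qed
    also have "\<dots> = (\<integral>\<^sup>+x. ennreal (f x) \<partial>N)"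
      using f by (intro kernel_nn_integral[OF M N MN]) measurable
    also have "\<dots> = ennreal (\<integral>x. f x \<partial>N)" using nn f by (intro nn_integral_eq_integral) auto
    finally show ?thesis using nn by (simp add: Bochner_Integration.integral_nonneg)
  qed
  let ?p = "\<lambda>x. max 0 (h x)" and ?n = "\<lambda>x. max 0 (- h x)"
  have pn: "?p \<in> borel_measurable borel" "?n \<in> borel_measurable borel" "integrable N ?p" "integrable N ?n"
    using h by auto
  have "(\<integral>x. (\<integral>y. h y \<partial>k x) \<partial>M) = (\<integral>x. (\<integral>y. ?p y \<partial>k x) - (\<integral>y. ?n y \<partial>k x) \<partial>M)"
  proof (rule integral_cong_AE)
    show "AE x in M. (\<integral>y. h y \<partial>k x) = (\<integral>y. ?p y \<partial>k x) - (\<integral>y. ?n y \<partial>k x)"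
      using kernel_integrable_AE[OF M N MN h]
    proof eventually_elim
      case (elim x)
      then have "integrable (k x) h" by (rule integrable_kernel[OF h(1)])
      then have "(\<integral>y. ?p y \<partial>k x) - (\<integral>y. ?n y \<partial>k x) = (\<integral>y. ?p y - ?n y \<partial>k x)" by simp
      also have "(\<lambda>y. ?p y - ?n y) = h" by (auto simp: max_def)
      finally show ?case by simp
    qed
  qed (use pn h in \<open>auto intro!: meas borel_measurable_kernel_integral borel_measurable_diff\<close>)
  also have "\<dots> = (\<integral>x. ?p x \<partial>N) - (\<integral>x. ?n x \<partial>N)"
    using nonneg[OF pn(1,3)] nonneg[OF pn(2,4)] int[OF pn(1,3)] int[OF pn(2,4)] by simp
  also have "\<dots> = (\<integral>x. ?p x - ?n x \<partial>N)" using pn by simp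
  also have "(\<lambda>y. ?p y - ?n y) = h" by (auto simp: max_def)
  finally show "(\<integral>x. (\<integral>y. h y \<partial>k x) \<partial>M) = (\<integral>x. h x \<partial>N)" .
qed

end

lemma clamped_continuous_approximation:
  fixes w :: "'a::metric_space \<Rightarrow> real"
  assumes M: "finite_measure M" "sets M = sets borel" and N: "finite_measure N" "sets N = sets borel"
    and w: "w \<in> borel_measurable borel" "\<And>x. m \<le> w x" "\<And>x. w x \<le> B" and e: "0 < e"
  shows "\<exists>g :: 'a \<Rightarrow>\<^sub>C real. (\<forall>x. m \<le> g x \<and> g x \<le> B) \<and>
    (\<integral>x. \<bar>w x - g x\<bar> \<partial>M) < e \<and> (\<integral>x. \<bar>w x - g x\<bar> \<partial>N) < e"
proof -
  have cases: "K = M \<or> K = N" if "K \<in> {M, N}" for K using that by simp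
  have fin: "finite_measure K" if "K \<in> {M, N}" for K
    using cases[OF that] M(1) N(1) by (elim disjE) (simp_all only:)
  have sets: "sets K = sets borel" if "K \<in> {M, N}" for K
    using cases[OF that] M(2) N(2) by (elim disjE) (simp_all only:)
  have "finite {M, N}" by simp
  from finite_borel_measures.intro[OF this fin sets] interpret finite_borel_measures "{M, N}" by simp
  have int: "integrable K w" if "K \<in> {M, N}" for K
  proof -
    interpret finite_measure K using finite_measure_\<M>[OF that] .
    have "\<bar>w x\<bar> \<le> max \<bar>m\<bar> \<bar>B\<bar>" for x using w(2,3)[of x] by linarith
    then show ?thesis
      using w(1) by (intro integrable_const_bound[of _ "max \<bar>m\<bar> \<bar>B\<bar>"])
        (auto simp: measurable_cong_sets[OF sets_\<M>[OF that] refl])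
  qed
  obtain g where g: "\<And>K. K \<in> {M, N} \<Longrightarrow> (\<integral>x. \<bar>w x - apply_bcontfun g x\<bar> \<partial>K) < e"
    using continuous_dense_L1[OF w(1) int e] by metis
  have mB: "m \<le> B" using w(2,3) order_trans by blast
  define h where "h = Bcontfun (\<lambda>x. min B (max m (g x)))"
  have h: "h x = min B (max m (g x))" for x
  proof -
    have "(\<lambda>x. min B (max m (g x))) \<in> bcontfun"
      by (rule bcontfun_normI[of _ "max \<bar>m\<bar> \<bar>B\<bar>"]) (auto intro!: continuous_intros)
    then show ?thesis by (simp add: h_def Bcontfun_inverse)
  qed
  have "(\<integral>x. \<bar>w x - h x\<bar> \<partial>K) < e" if K: "K \<in> {M, N}" for K
  proof -
    have "(\<integral>x. \<bar>w x - h x\<bar> \<partial>K) \<le> (\<integral>x. \<bar>w x - g x\<bar> \<partial>K)"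
    proof (rule integral_mono)
      have L: "w \<in> L1" using w(1) int by (simp add: L1_def)
      show "integrable K (\<lambda>x. \<bar>w x - h x\<bar>)" "integrable K (\<lambda>x. \<bar>w x - g x\<bar>)"
        using K L bcontfun_L1 by (auto intro!: integrable_abs_diff)
      show "\<bar>w x - h x\<bar> \<le> \<bar>w x - g x\<bar>" for x
        using w(2,3)[of x] by (auto simp: h min_def max_def)
    qed
    then show ?thesis using g[OF K] by simp
  qed
  then show ?thesis using mB by (intro exI[of _ h]) (auto simp: h)
qed

lemma nn_integral_fatou_le:
  fixes u :: "nat \<Rightarrow> 'a \<Rightarrow> real"
  assumes "\<And>n. u n \<in> borel_measurable M" and lim: "AE x in M. (\<lambda>n. u n x) \<longlonglongrightarrow> v x"
    and le: "\<And>n. (\<integral>\<^sup>+x. ennreal (u n x) \<partial>M) \<le> ennreal (d n)" and d: "d \<longlonglongrightarrow> D"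
  shows "(\<integral>\<^sup>+x. ennreal (v x) \<partial>M) \<le> ennreal D"
proof -
  have "(\<integral>\<^sup>+x. ennreal (v x) \<partial>M) = (\<integral>\<^sup>+x. liminf (\<lambda>n. ennreal (u n x)) \<partial>M)"
  proof (rule nn_integral_cong_AE)
    show "AE x in M. ennreal (v x) = liminf (\<lambda>n. ennreal (u n x))"
      using lim
    proof eventually_elim
      case (elim x)
      then have "(\<lambda>n. ennreal (u n x)) \<longlonglongrightarrow> ennreal (v x)" by (rule tendsto_ennrealI)
      then show ?case by (intro lim_imp_Liminf[symmetric]) simp
    qed
  qed
  also have "\<dots> \<le> liminf (\<lambda>n. \<integral>\<^sup>+x. ennreal (u n x) \<partial>M)"
    using assms(1) by (intro nn_integral_liminf) measurable
  also have "\<dots> \<le> liminf (\<lambda>n. ennreal (d n))"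
    using le by (intro Liminf_mono always_eventually) auto
  also have "\<dots> = ennreal D"
    by (intro lim_imp_Liminf tendsto_ennrealI d) simp
  finally show ?thesis .
qed

context equilibrium
begin

text \<open>
  Normalising the invariant functional costs an additive constant \<open>c\<close>, the logarithm of its total mass.
  The last inequality is the variational form of the statement that the relative entropy of \<open>\<mu>\<close> with
  respect to \<open>\<pi>\<close> is at most \<open>c\<close>.
\<close>

theorem invariant_probability_exists:
  "\<exists>\<pi> c. prob_space \<pi> \<and> sets \<pi> = sets borel \<and>
    (\<forall>t\<ge>0. \<forall>f. (\<integral>x. Q t f x \<partial>\<pi>) = (\<integral>x. f x \<partial>\<pi>)) \<and>
    (\<forall>w :: 'a \<Rightarrow>\<^sub>C real. (\<forall>x. 0 < w x) \<longrightarrow> (\<integral>x. ln (w x) \<partial>\<mu>) \<le> c + ln (\<integral>x. w x \<partial>\<pi>))"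
proof -
  obtain \<phi> where pf: "positive_functional \<phi>" and phi: "\<forall>t\<ge>0. \<forall>f. \<phi> (Q t f) = \<phi> f"
    "\<forall>w. (\<forall>x. 0 < apply_bcontfun w x) \<longrightarrow> exp (\<integral>x. ln (w x) \<partial>\<mu>) \<le> \<phi> w"
    using invariant_functional_exists by (elim exE conjE)
  have \<phi>: "\<And>t f. 0 \<le> t \<Longrightarrow> \<phi> (Q t f) = \<phi> f"
    "\<And>w. (\<And>x. 0 < apply_bcontfun w x) \<Longrightarrow> exp (\<integral>x. ln (w x) \<partial>\<mu>) \<le> \<phi> w"
    using phi by simp_all
  interpret \<phi>: positive_functional \<phi> by (rule pf)
  let ?one = "const_bcontfun 1 :: 'a \<Rightarrow>\<^sub>C real"
  have one: "1 \<le> \<phi> ?one" using \<phi>(2)[of ?one] by simp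
  interpret n: positive_functional "\<lambda>f. \<phi> f / \<phi> ?one"
  proof
    show "\<phi> (f + g) / \<phi> ?one = \<phi> f / \<phi> ?one + \<phi> g / \<phi> ?one" for f g
      by (simp add: linear_add[OF \<phi>.lin] add_divide_distrib)
    show "\<phi> (r *\<^sub>R f) / \<phi> ?one = r *\<^sub>R (\<phi> f / \<phi> ?one)" for r f
      by (simp add: linear_cmul[OF \<phi>.lin])
    show "0 \<le> \<phi> f / \<phi> ?one" if "\<And>x. 0 \<le> apply_bcontfun f x" for f
      using \<phi>.pos[of f] that one by simp
  qed (rule cpt)
  obtain \<pi> where \<pi>: "sets \<pi> = sets borel" "finite_measure \<pi>"
    "\<And>f. \<phi> f / \<phi> ?one = (\<integral>x. apply_bcontfun f x \<partial>\<pi>)"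
    using n.riesz_representation by metis
  have sp: "space \<pi> = UNIV" using sets_eq_imp_space_eq[OF \<pi>(1)] by simp
  have mass: "measure \<pi> UNIV = 1" using \<pi>(3)[of ?one] one by (simp add: sp)
  have prob: "prob_space \<pi>"
    by (intro prob_spaceI) (simp add: sp mass finite_measure.emeasure_eq_measure[OF \<pi>(2)])
  have inv: "(\<integral>x. Q t f x \<partial>\<pi>) = (\<integral>x. f x \<partial>\<pi>)" if "0 \<le> t" for t f
    using \<pi>(3)[of f] \<pi>(3)[of "Q t f"] \<phi>(1)[OF that, of f] by simp
  have ent: "(\<integral>x. ln (w x) \<partial>\<mu>) \<le> ln (\<phi> ?one) + ln (\<integral>x. w x \<partial>\<pi>)" if w: "\<And>x. 0 < apply_bcontfun w x" for w
  proof -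
    have p: "0 < \<phi> w" using \<phi>(2)[OF w] less_le_trans[OF exp_gt_zero] by blast
    have "(\<integral>x. ln (w x) \<partial>\<mu>) \<le> ln (\<phi> w)" using \<phi>(2)[OF w] p by (simp add: ln_ge_iff)
    also have "\<dots> = ln (\<phi> ?one) + ln (\<integral>x. w x \<partial>\<pi>)"
      using p one unfolding \<pi>(3)[symmetric] by (simp add: ln_div)
    finally show ?thesis .
  qed
  have all: "prob_space \<pi> \<and> sets \<pi> = sets borel \<and>
    (\<forall>t\<ge>0. \<forall>f. (\<integral>x. Q t f x \<partial>\<pi>) = (\<integral>x. f x \<partial>\<pi>)) \<and>
    (\<forall>w. (\<forall>x. 0 < apply_bcontfun w x) \<longrightarrow> (\<integral>x. ln (w x) \<partial>\<mu>) \<le> ln (\<phi> ?one) + ln (\<integral>x. w x \<partial>\<pi>))"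
    using prob \<pi>(1) inv ent by simp
  show ?thesis by (rule exI[of _ \<pi>], rule exI[of _ "ln (\<phi> ?one)"], rule all)
qed

end

locale ground = equilibrium Q C \<mu> for Q :: "'a::metric_space op_family" and C and \<mu> +
  fixes k :: "real \<Rightarrow> 'a \<Rightarrow> 'a measure" and \<pi> :: "'a measure" and c :: real
  assumes kernel_k: "0 \<le> t \<Longrightarrow> kernel (k t) (blinfun_apply (Q t))"
    and prob_\<pi>: "prob_space \<pi>"
    and sets_\<pi>: "sets \<pi> = sets borel"
    and invariant: "0 \<le> t \<Longrightarrow> (\<integral>x. Q t f x \<partial>\<pi>) = (\<integral>x. f x \<partial>\<pi>)"
    and entropy: "(\<And>x. 0 < apply_bcontfun w x) \<Longrightarrow> (\<integral>x. ln (w x) \<partial>\<mu>) \<le> c + ln (\<integral>x. w x \<partial>\<pi>)"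
begin

sublocale \<pi>: prob_space \<pi> by (rule prob_\<pi>)

lemma borel_\<pi>: "f \<in> borel_measurable \<pi> \<longleftrightarrow> f \<in> borel_measurable borel"
  by (rule arg_cong[of _ _ "\<lambda>S. f \<in> S", OF measurable_cong_sets[OF sets_\<pi> refl]])

lemma integrable_bounded_\<pi>: "f \<in> borel_measurable borel \<Longrightarrow> (\<And>x. \<bar>f x\<bar> \<le> B) \<Longrightarrow> integrable \<pi> (f :: 'a \<Rightarrow> real)"
  by (rule \<pi>.integrable_const_bound[of _ B]) (auto simp: borel_\<pi>)

subsection \<open>Absolute continuity and integrability of the logarithmic density\<close>

lemma entropy_borel:
  fixes w :: "'a \<Rightarrow> real"
  assumes w: "w \<in> borel_measurable borel" "0 < m" "\<And>x. m \<le> w x" "\<And>x. w x \<le> B"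
  shows "(\<integral>x. ln (w x) \<partial>\<mu>) \<le> c + ln (\<integral>x. w x \<partial>\<pi>)"
proof (rule field_le_epsilon)
  fix e :: real assume e: "0 < e"
  define d where "d = e * m / 2"
  have d: "0 < d" using e w(2) by (simp add: d_def)
  obtain g :: "'a \<Rightarrow>\<^sub>C real" where g: "\<And>x. m \<le> g x" "\<And>x. g x \<le> B"
    "(\<integral>x. \<bar>w x - g x\<bar> \<partial>\<mu>) < d" "(\<integral>x. \<bar>w x - g x\<bar> \<partial>\<pi>) < d"
    using clamped_continuous_approximation[OF finite_measure_axioms sets_\<mu> \<pi>.finite_measure_axioms sets_\<pi> w(1,3,4) d]
    by metis
  have wB: "\<bar>w x\<bar> \<le> B" "\<bar>g x\<bar> \<le> B" for x using w(2) w(3,4)[of x] g(1,2)[of x] by auto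
  note int = integrable_bounded_\<pi>[OF w(1) wB(1)] integrable_bounded_\<pi>[OF borel_bcontfun wB(2)]
  have 1: "(\<integral>x. ln (w x) \<partial>\<mu>) - (\<integral>x. ln (g x) \<partial>\<mu>) \<le> d / m"
  proof -
    have "\<bar>(\<integral>x. ln (w x) \<partial>\<mu>) - (\<integral>x. ln (g x) \<partial>\<mu>)\<bar> \<le> (\<integral>x. \<bar>w x - g x\<bar> \<partial>\<mu>) / m"
      by (rule ln_integral_lipschitz[OF w(1) borel_bcontfun w(2-4) g(1,2)])
    also have "\<dots> \<le> d / m" using g(3) w(2) by (intro divide_right_mono) auto
    finally show ?thesis by simp
  qed
  have 2: "(\<integral>x. ln (g x) \<partial>\<mu>) \<le> c + ln (\<integral>x. g x \<partial>\<pi>)"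
    by (rule entropy) (rule less_le_trans[OF w(2) g(1)])
  have lower: "m \<le> (\<integral>x. w x \<partial>\<pi>)" "m \<le> (\<integral>x. g x \<partial>\<pi>)"
    using int w(3) g(1) by (auto intro!: \<pi>.integral_ge_const)
  have 3: "ln (\<integral>x. g x \<partial>\<pi>) - ln (\<integral>x. w x \<partial>\<pi>) \<le> d / m"
  proof -
    have "\<bar>ln (\<integral>x. w x \<partial>\<pi>) - ln (\<integral>x. g x \<partial>\<pi>)\<bar> \<le> \<bar>(\<integral>x. w x \<partial>\<pi>) - (\<integral>x. g x \<partial>\<pi>)\<bar> / m"
      by (rule abs_ln_diff_le[OF w(2) lower])
    also have "\<bar>(\<integral>x. w x \<partial>\<pi>) - (\<integral>x. g x \<partial>\<pi>)\<bar> = \<bar>\<integral>x. w x - g x \<partial>\<pi>\<bar>" using int by simp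
    also have "\<dots> / m \<le> d / m"
      using order_trans[OF integral_abs_bound less_imp_le[OF g(4)]] w(2) by (intro divide_right_mono) auto
    finally show ?thesis by simp
  qed
  have "d / m = e / 2" using w(2) by (simp add: d_def)
  then show "(\<integral>x. ln (w x) \<partial>\<mu>) \<le> c + ln (\<integral>x. w x \<partial>\<pi>) + e" using 1 2 3 by linarith
qed

text \<open>
  Testing the entropy inequality with a function that is \<open>1\<close> off a \<open>\<pi>\<close>-null set \<open>A\<close> and huge on \<open>A\<close>
  forces \<open>\<mu>(A) = 0\<close>.
\<close>

theorem \<mu>_absolutely_continuous: "absolutely_continuous \<pi> \<mu>"
  unfolding absolutely_continuous_def
proof
  fix A assume A: "A \<in> null_sets \<pi>"
  then have Ab: "A \<in> sets borel" by (auto simp: sets_\<pi>)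
  have "measure \<mu> A = 0"
  proof (rule ccontr)
    assume "measure \<mu> A \<noteq> 0"
    then have p: "0 < measure \<mu> A" using measure_nonneg[of \<mu> A] by linarith
    (* chosen so that the integral of ln w exceeds c if A has positive measure *)
    define n where "n = exp ((c + 1) / measure \<mu> A)"
    define w where "w x = 1 + n * indicator A x" for x
    have n: "0 < n" by (simp add: n_def)
    have wm [measurable]: "w \<in> borel_measurable borel" unfolding w_def using Ab by measurable
    have "(\<integral>x. ln (w x) \<partial>\<mu>) \<le> c + ln (\<integral>x. w x \<partial>\<pi>)"
      by (rule entropy_borel[of w 1 "1 + n"]) (use n in \<open>auto simp: w_def indicator_def\<close>)
    also have "(\<integral>x. w x \<partial>\<pi>) = (\<integral>x. 1 \<partial>\<pi>)"
    proof (rule integral_cong_AE)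
      show "AE x in \<pi>. w x = 1" using AE_not_in[OF A] by eventually_elim (simp add: w_def)
    qed (auto simp: borel_\<pi>)
    also have "(\<integral>x. ln (w x) \<partial>\<mu>) = (\<integral>x. ln (1 + n) * indicator A x \<partial>\<mu>)"
      by (rule Bochner_Integration.integral_cong) (auto simp: w_def indicator_def)
    finally have "ln (1 + n) * measure \<mu> A \<le> c"
      using Ab by (simp add: \<pi>.prob_space sets_\<mu> space_\<mu>)
    moreover have "ln n \<le> ln (1 + n)" using n by simp
    then have "(c + 1) / measure \<mu> A * measure \<mu> A \<le> ln (1 + n) * measure \<mu> A"
      using p by (intro mult_right_mono) (auto simp: n_def)
    ultimately show False using p by simp
  qed
  then show "A \<in> null_sets \<mu>" using Ab by (auto simp: null_sets_def sets_\<mu> emeasure_eq_measure)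
qed

text \<open>
  The Radon--Nikodym derivative takes the value \<open>\<infinity>\<close> at most on a \<open>\<pi>\<close>-null set; there \<open>\<psi> = 0\<close>.
\<close>

definition \<psi> :: "'a \<Rightarrow> real" where "\<psi> x = enn2real (RN_deriv \<pi> \<mu> x)"

lemma \<psi>_nonneg [simp]: "0 \<le> \<psi> x"
  by (simp add: \<psi>_def)

lemma RN_deriv_measurable [measurable]: "RN_deriv \<pi> \<mu> \<in> borel_measurable borel"
  using borel_measurable_RN_deriv[of \<pi> \<mu>] unfolding borel_\<pi> .

lemma \<psi>_measurable [measurable]: "\<psi> \<in> borel_measurable borel"
  unfolding \<psi>_def[abs_def] by measurable

lemma RN_deriv_\<psi>: "AE x in \<pi>. RN_deriv \<pi> \<mu> x = ennreal (\<psi> x)"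
proof -
  have "AE x in \<pi>. RN_deriv \<pi> \<mu> x \<noteq> \<infinity>"
    by (rule \<pi>.RN_deriv_finite[OF sigma_finite_measure_axioms \<mu>_absolutely_continuous])
       (simp add: sets_\<mu> sets_\<pi>)
  then show ?thesis by eventually_elim (simp add: \<psi>_def ennreal_enn2real_if)
qed

lemma \<mu>_density: "\<mu> = density \<pi> (\<lambda>x. ennreal (\<psi> x))"
proof -
  have "density \<pi> (RN_deriv \<pi> \<mu>) = \<mu>"
    by (rule \<pi>.density_RN_deriv[OF \<mu>_absolutely_continuous]) (simp add: sets_\<mu> sets_\<pi>)
  moreover have "density \<pi> (RN_deriv \<pi> \<mu>) = density \<pi> (\<lambda>x. ennreal (\<psi> x))"
    by (rule density_cong) (use RN_deriv_\<psi> in \<open>simp_all add: borel_\<pi>\<close>)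
  ultimately show ?thesis by simp
qed

lemma AE_\<mu>_iff: "(AE x in \<mu>. R x) \<longleftrightarrow> (AE x in \<pi>. 0 < \<psi> x \<longrightarrow> R x)"
  by (subst \<mu>_density) (simp add: AE_density borel_\<pi>)

lemma AE_\<pi>_imp_\<mu>: "(AE x in \<pi>. R x) \<Longrightarrow> (AE x in \<mu>. R x)"
  unfolding AE_\<mu>_iff by (erule eventually_mono) simp

lemma AE_\<psi>_pos: "AE x in \<mu>. 0 < \<psi> x"
  by (simp add: AE_\<mu>_iff)

lemma nn_integral_\<mu>: "f \<in> borel_measurable borel \<Longrightarrow> (\<integral>\<^sup>+x. f x \<partial>\<mu>) = (\<integral>\<^sup>+x. ennreal (\<psi> x) * f x \<partial>\<pi>)"
  by (subst \<mu>_density) (simp add: nn_integral_density borel_\<pi>)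

lemma integrable_\<mu>: "f \<in> borel_measurable borel \<Longrightarrow> integrable \<mu> f \<longleftrightarrow> integrable \<pi> (\<lambda>x. f x * \<psi> x)"
  for f :: "'a \<Rightarrow> real"
  by (subst \<mu>_density) (simp add: integrable_density borel_\<pi> mult.commute)

lemma integral_\<mu>: "f \<in> borel_measurable borel \<Longrightarrow> (\<integral>x. f x \<partial>\<mu>) = (\<integral>x. f x * \<psi> x \<partial>\<pi>)"
  for f :: "'a \<Rightarrow> real"
  by (subst \<mu>_density) (simp add: integral_density borel_\<pi> mult.commute)

lemma nn_integral_\<psi>: "(\<integral>\<^sup>+x. ennreal (\<psi> x) \<partial>\<pi>) = 1"
  using nn_integral_\<mu>[of "\<lambda>_. 1"] emeasure_space_1 by simp

lemma integrable_\<psi>: "integrable \<pi> \<psi>" and integral_\<psi>: "(\<integral>x. \<psi> x \<partial>\<pi>) = 1"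
  using integrable_\<mu>[of "\<lambda>_. 1"] integral_\<mu>[of "\<lambda>_. 1"] by (simp_all add: prob_space)

text \<open>
  The positive part of \<open>ln \<psi>\<close> is bounded by testing the entropy inequality with truncations of \<open>\<psi>\<close>
  itself.  The negative part is integrable because \<open>- a * ln a \<le> 1\<close> for \<open>a \<ge> 0\<close> and
  \<open>d\<mu> = \<psi> d\<pi>\<close>.
\<close>

theorem integrable_ln_\<psi>: "integrable \<mu> (\<lambda>x. ln (\<psi> x))"
proof -
  define u where "u n x = ln (min (real (Suc n)) (max 1 (\<psi> x)))" for n x
  have um: "u n \<in> borel_measurable borel" for n unfolding u_def by measurable
  have ub: "0 \<le> u n x" "u n x \<le> ln (real (Suc n))" for n x
    unfolding u_def by (auto simp del: of_nat_Suc)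
  have ule: "(\<integral>\<^sup>+x. ennreal (u n x) \<partial>\<mu>) \<le> ennreal (c + ln 2)" for n
  proof -
    have "integrable \<mu> (u n)"
      by (rule integrable_bounded[OF um, of _ "ln (real (Suc n))"]) (use ub in auto)
    then have "(\<integral>\<^sup>+x. ennreal (u n x) \<partial>\<mu>) = ennreal (\<integral>x. u n x \<partial>\<mu>)"
      using ub by (intro nn_integral_eq_integral) auto
    also have "(\<integral>x. u n x \<partial>\<mu>) \<le> c + ln (\<integral>x. min (real (Suc n)) (max 1 (\<psi> x)) \<partial>\<pi>)"
      unfolding u_def by (rule entropy_borel[of _ 1 "real (Suc n)"]) auto
    also have "ln (\<integral>x. min (real (Suc n)) (max 1 (\<psi> x)) \<partial>\<pi>) \<le> ln 2"
    proof -
      have i: "integrable \<pi> (\<lambda>x. min (real (Suc n)) (max 1 (\<psi> x)))"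
        by (rule integrable_bounded_\<pi>[of _ "real (Suc n)"]) auto
      have "(\<integral>x. min (real (Suc n)) (max 1 (\<psi> x)) \<partial>\<pi>) \<le> (\<integral>x. 1 + \<psi> x \<partial>\<pi>)"
        using i integrable_\<psi> by (intro integral_mono) (auto simp: min_def max_def add_increasing)
      also have "\<dots> = 2" using integrable_\<psi> by (simp add: integral_\<psi> \<pi>.prob_space)
      finally have "(\<integral>x. min (real (Suc n)) (max 1 (\<psi> x)) \<partial>\<pi>) \<le> 2" .
      moreover have "1 \<le> (\<integral>x. min (real (Suc n)) (max 1 (\<psi> x)) \<partial>\<pi>)"
        using i by (intro \<pi>.integral_ge_const) auto
      ultimately show ?thesis by simp
    qed
    finally show ?thesis by (simp add: ennreal_leI)
  qed
  have ulim: "(\<lambda>n. u n x) \<longlonglongrightarrow> ln (max 1 (\<psi> x))" for x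
  proof -
    obtain N :: nat where N: "max 1 (\<psi> x) < real N" using reals_Archimedean2 by blast
    then have "\<forall>\<^sub>F n in sequentially. u n x = ln (max 1 (\<psi> x))"
      unfolding eventually_sequentially u_def by (intro exI[of _ N]) (auto simp: min_def)
    then show ?thesis by (rule tendsto_eventually)
  qed
  have plus: "(\<integral>\<^sup>+x. ennreal (ln (max 1 (\<psi> x))) \<partial>\<mu>) \<le> ennreal (c + ln 2)"
  proof (rule nn_integral_fatou_le)
    show "u n \<in> borel_measurable \<mu>" for n using um by (simp add: borel_\<mu>)
    show "AE x in \<mu>. (\<lambda>n. u n x) \<longlonglongrightarrow> ln (max 1 (\<psi> x))" using ulim by simp
    show "(\<lambda>_ :: nat. c + ln 2) \<longlonglongrightarrow> c + ln 2" by (rule tendsto_const)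
  qed (rule ule)
  have minus: "(\<integral>\<^sup>+x. ennreal (- ln (\<psi> x)) \<partial>\<mu>) \<le> 1"
  proof -
    have "(\<integral>\<^sup>+x. ennreal (- ln (\<psi> x)) \<partial>\<mu>) = (\<integral>\<^sup>+x. ennreal (\<psi> x) * ennreal (- ln (\<psi> x)) \<partial>\<pi>)"
      by (rule nn_integral_\<mu>) measurable
    also have "\<dots> \<le> (\<integral>\<^sup>+x. 1 \<partial>\<pi>)"
    proof (rule nn_integral_mono)
      fix x
      have "\<psi> x * (- ln (\<psi> x)) \<le> 1"
      proof (cases "\<psi> x = 0")
        case False
        then have p: "0 < \<psi> x" by (simp add: less_le)
        have "- ln (\<psi> x) = ln (1 / \<psi> x)" using p by (simp add: ln_div)
        also have "\<dots> \<le> 1 / \<psi> x" using ln_le_minus_one[of "1 / \<psi> x"] p by simp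
        finally have "\<psi> x * (- ln (\<psi> x)) \<le> \<psi> x * (1 / \<psi> x)" using p by (intro mult_left_mono) auto
        then show ?thesis using p by simp
      qed simp
      then show "ennreal (\<psi> x) * ennreal (- ln (\<psi> x)) \<le> 1"
        by (simp add: ennreal_mult'[symmetric])
    qed
    finally show ?thesis by (simp add: \<pi>.emeasure_space_1)
  qed
  have "(\<integral>\<^sup>+x. ennreal \<bar>ln (\<psi> x)\<bar> \<partial>\<mu>)
      \<le> (\<integral>\<^sup>+x. ennreal (ln (max 1 (\<psi> x))) + ennreal (- ln (\<psi> x)) \<partial>\<mu>)"
  proof (rule nn_integral_mono_AE)
    show "AE x in \<mu>. ennreal \<bar>ln (\<psi> x)\<bar> \<le> ennreal (ln (max 1 (\<psi> x))) + ennreal (- ln (\<psi> x))"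
      using AE_\<psi>_pos
    proof eventually_elim
      case (elim x)
      show ?case
      proof (cases "1 \<le> \<psi> x")
        case True
        then show ?thesis by (simp add: max_absorb2 add_increasing2)
      next
        case False
        then show ?thesis using elim by (simp add: max_absorb1 abs_of_neg)
      qed
    qed
  qed
  also have "\<dots> = (\<integral>\<^sup>+x. ennreal (ln (max 1 (\<psi> x))) \<partial>\<mu>) + (\<integral>\<^sup>+x. ennreal (- ln (\<psi> x)) \<partial>\<mu>)"
    by (rule nn_integral_add) (auto simp: borel_\<mu>)
  also have "\<dots> \<le> ennreal (c + ln 2) + 1" by (intro add_mono plus minus)
  also have "\<dots> < \<infinity>" by simp
  finally show ?thesis by (simp add: integrable_iff_bounded borel_\<mu>)
qed

subsection \<open>The density is a ground state\<close>

lemma sets_k: "0 \<le> t \<Longrightarrow> sets (k t x) = sets borel"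
  by (rule kernel.sets_k[OF kernel_k])

lemma finite_k: "0 \<le> t \<Longrightarrow> finite_measure (k t x)"
  by (rule kernel.finite_k[OF kernel_k])

lemma Q_eq: "0 \<le> t \<Longrightarrow> Q t f x = (\<integral>y. f y \<partial>k t x)"
  by (rule kernel.T[OF kernel_k])

lemma borel_k: "0 \<le> t \<Longrightarrow> f \<in> borel_measurable (k t x) \<longleftrightarrow> f \<in> borel_measurable borel"
  by (rule arg_cong[of _ _ "\<lambda>S. f \<in> S", OF measurable_cong_sets[OF sets_k refl]])

lemma space_k: "0 \<le> t \<Longrightarrow> space (k t x) = UNIV"
  using sets_eq_imp_space_eq[OF sets_k] by simp

text \<open>
  \<open>Qnn\<close> makes sense for every nonnegative function but may be infinite; \<open>Qint\<close> is \<open>0\<close> by convention where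
  the integral diverges, which happens at most on a \<open>\<pi>\<close>-null set for \<open>u \<in> L\<^sup>1(\<pi>)\<close>.
\<close>

definition Qnn :: "real \<Rightarrow> ('a \<Rightarrow> real) \<Rightarrow> 'a \<Rightarrow> ennreal" where
  "Qnn t u x = (\<integral>\<^sup>+y. ennreal (u y) \<partial>k t x)"

definition Qint :: "real \<Rightarrow> ('a \<Rightarrow> real) \<Rightarrow> 'a \<Rightarrow> real" where
  "Qint t u x = (\<integral>y. u y \<partial>k t x)"

lemma Qnn_measurable: "0 \<le> t \<Longrightarrow> u \<in> borel_measurable borel \<Longrightarrow> Qnn t u \<in> borel_measurable borel"
  unfolding Qnn_def[abs_def]
  by (intro kernel.borel_measurable_kernel_nn_integral[OF kernel_k] measurable_compose[OF _ measurable_ennreal])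

lemma Qint_measurable: "0 \<le> t \<Longrightarrow> u \<in> borel_measurable borel \<Longrightarrow> Qint t u \<in> borel_measurable borel"
  unfolding Qint_def[abs_def] by (rule kernel.borel_measurable_kernel_integral[OF kernel_k])

lemma Qnn_invariant:
  assumes "0 \<le> t" "u \<in> borel_measurable borel"
  shows "(\<integral>\<^sup>+x. Qnn t u x \<partial>\<pi>) = (\<integral>\<^sup>+x. ennreal (u x) \<partial>\<pi>)"
  unfolding Qnn_def
  by (rule kernel.kernel_nn_integral[OF kernel_k[OF assms(1)] \<pi>.finite_measure_axioms sets_\<pi>
      \<pi>.finite_measure_axioms sets_\<pi> invariant[OF assms(1)] measurable_compose[OF assms(2) measurable_ennreal]])

lemma Qint_bounds:
  assumes t: "0 \<le> t" and w: "w \<in> borel_measurable borel" "\<And>x. m \<le> w x" "\<And>x. w x \<le> B"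
  shows "integrable (k t x) w" "m * Q t (const_bcontfun 1) x \<le> Qint t w x" "Qint t w x \<le> B * Q t (const_bcontfun 1) x"
proof -
  interpret kx: finite_measure "k t x" by (rule finite_k[OF t])
  have "\<bar>w x\<bar> \<le> max \<bar>m\<bar> \<bar>B\<bar>" for x using w(2,3)[of x] by linarith
  then show int: "integrable (k t x) w"
    using w(1) by (intro kx.integrable_const_bound[of _ "max \<bar>m\<bar> \<bar>B\<bar>"]) (auto simp: borel_k[OF t])
  have one: "Q t (const_bcontfun 1) x = measure (k t x) UNIV" by (simp add: Q_eq[OF t] space_k[OF t])
  have "(\<integral>y. m \<partial>k t x) \<le> Qint t w x" unfolding Qint_def using int w(2) by (intro integral_mono) auto
  then show "m * Q t (const_bcontfun 1) x \<le> Qint t w x"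
    by (simp add: one space_k[OF t] mult.commute)
  have "Qint t w x \<le> (\<integral>y. B \<partial>k t x)" unfolding Qint_def using int w(3) by (intro integral_mono) auto
  then show "Qint t w x \<le> B * Q t (const_bcontfun 1) x"
    by (simp add: one space_k[OF t] mult.commute)
qed

lemma Q_one_le: "0 \<le> t \<Longrightarrow> Q t (const_bcontfun 1) x \<le> C"
proof -
  assume t: "0 \<le> t"
  have "norm (const_bcontfun 1 :: 'a \<Rightarrow>\<^sub>C real) \<le> 1" by (rule norm_bound) simp
  then have "C * norm (const_bcontfun 1 :: 'a \<Rightarrow>\<^sub>C real) \<le> C" using C_nonneg by (simp add: mult_left_le)
  then show ?thesis
    using norm_bounded[of "Q t (const_bcontfun 1)" x] norm_apply_le[OF t, of "const_bcontfun 1"] by simp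
qed

text \<open>
  The logarithmic inequality extends to Borel functions because \<open>w\<close> can be approximated by
  continuous functions in the \<open>L\<^sup>1\<close> norms of \<open>\<mu>\<close> and of the measure \<open>f \<mapsto> \<mu> (Q t f)\<close> at the same time.
\<close>

lemma log_inequality_borel:
  assumes t: "0 \<le> t" and w: "w \<in> borel_measurable borel" "0 < m" "\<And>x. m \<le> w x" "\<And>x. w x \<le> B"
  shows "(\<integral>x. ln (w x) \<partial>\<mu>) \<le> (\<integral>x. ln (Qint t w x) \<partial>\<mu>)"
proof (rule field_le_epsilon)
  fix e :: real assume e: "0 < e"
  interpret \<nu>: positive_functional "\<lambda>f. mean (Q t f)"
  proof
    show "mean (Q t (f + g)) = mean (Q t f) + mean (Q t g)" for f g
      by (simp add: blinfun.add_right linear_add[OF bounded_linear.linear[OF bounded_linear_mean]])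
    show "mean (Q t (r *\<^sub>R f)) = r *\<^sub>R mean (Q t f)" for r f
      by (simp add: blinfun.scaleR_right linear_cmul[OF bounded_linear.linear[OF bounded_linear_mean]])
    show "0 \<le> mean (Q t f)" if "\<And>x. 0 \<le> apply_bcontfun f x" for f
      unfolding mean_def using that by (intro Bochner_Integration.integral_nonneg pos t)
  qed (rule cpt)
  obtain \<nu> where \<nu>: "sets \<nu> = sets borel" "finite_measure \<nu>" "\<And>f. mean (Q t f) = (\<integral>x. apply_bcontfun f x \<partial>\<nu>)"
    using \<nu>.riesz_representation by metis
  have \<mu>\<nu>: "(\<integral>x. Q t f x \<partial>\<mu>) = (\<integral>x. f x \<partial>\<nu>)" for f using \<nu>(3)[of f] by (simp add: mean_def)
  (* a uniform lower bound for Q t w in terms of one for w *)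
  obtain r where r: "0 < r" "\<And>x. r \<le> Q t (const_bcontfun 1) x"
    using positive_lower_bound[of "Q t (const_bcontfun 1)"] strictly_positive[OF t, of "const_bcontfun 1"] by auto
  (* w and g are bounded below by m, and their images under Q t by m * r; ln is Lipschitz there *)
  define d where "d = min (e * m / 2) (e * (m * r) / 2)"
  have d: "0 < d" "d / m \<le> e / 2" "d / (m * r) \<le> e / 2"
    using e w(2) r(1) by (auto simp: d_def field_simps min_def)
  have "\<exists>g :: 'a \<Rightarrow>\<^sub>C real. (\<forall>x. m \<le> g x \<and> g x \<le> B) \<and>
    (\<integral>x. \<bar>w x - g x\<bar> \<partial>\<mu>) < d \<and> (\<integral>x. \<bar>w x - g x\<bar> \<partial>\<nu>) < d"
    by (rule clamped_continuous_approximation[OF finite_measure_axioms sets_\<mu> \<nu>(2,1) w(1,3,4) d(1)])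
  then obtain g :: "'a \<Rightarrow>\<^sub>C real" where g: "\<And>x. m \<le> g x" "\<And>x. g x \<le> B"
    "(\<integral>x. \<bar>w x - g x\<bar> \<partial>\<mu>) < d" "(\<integral>x. \<bar>w x - g x\<bar> \<partial>\<nu>) < d" by blast
  have gb: "apply_bcontfun g \<in> borel_measurable borel" by (rule borel_bcontfun)
  have Qg: "Qint t g x = Q t g x" for x by (simp add: Qint_def Q_eq[OF t])
  have 1: "\<bar>(\<integral>x. ln (w x) \<partial>\<mu>) - (\<integral>x. ln (g x) \<partial>\<mu>)\<bar> \<le> (\<integral>x. \<bar>w x - g x\<bar> \<partial>\<mu>) / m"
    by (rule ln_integral_lipschitz[OF w(1) gb w(2-4) g(1,2)])
  have 2: "(\<integral>x. ln (g x) \<partial>\<mu>) \<le> (\<integral>x. ln (Qint t g x) \<partial>\<mu>)"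
    unfolding Qg by (rule log_inequality[OF less_le_trans[OF w(2) g(1)] t])
  have mr: "0 < m * r" using w(2) r(1) by simp
  have B0: "0 \<le> B" using w(2) order_trans[OF w(3,4)] by linarith
  have lower: "m * r \<le> Qint t v x" if "v \<in> borel_measurable borel" "\<And>x. m \<le> v x" "\<And>x. v x \<le> B" for v x
    using Qint_bounds(2)[OF t that, of x] mult_left_mono[OF r(2)[of x], of m] w(2) by linarith
  have upper: "Qint t v x \<le> B * C" if "v \<in> borel_measurable borel" "\<And>x. m \<le> v x" "\<And>x. v x \<le> B" for v x
    using Qint_bounds(3)[OF t that, of x] mult_left_mono[OF Q_one_le[OF t, of x] B0] by linarith
  have 3: "\<bar>(\<integral>x. ln (Qint t w x) \<partial>\<mu>) - (\<integral>x. ln (Qint t g x) \<partial>\<mu>)\<bar>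
      \<le> (\<integral>x. \<bar>Qint t w x - Qint t g x\<bar> \<partial>\<mu>) / (m * r)"
    by (rule ln_integral_lipschitz[OF Qint_measurable[OF t w(1)] Qint_measurable[OF t gb] mr
        lower[OF w(1,3,4)] upper[OF w(1,3,4)] lower[OF gb g(1,2)] upper[OF gb g(1,2)]])
  have wg: "(\<lambda>x. w x - g x) \<in> borel_measurable borel" using w(1) gb by measurable
  have int_wg: "integrable \<nu> (\<lambda>x. w x - g x)"
  proof (rule finite_measure.integrable_const_bound[OF \<nu>(2), of _ "B"])
    show "AE x in \<nu>. norm (w x - g x) \<le> B"
    proof (rule AE_I2)
      fix x show "norm (w x - g x) \<le> B"
        using w(2) w(3,4)[of x] g(1,2)[of x] unfolding real_norm_def by linarith
    qed
    show "(\<lambda>x. w x - g x) \<in> borel_measurable \<nu>" using wg by (simp add: measurable_cong_sets[OF \<nu>(1) refl])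
  qed
  have "(\<integral>x. \<bar>Qint t w x - Qint t g x\<bar> \<partial>\<mu>) = (\<integral>x. \<bar>\<integral>y. w y - g y \<partial>k t x\<bar> \<partial>\<mu>)"
    using Qint_bounds(1)[OF t w(1,3,4)] Qint_bounds(1)[OF t gb g(1,2)] by (simp add: Qint_def)
  also have "\<dots> \<le> (\<integral>x. \<bar>w x - g x\<bar> \<partial>\<nu>)"
    by (rule kernel.kernel_integral_L1(2)[OF kernel_k[OF t] finite_measure_axioms sets_\<mu> \<nu>(2,1) \<mu>\<nu> wg int_wg])
  finally have 4: "(\<integral>x. \<bar>Qint t w x - Qint t g x\<bar> \<partial>\<mu>) / (m * r) \<le> d / (m * r)"
    using g(4) mr by (intro divide_right_mono) auto
  have 5: "(\<integral>x. \<bar>w x - g x\<bar> \<partial>\<mu>) / m \<le> d / m" using g(3) w(2) by (intro divide_right_mono) auto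
  show "(\<integral>x. ln (w x) \<partial>\<mu>) \<le> (\<integral>x. ln (Qint t w x) \<partial>\<mu>) + e"
    using 1 2 3 4 5 d by linarith
qed

text \<open>
  The truncations of \<open>\<psi>\<close> to \<open>[1/(n+1), n+1]\<close>, to which the logarithmic inequality for bounded
  functions with a positive lower bound applies.
\<close>

definition trunc :: "nat \<Rightarrow> 'a \<Rightarrow> real" where
  "trunc n x = min (real (Suc n)) (max (1 / real (Suc n)) (\<psi> x))"

lemma trunc_measurable [measurable]: "trunc n \<in> borel_measurable borel"
  unfolding trunc_def[abs_def] by measurable

lemma trunc_bounds: "1 / real (Suc n) \<le> trunc n x" "trunc n x \<le> real (Suc n)" "trunc n x \<le> \<psi> x + 1 / real (Suc n)"
proof -
  have "1 / real (Suc n) \<le> 1" "1 \<le> real (Suc n)" by auto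
  then have "1 / real (Suc n) \<le> real (Suc n)" by (rule order_trans)
  then show "1 / real (Suc n) \<le> trunc n x" by (simp add: trunc_def del: of_nat_Suc)
  show "trunc n x \<le> real (Suc n)" by (simp add: trunc_def del: of_nat_Suc)
  have "0 \<le> 1 / real (Suc n)" by simp
  then show "trunc n x \<le> \<psi> x + 1 / real (Suc n)"
    using \<psi>_nonneg[of x] unfolding trunc_def by linarith
qed

lemma trunc_pos: "0 < trunc n x"
  by (rule less_le_trans[OF _ trunc_bounds(1)]) simp

lemma Qint_trunc_bounds:
  assumes "0 \<le> t"
  shows "integrable (k t x) (trunc n)"
    "1 / real (Suc n) * Q t (const_bcontfun 1) x \<le> Qint t (trunc n) x"
    "Qint t (trunc n) x \<le> real (Suc n) * Q t (const_bcontfun 1) x"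
  by (rule Qint_bounds[OF assms trunc_measurable trunc_bounds(1,2)])+

lemma trunc_tendsto: "(\<lambda>n. trunc n x) \<longlonglongrightarrow> \<psi> x"
proof -
  have "(\<lambda>n. max (1 / real (Suc n)) (\<psi> x)) \<longlonglongrightarrow> max 0 (\<psi> x)"
    by (intro tendsto_max tendsto_const LIMSEQ_Suc[OF lim_const_over_n])
  then have "(\<lambda>n. max (1 / real (Suc n)) (\<psi> x)) \<longlonglongrightarrow> \<psi> x" by simp
  moreover have "\<forall>\<^sub>F n in sequentially. max (1 / real (Suc n)) (\<psi> x) = trunc n x"
  proof -
    obtain N :: nat where N: "max 1 (\<psi> x) < real N" using reals_Archimedean2 by blast
    have "max (1 / real (Suc n)) (\<psi> x) = trunc n x" if "N \<le> n" for n
    proof -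
      have "1 / real (Suc n) \<le> 1" "real N \<le> real (Suc n)" "1 \<le> real (Suc n)" using that by auto
      then show ?thesis using N unfolding trunc_def by linarith
    qed
    then show ?thesis unfolding eventually_sequentially by blast
  qed
  ultimately show ?thesis by (rule Lim_transform_eventually)
qed

text \<open>
  A bound for the amount by which \<open>\<integral> Q t (trunc n) / trunc n d\<mu>\<close> can exceed \<open>1\<close>.
\<close>

definition tail :: "nat \<Rightarrow> real" where
  "tail n = 1 / real (Suc n) + C * measure \<mu> {x. real (Suc n) < \<psi> x}"

lemma tail_tendsto: "tail \<longlonglongrightarrow> 0"
proof -
  have "(\<lambda>n. measure \<mu> {x. real (Suc n) < \<psi> x}) \<longlonglongrightarrow> measure \<mu> (\<Inter>n. {x. real (Suc n) < \<psi> x})"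
    by (rule finite_Lim_measure_decseq) (auto simp: sets_\<mu> decseq_def)
  moreover have "(\<Inter>n. {x. real (Suc n) < \<psi> x}) = {}"
  proof -
    have "\<exists>n. \<not> real (Suc n) < \<psi> x" for x
    proof -
      obtain N :: nat where "\<psi> x < real N" using reals_Archimedean2 by blast
      then show ?thesis by (intro exI[of _ N]) simp
    qed
    then show ?thesis by auto
  qed
  ultimately have 1: "(\<lambda>n. measure \<mu> {x. real (Suc n) < \<psi> x}) \<longlonglongrightarrow> 0" by simp
  have "(\<lambda>n. 1 / real (Suc n) + C * measure \<mu> {x. real (Suc n) < \<psi> x}) \<longlonglongrightarrow> 0 + C * 0"
    by (intro tendsto_add tendsto_mult tendsto_const 1 LIMSEQ_Suc[OF lim_const_over_n])
  then show ?thesis by (simp add: tail_def[abs_def])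
qed

lemma trunc_ratio_bounds:
  assumes t: "0 \<le> t"
  shows "0 < Qint t (trunc n) x" "Qint t (trunc n) x \<le> real (Suc n) * C"
proof -
  have "0 < 1 / real (Suc n) * Q t (const_bcontfun 1) x"
    using strictly_positive[OF t, of "const_bcontfun 1" x] by simp
  then show "0 < Qint t (trunc n) x"
    using Qint_trunc_bounds(2)[OF t, of n x] by linarith
  show "Qint t (trunc n) x \<le> real (Suc n) * C"
    using Qint_trunc_bounds(3)[OF t, of n x]
      mult_left_mono[OF Q_one_le[OF t, of x] of_nat_0_le_iff[of "Suc n"]] by linarith
qed

text \<open>
  With \<open>d\<mu> = \<psi> d\<pi>\<close>, the factor \<open>\<psi>\<close> cancels the denominator up to \<open>\<le>\<close> where \<open>\<psi> \<le> n + 1\<close>, and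
  invariance of \<open>\<pi>\<close> bounds the rest by \<open>\<integral> trunc n d\<pi>\<close>.  Where \<open>\<psi> > n + 1\<close> the ratio is at most \<open>C\<close>.
\<close>

lemma nn_integral_trunc_ratio:
  assumes t: "0 \<le> t"
  shows "(\<integral>\<^sup>+x. ennreal (Qint t (trunc n) x / trunc n x) \<partial>\<mu>) \<le> ennreal (1 + tail n)"
proof -
  let ?q = "Qint t (trunc n)" and ?N = "real (Suc n)"
  have qm [measurable]: "?q \<in> borel_measurable borel" by (rule Qint_measurable[OF t trunc_measurable])
  have q0: "0 \<le> ?q x" for x using trunc_ratio_bounds(1)[OF t] by (rule less_imp_le)
  have "(\<integral>\<^sup>+x. ennreal (?q x / trunc n x) \<partial>\<mu>) = (\<integral>\<^sup>+x. ennreal (\<psi> x) * ennreal (?q x / trunc n x) \<partial>\<pi>)"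
    by (rule nn_integral_\<mu>) measurable
  also have "\<dots> \<le> (\<integral>\<^sup>+x. ennreal (?q x) + ennreal (C * (\<psi> x * indicator {x. ?N < \<psi> x} x)) \<partial>\<pi>)"
  proof (rule nn_integral_mono)
    fix x
    have "\<psi> x * (?q x / trunc n x) \<le> ?q x + C * (\<psi> x * indicator {x. ?N < \<psi> x} x)"
    proof (cases "?N < \<psi> x")
      case True
      have "1 / ?N \<le> 1" "1 \<le> ?N" by auto
      then have "trunc n x = ?N" using True unfolding trunc_def by linarith
      then have "?q x / trunc n x \<le> C"
        using trunc_ratio_bounds(2)[OF t, of n x] by (simp add: divide_le_eq mult.commute del: of_nat_Suc)
      then have "\<psi> x * (?q x / trunc n x) \<le> \<psi> x * C" by (intro mult_left_mono) auto
      then show ?thesis using True q0[of x] by (simp add: mult.commute del: of_nat_Suc)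
    next
      case False
      then have "\<psi> x \<le> trunc n x" by (simp add: trunc_def del: of_nat_Suc)
      then have "\<psi> x * (?q x / trunc n x) \<le> trunc n x * (?q x / trunc n x)"
        using q0[of x] trunc_pos[of n x] by (intro mult_right_mono) auto
      then show ?thesis using False trunc_pos[of n x] by (simp del: of_nat_Suc)
    qed
    then show "ennreal (\<psi> x) * ennreal (?q x / trunc n x)
        \<le> ennreal (?q x) + ennreal (C * (\<psi> x * indicator {x. ?N < \<psi> x} x))"
      using q0[of x] C_nonneg
      by (subst ennreal_mult'[symmetric], simp, subst ennreal_plus[symmetric]) (auto intro!: ennreal_leI simp del: ennreal_plus)
  qed
  also have "\<dots> = (\<integral>\<^sup>+x. ennreal (?q x) \<partial>\<pi>) + (\<integral>\<^sup>+x. ennreal (C * (\<psi> x * indicator {x. ?N < \<psi> x} x)) \<partial>\<pi>)"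
    by (rule nn_integral_add) (auto simp: borel_\<pi>)
  also have "(\<integral>\<^sup>+x. ennreal (?q x) \<partial>\<pi>) = (\<integral>\<^sup>+x. Qnn t (trunc n) x \<partial>\<pi>)"
  proof (rule nn_integral_cong)
    fix x
    show "ennreal (?q x) = Qnn t (trunc n) x"
      unfolding Qint_def Qnn_def
      using Qint_trunc_bounds(1)[OF t, of x n] less_imp_le[OF trunc_pos]
      by (intro nn_integral_eq_integral[symmetric]) auto
  qed
  also have "\<dots> = (\<integral>\<^sup>+x. ennreal (trunc n x) \<partial>\<pi>)" by (rule Qnn_invariant[OF t trunc_measurable])
  also have "\<dots> \<le> (\<integral>\<^sup>+x. ennreal (\<psi> x) + ennreal (1 / ?N) \<partial>\<pi>)"
    using trunc_bounds(3)[of n]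
    by (intro nn_integral_mono) (simp add: ennreal_leI flip: ennreal_plus del: of_nat_Suc)
  also have "\<dots> = ennreal (1 + 1 / ?N)"
    by (subst nn_integral_add) (auto simp: borel_\<pi> nn_integral_\<psi> \<pi>.emeasure_space_1 simp del: of_nat_Suc)
  also have "(\<integral>\<^sup>+x. ennreal (C * (\<psi> x * indicator {x. ?N < \<psi> x} x)) \<partial>\<pi>)
      = (\<integral>\<^sup>+x. ennreal (\<psi> x) * (ennreal C * indicator {x. ?N < \<psi> x} x) \<partial>\<pi>)"
    using C_nonneg by (intro nn_integral_cong) (auto simp: indicator_def ennreal_mult mult.commute)
  also have "\<dots> = (\<integral>\<^sup>+x. ennreal C * indicator {x. ?N < \<psi> x} x \<partial>\<mu>)"
    by (rule nn_integral_\<mu>[symmetric]) measurable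
  also have "\<dots> = ennreal (C * measure \<mu> {x. ?N < \<psi> x})"
    using C_nonneg by (subst nn_integral_cmult_indicator) (auto simp: sets_\<mu> emeasure_eq_measure ennreal_mult)
  finally show ?thesis
    using C_nonneg by (simp add: tail_def add.assoc flip: ennreal_plus del: of_nat_Suc)
qed

text \<open>
  The logarithmic inequality says \<open>0 \<le> \<integral> ln r\<^sup>2 d\<mu>\<close> for the square root \<open>r\<close> of the ratio, and
  \<open>ln r\<^sup>2 \<le> 2 * (r - 1)\<close>.
\<close>

lemma sqrt_ratio_integral_ge_1:
  assumes t: "0 \<le> t" and int: "integrable \<mu> (\<lambda>x. Qint t (trunc n) x / trunc n x)"
  shows "integrable \<mu> (\<lambda>x. sqrt (Qint t (trunc n) x / trunc n x))"
    and "1 \<le> (\<integral>x. sqrt (Qint t (trunc n) x / trunc n x) \<partial>\<mu>)"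
proof -
  let ?q = "Qint t (trunc n)"
  define r where "r x = sqrt (?q x / trunc n x)" for x
  have qm [measurable]: "?q \<in> borel_measurable borel" by (rule Qint_measurable[OF t trunc_measurable])
  have rm: "r \<in> borel_measurable borel" unfolding r_def[abs_def] by measurable
  have ratio: "0 < ?q x / trunc n x" for x
    using trunc_ratio_bounds(1)[OF t, of n x] trunc_pos[of n x] by simp
  have r_le: "r x \<le> ?q x / trunc n x + 1" for x
  proof -
    have "0 \<le> (r x - 1)^2" by simp
    then have "2 * r x \<le> (r x)^2 + 1" by (simp add: power2_eq_square algebra_simps)
    moreover have "(r x)^2 = ?q x / trunc n x" using ratio[of x] by (simp add: r_def)
    moreover have "0 \<le> r x" using ratio[of x] by (simp add: r_def)
    ultimately show ?thesis by linarith
  qed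
  have r0: "0 < r x" for x using ratio[of x] by (simp add: r_def)
  show ri: "integrable \<mu> (\<lambda>x. sqrt (Qint t (trunc n) x / trunc n x))"
  proof (rule Bochner_Integration.integrable_bound)
    show "integrable \<mu> (\<lambda>x. ?q x / trunc n x + 1)" using int by simp
    show "(\<lambda>x. sqrt (?q x / trunc n x)) \<in> borel_measurable \<mu>" using rm by (simp add: borel_\<mu> r_def[abs_def])
    show "AE x in \<mu>. norm (sqrt (?q x / trunc n x)) \<le> norm (?q x / trunc n x + 1)"
    proof (rule AE_I2)
      fix x show "norm (sqrt (?q x / trunc n x)) \<le> norm (?q x / trunc n x + 1)"
        using r_le[of x] r0[of x] ratio[of x] by (simp add: r_def)
    qed
  qed
  have i1: "integrable \<mu> (\<lambda>x. ln (trunc n x))"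
    by (rule integrable_ln[OF trunc_measurable _ trunc_bounds(1,2)]) simp
  obtain s where s: "0 < s" "\<And>x. s \<le> Q t (const_bcontfun 1) x"
    using positive_lower_bound[of "Q t (const_bcontfun 1)"] strictly_positive[OF t, of "const_bcontfun 1"] by auto
  have qlow: "1 / real (Suc n) * s \<le> ?q x" for x
    using Qint_trunc_bounds(2)[OF t, of n x]
      mult_left_mono[OF s(2)[of x], of "1 / real (Suc n)"] by simp
  have i2: "integrable \<mu> (\<lambda>x. ln (?q x))"
    by (rule integrable_ln[OF qm _ qlow trunc_ratio_bounds(2)[OF t]]) (use s in simp)
  have "0 \<le> (\<integral>x. ln (?q x) \<partial>\<mu>) - (\<integral>x. ln (trunc n x) \<partial>\<mu>)"
    using log_inequality_borel[OF t trunc_measurable _ trunc_bounds(1,2), of n] by simp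
  also have "\<dots> = (\<integral>x. ln (?q x) - ln (trunc n x) \<partial>\<mu>)" using i1 i2 by simp
  also have "\<dots> \<le> (\<integral>x. 2 * (r x - 1) \<partial>\<mu>)"
  proof (rule integral_mono)
    show "integrable \<mu> (\<lambda>x. ln (?q x) - ln (trunc n x))" using i1 i2 by simp
    show "integrable \<mu> (\<lambda>x. 2 * (r x - 1))" using ri by (simp add: r_def)
    fix x
    have "ln (?q x) - ln (trunc n x) = ln (?q x / trunc n x)"
      using trunc_ratio_bounds(1)[OF t, of n x] trunc_pos[of n x] by (simp add: ln_div)
    also have "\<dots> = 2 * ln (r x)" using ratio[of x] by (simp add: r_def ln_sqrt)
    also have "\<dots> \<le> 2 * (r x - 1)" using ln_le_minus_one[OF r0[of x]] by simp
    finally show "ln (?q x) - ln (trunc n x) \<le> 2 * (r x - 1)" .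
  qed
  also have "\<dots> = 2 * ((\<integral>x. r x \<partial>\<mu>) - 1)" using ri by (simp add: r_def prob_space)
  finally show "1 \<le> (\<integral>x. sqrt (?q x / trunc n x) \<partial>\<mu>)" by (simp add: r_def)
qed

text \<open>
  A quantitative equality case of Jensen's inequality: the ratio has integral at most \<open>1 + tail n\<close> and
  its square root has integral at least \<open>1\<close>, so the square root is close to \<open>1\<close> in \<open>L\<^sup>2(\<mu>)\<close>.
\<close>

lemma nn_integral_sqrt_ratio_deviation:
  assumes t: "0 \<le> t"
  shows "(\<integral>\<^sup>+x. ennreal ((sqrt (Qint t (trunc n) x / trunc n x) - 1)^2) \<partial>\<mu>) \<le> ennreal (tail n)"
proof -
  let ?w = "\<lambda>x. Qint t (trunc n) x / trunc n x"
  have wm: "?w \<in> borel_measurable borel"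
    using Qint_measurable[OF t trunc_measurable, of n] by measurable
  have w0: "0 \<le> ?w x" for x
    using trunc_ratio_bounds(1)[OF t, of n x] trunc_pos[of n x] by simp
  have tail0: "0 \<le> tail n" using C_nonneg by (simp add: tail_def)
  have int: "integrable \<mu> ?w"
    using le_less_trans[OF nn_integral_trunc_ratio[OF t, of n] ennreal_less_top] wm w0
    by (intro integrableI_nonneg) (simp_all add: borel_\<mu>)
  have "ennreal (\<integral>x. ?w x \<partial>\<mu>) \<le> ennreal (1 + tail n)"
    using nn_integral_trunc_ratio[OF t, of n] w0 int by (subst nn_integral_eq_integral[symmetric]) auto
  then have w_le: "(\<integral>x. ?w x \<partial>\<mu>) \<le> 1 + tail n" using tail0 by (subst (asm) ennreal_le_iff) auto
  note s = sqrt_ratio_integral_ge_1[OF t int]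
  have sq: "(sqrt (?w x) - 1)^2 = ?w x - 2 * sqrt (?w x) + 1" for x
    unfolding power2_diff real_sqrt_pow2[OF w0] by simp
  have "integrable \<mu> (\<lambda>x. (sqrt (?w x) - 1)^2)"
    unfolding sq using int s(1)
    by (intro Bochner_Integration.integrable_add Bochner_Integration.integrable_diff integrable_mult_right) auto
  then have "(\<integral>\<^sup>+x. ennreal ((sqrt (?w x) - 1)^2) \<partial>\<mu>) = ennreal (\<integral>x. (sqrt (?w x) - 1)^2 \<partial>\<mu>)"
    by (rule nn_integral_eq_integral) simp
  also have "(\<integral>x. (sqrt (?w x) - 1)^2 \<partial>\<mu>) = (\<integral>x. ?w x \<partial>\<mu>) - 2 * (\<integral>x. sqrt (?w x) \<partial>\<mu>) + 1"
    unfolding sq using int s(1) by (simp add: prob_space)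
  also have "ennreal \<dots> \<le> ennreal (tail n)" using w_le s(2) by (intro ennreal_leI) linarith
  finally show ?thesis .
qed

lemma Qnn_\<psi>_finite: "AE x in \<pi>. Qnn t \<psi> x < \<infinity>" if t: "0 \<le> t"
  using kernel.kernel_integrable_AE[OF kernel_k[OF t] \<pi>.finite_measure_axioms sets_\<pi>
      \<pi>.finite_measure_axioms sets_\<pi> invariant[OF t] \<psi>_measurable integrable_\<psi>]
  by (simp add: Qnn_def)

lemma Qint_trunc_tendsto:
  assumes t: "0 \<le> t" and fin: "Qnn t \<psi> x < \<infinity>"
  shows "(\<lambda>n. Qint t (trunc n) x) \<longlonglongrightarrow> Qint t \<psi> x"
  unfolding Qint_def
proof (rule integral_dominated_convergence[where w = "\<lambda>y. \<psi> y + 1"])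
  interpret kx: finite_measure "k t x" by (rule finite_k[OF t])
  have "integrable (k t x) \<psi>"
    using fin by (intro kernel.integrable_kernel[OF kernel_k[OF t]]) (auto simp: Qnn_def)
  then show "integrable (k t x) (\<lambda>y. \<psi> y + 1)" by simp
  show "\<psi> \<in> borel_measurable (k t x)" "trunc n \<in> borel_measurable (k t x)" for n
    by (simp_all add: borel_k[OF t])
  show "AE y in k t x. (\<lambda>n. trunc n y) \<longlonglongrightarrow> \<psi> y" by (simp add: trunc_tendsto)
  show "AE y in k t x. norm (trunc n y) \<le> \<psi> y + 1" for n
  proof (rule AE_I2)
    fix y
    have "1 / real (Suc n) \<le> 1" by simp
    then show "norm (trunc n y) \<le> \<psi> y + 1"
      using trunc_bounds(3)[of n y] trunc_pos[of n y] unfolding real_norm_def by linarith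
  qed
qed

text \<open>
  Fatou's lemma passes to the limit \<open>n \<rightarrow> \<infinity>\<close> in \<open>nn_integral_sqrt_ratio_deviation\<close>, where the bound tends to \<open>0\<close>.
\<close>

theorem Q_\<psi>: "AE x in \<mu>. Qint t \<psi> x = \<psi> x" if t: "0 \<le> t"
proof -
  let ?v = "\<lambda>x. (sqrt (Qint t \<psi> x / \<psi> x) - 1)^2"
  have vm: "?v \<in> borel_measurable borel"
    using Qint_measurable[OF t \<psi>_measurable] by measurable
  have "(\<integral>\<^sup>+x. ennreal (?v x) \<partial>\<mu>) \<le> ennreal 0"
  proof (rule nn_integral_fatou_le[OF _ _ nn_integral_sqrt_ratio_deviation[OF t] tail_tendsto])
    show "(\<lambda>x. (sqrt (Qint t (trunc n) x / trunc n x) - 1)^2) \<in> borel_measurable \<mu>" for n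
      unfolding borel_\<mu> using Qint_measurable[OF t trunc_measurable, of n] by measurable
    show "AE x in \<mu>. (\<lambda>n. (sqrt (Qint t (trunc n) x / trunc n x) - 1)^2) \<longlonglongrightarrow> ?v x"
      using AE_\<pi>_imp_\<mu>[OF Qnn_\<psi>_finite[OF t]] AE_\<psi>_pos
    proof eventually_elim
      case (elim x)
      then show ?case
        by (intro tendsto_power tendsto_diff tendsto_real_sqrt tendsto_divide tendsto_const
            Qint_trunc_tendsto t trunc_tendsto) auto
    qed
  qed
  then have "(\<integral>\<^sup>+x. ennreal (?v x) \<partial>\<mu>) = 0" by simp
  then have "AE x in \<mu>. ennreal (?v x) = 0"
    using vm by (subst (asm) nn_integral_0_iff_AE) (auto simp: borel_\<mu>)
  then show ?thesis
    using AE_\<psi>_pos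
  proof eventually_elim
    case (elim x)
    then have "(sqrt (Qint t \<psi> x / \<psi> x) - 1)^2 = 0"
      by (metis ennreal_eq_0_iff zero_le_power2 order_antisym)
    then have "sqrt (Qint t \<psi> x / \<psi> x) = 1" by simp
    then have "Qint t \<psi> x / \<psi> x = 1" by simp
    then show ?case using elim by simp
  qed
qed

lemma Qnn_\<psi>: "AE x in \<mu>. Qnn t \<psi> x = ennreal (\<psi> x)" if t: "0 \<le> t"
  using AE_\<pi>_imp_\<mu>[OF Qnn_\<psi>_finite[OF t]] Q_\<psi>[OF t]
proof eventually_elim
  case (elim x)
  have "integrable (k t x) \<psi>"
    using elim by (intro kernel.integrable_kernel[OF kernel_k[OF t]]) (auto simp: Qnn_def)
  then have "Qnn t \<psi> x = ennreal (Qint t \<psi> x)"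
    unfolding Qnn_def Qint_def by (intro nn_integral_eq_integral) auto
  then show ?case using elim by simp
qed

subsection \<open>The extended semigroup on \<open>L\<^sup>1(\<pi>)\<close>\<close>

text \<open>
  Total mass forces \<open>Q t \<psi>\<close> to vanish where \<open>\<psi>\<close> does: both functions have the same \<open>\<pi>\<close>-integral
  and they agree on \<open>{\<psi> > 0}\<close>.
\<close>

lemma Qnn_\<psi>_eq_0: "AE x in \<pi>. \<psi> x = 0 \<longrightarrow> Qnn t \<psi> x = 0" if t: "0 \<le> t"
proof -
  let ?Z = "{x. \<psi> x = 0}"
  have Z [measurable]: "?Z \<in> sets borel" by measurable
  have Qm: "Qnn t \<psi> \<in> borel_measurable borel" by (rule Qnn_measurable[OF t \<psi>_measurable])
  have "AE x in \<pi>. Qnn t \<psi> x = ennreal (\<psi> x) + Qnn t \<psi> x * indicator ?Z x"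
    using Qnn_\<psi>[OF t] unfolding AE_\<mu>_iff
  proof eventually_elim
    case (elim x)
    show ?case
    proof (cases "\<psi> x = 0")
      case False
      then have "0 < \<psi> x" by (simp add: less_le)
      then show ?thesis using elim by simp
    qed simp
  qed
  then have "(\<integral>\<^sup>+x. Qnn t \<psi> x \<partial>\<pi>) = (\<integral>\<^sup>+x. ennreal (\<psi> x) + Qnn t \<psi> x * indicator ?Z x \<partial>\<pi>)"
    by (rule nn_integral_cong_AE)
  also have "\<dots> = (\<integral>\<^sup>+x. ennreal (\<psi> x) \<partial>\<pi>) + (\<integral>\<^sup>+x. Qnn t \<psi> x * indicator ?Z x \<partial>\<pi>)"
    using Qm by (intro nn_integral_add) (auto simp: borel_\<pi>)
  finally have "1 + (\<integral>\<^sup>+x. Qnn t \<psi> x * indicator ?Z x \<partial>\<pi>) = 1 + 0"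
    unfolding Qnn_invariant[OF t \<psi>_measurable] nn_integral_\<psi> by simp
  then have "(\<integral>\<^sup>+x. Qnn t \<psi> x * indicator ?Z x \<partial>\<pi>) = 0"
    unfolding ennreal_add_left_cancel by simp
  then have "AE x in \<pi>. Qnn t \<psi> x * indicator ?Z x = 0"
    using Qm by (subst (asm) nn_integral_0_iff_AE) (auto simp: borel_\<pi>)
  then show ?thesis by eventually_elim (auto simp: indicator_def)
qed

text \<open>
  If \<open>Q t \<psi>\<close> vanishes at \<open>x\<close>, then \<open>k t x\<close> is carried by \<open>{\<psi> = 0}\<close>, where every multiple of \<open>\<psi>\<close> vanishes.
  This lets the transform be multiplied back by \<open>\<psi>\<close> also on \<open>{\<psi> = 0}\<close>.
\<close>

lemma Qint_\<psi>_multiple_eq_0: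
  assumes t: "0 \<le> t" and f: "f \<in> borel_measurable borel"
  shows "AE x in \<pi>. \<psi> x = 0 \<longrightarrow> Qint t (\<lambda>y. f y * \<psi> y) x = 0"
  using Qnn_\<psi>_eq_0[OF t]
proof eventually_elim
  case (elim x)
  show ?case
  proof
    assume "\<psi> x = 0"
    with elim have "(\<integral>\<^sup>+y. ennreal (\<psi> y) \<partial>k t x) = 0" by (simp add: Qnn_def)
    then have "AE y in k t x. ennreal (\<psi> y) = 0"
      by (subst (asm) nn_integral_0_iff_AE) (auto simp: borel_k[OF t])
    then have "AE y in k t x. f y * \<psi> y = 0"
      by eventually_elim (metis ennreal_eq_0_iff \<psi>_nonneg mult_zero_right order_antisym)
    then show "Qint t (\<lambda>y. f y * \<psi> y) x = 0"
      unfolding Qint_def by (rule integral_eq_zero_AE)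
  qed
qed

context
  fixes t :: real
  assumes t: "0 \<le> t"
begin

lemmas Qint_L1 = kernel.kernel_integral_L1[OF kernel_k[OF t] \<pi>.finite_measure_axioms sets_\<pi>
    \<pi>.finite_measure_axioms sets_\<pi> invariant[OF t], folded Qint_def]

lemmas Qint_finite_AE = kernel.kernel_integrable_AE[OF kernel_k[OF t] \<pi>.finite_measure_axioms sets_\<pi>
    \<pi>.finite_measure_axioms sets_\<pi> invariant[OF t]]

lemma Qint_lincomb:
  assumes h: "h \<in> borel_measurable borel" "integrable \<pi> h" and g: "g \<in> borel_measurable borel" "integrable \<pi> g"
  shows "AE x in \<pi>. Qint t (\<lambda>y. a * h y + b * g y) x = a * Qint t h x + b * Qint t g x"
  using Qint_finite_AE[OF h] Qint_finite_AE[OF g]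
proof eventually_elim
  case (elim x)
  have "integrable (k t x) h" "integrable (k t x) g"
    using elim by (auto intro: kernel.integrable_kernel[OF kernel_k[OF t]] h(1) g(1))
  then show ?case by (simp add: Qint_def)
qed

lemma Qint_distance:
  assumes h: "h \<in> borel_measurable borel" "integrable \<pi> h" and g: "g \<in> borel_measurable borel" "integrable \<pi> g"
  shows "(\<integral>x. \<bar>Qint t h x - Qint t g x\<bar> \<partial>\<pi>) \<le> (\<integral>x. \<bar>h x - g x\<bar> \<partial>\<pi>)"
proof -
  have hg: "(\<lambda>y. h y - g y) \<in> borel_measurable borel" "integrable \<pi> (\<lambda>y. h y - g y)" using h g by auto
  have "(\<integral>x. \<bar>Qint t h x - Qint t g x\<bar> \<partial>\<pi>) = (\<integral>x. \<bar>Qint t (\<lambda>y. h y - g y) x\<bar> \<partial>\<pi>)"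
  proof (rule integral_cong_AE)
    show "AE x in \<pi>. \<bar>Qint t h x - Qint t g x\<bar> = \<bar>Qint t (\<lambda>y. h y - g y) x\<bar>"
      using Qint_lincomb[OF h g, of 1 "-1"] by eventually_elim simp
    show "(\<lambda>x. \<bar>Qint t h x - Qint t g x\<bar>) \<in> borel_measurable \<pi>"
      using Qint_measurable[OF t h(1)] Qint_measurable[OF t g(1)] unfolding borel_\<pi> by measurable
    show "(\<lambda>x. \<bar>Qint t (\<lambda>y. h y - g y) x\<bar>) \<in> borel_measurable \<pi>"
      using Qint_measurable[OF t hg(1)] unfolding borel_\<pi> by measurable
  qed
  also have "\<dots> \<le> (\<integral>x. \<bar>h x - g x\<bar> \<partial>\<pi>)" by (rule Qint_L1(2)[OF hg])
  finally show ?thesis .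
qed

lemma Qint_cong_AE:
  assumes h: "h \<in> borel_measurable borel" "integrable \<pi> h" and g: "g \<in> borel_measurable borel" "integrable \<pi> g"
    and eq: "AE x in \<pi>. h x = g x"
  shows "AE x in \<pi>. Qint t h x = Qint t g x"
proof -
  have "(\<integral>x. \<bar>h x - g x\<bar> \<partial>\<pi>) = 0"
    by (rule integral_eq_zero_AE) (use eq in \<open>eventually_elim, simp\<close>)
  then have "(\<integral>x. \<bar>Qint t h x - Qint t g x\<bar> \<partial>\<pi>) = 0"
    using Qint_distance[OF h g] by (simp add: order_antisym Bochner_Integration.integral_nonneg)
  moreover have "integrable \<pi> (\<lambda>x. \<bar>Qint t h x - Qint t g x\<bar>)"
    using Qint_L1(1)[OF h] Qint_L1(1)[OF g] by simp
  ultimately have "AE x in \<pi>. \<bar>Qint t h x - Qint t g x\<bar> = 0"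
    by (subst (asm) integral_nonneg_eq_0_iff_AE) auto
  then show ?thesis by eventually_elim simp
qed

end

lemma Qint_add:
  assumes s: "0 \<le> s" and t: "0 \<le> t" and h: "h \<in> borel_measurable borel" "integrable \<pi> h"
  shows "AE x in \<pi>. Qint (s + t) h x = Qint s (Qint t h) x"
  using Qint_finite_AE[OF add_nonneg_nonneg[OF s t] h]
proof eventually_elim
  case (elim x)
  have st: "0 \<le> s + t" using s t by simp
  have "integrable (k (s + t) x) h" by (rule kernel.integrable_kernel[OF kernel_k[OF st] h(1) elim])
  moreover have "(\<integral>y. Q t f y \<partial>k s x) = (\<integral>y. f y \<partial>k (s + t) x)" for f
    by (simp add: Q_eq[OF s, symmetric] Q_eq[OF st, symmetric] apply_add[OF s t])
  ultimately have "(\<integral>y. (\<integral>z. h z \<partial>k t y) \<partial>k s x) = (\<integral>y. h y \<partial>k (s + t) x)"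
    by (intro kernel.kernel_integral_L1(3)[OF kernel_k[OF t] finite_k[OF s] sets_k[OF s] finite_k[OF st] sets_k[OF st] _ h(1)])
  then show ?case by (simp add: Qint_def)
qed

text \<open>
  The same \<open>g\<close> serves for all times because \<open>Q t\<close> contracts \<open>L\<^sup>1(\<pi>)\<close>.  The estimate yields strong
  continuity, and at \<open>t = 0\<close> the identity \<open>Q 0 h = h\<close>.
\<close>

lemma Qint_continuous_approximation:
  assumes h: "h \<in> borel_measurable borel" "integrable \<pi> h" and e: "0 < e"
  shows "\<exists>g :: 'a \<Rightarrow>\<^sub>C real. \<forall>t\<ge>0. (\<integral>x. \<bar>Qint t h x - h x\<bar> \<partial>\<pi>) \<le> e + norm (Q t g - g)"
proof -
  interpret finite_borel_measures "{\<pi>}"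
    by (rule finite_borel_measures.intro) (auto simp: sets_\<pi> \<pi>.finite_measure_axioms)
  have "integrable M h" if "M \<in> {\<pi>}" for M using that h(2) by simp
  then obtain g where g': "\<And>M. M \<in> {\<pi>} \<Longrightarrow> (\<integral>x. \<bar>h x - apply_bcontfun g x\<bar> \<partial>M) < e / 2"
    using continuous_dense_L1[OF h(1), of "e / 2"] e by (metis half_gt_zero)
  then have g: "(\<integral>x. \<bar>h x - g x\<bar> \<partial>\<pi>) < e / 2" by simp
  have gb: "apply_bcontfun f \<in> borel_measurable borel" "integrable \<pi> (apply_bcontfun f)" for f :: "'a \<Rightarrow>\<^sub>C real"
    by (auto intro: borel_bcontfun integrable_bcontfun_finite[OF \<pi>.finite_measure_axioms sets_\<pi>])
  have "(\<integral>x. \<bar>Qint t h x - h x\<bar> \<partial>\<pi>) \<le> e + norm (Q t g - g)" if t: "0 \<le> t" for t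
  proof -
    have Qg: "Qint t g = apply_bcontfun (Q t g)" by (rule ext) (simp add: Qint_def Q_eq[OF t])
    have i1: "integrable \<pi> (\<lambda>x. \<bar>Qint t h x - Q t g x\<bar>)"
      using Qint_L1(1)[OF t h] gb(2) by simp
    have i2: "integrable \<pi> (\<lambda>x. \<bar>h x - g x\<bar>)" using h(2) gb(2) by simp
    have i3: "integrable \<pi> (\<lambda>x. \<bar>Qint t h x - h x\<bar>)" using Qint_L1(1)[OF t h] h(2) by simp
    have "(\<integral>x. \<bar>Qint t h x - h x\<bar> \<partial>\<pi>)
        \<le> (\<integral>x. \<bar>Qint t h x - Q t g x\<bar> + norm (Q t g - g) + \<bar>h x - g x\<bar> \<partial>\<pi>)"
    proof (rule integral_mono)
      fix x
      have "\<bar>Q t g x - g x\<bar> \<le> norm (Q t g - g)" using norm_bounded[of "Q t g - g" x] by simp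
      then show "\<bar>Qint t h x - h x\<bar> \<le> \<bar>Qint t h x - Q t g x\<bar> + norm (Q t g - g) + \<bar>h x - g x\<bar>"
        by linarith
    qed (use i1 i2 i3 in auto)
    also have "\<dots> = (\<integral>x. \<bar>Qint t h x - Q t g x\<bar> \<partial>\<pi>) + norm (Q t g - g) + (\<integral>x. \<bar>h x - g x\<bar> \<partial>\<pi>)"
      using i1 i2 by (simp add: \<pi>.prob_space)
    also have "(\<integral>x. \<bar>Qint t h x - Q t g x\<bar> \<partial>\<pi>) \<le> (\<integral>x. \<bar>h x - g x\<bar> \<partial>\<pi>)"
      using Qint_distance[OF t h gb, of g] by (simp add: Qg)
    finally show ?thesis using g by linarith
  qed
  then show ?thesis by blast
qed

lemma Qint_0:
  assumes h: "h \<in> borel_measurable borel" "integrable \<pi> h"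
  shows "AE x in \<pi>. Qint 0 h x = h x"
proof -
  have "(\<integral>x. \<bar>Qint 0 h x - h x\<bar> \<partial>\<pi>) \<le> 0 + e" if "0 < e" for e
    using Qint_continuous_approximation[OF h that] by auto
  then have "(\<integral>x. \<bar>Qint 0 h x - h x\<bar> \<partial>\<pi>) \<le> 0" by (rule field_le_epsilon)
  then have "(\<integral>x. \<bar>Qint 0 h x - h x\<bar> \<partial>\<pi>) = 0"
    by (simp add: order_antisym Bochner_Integration.integral_nonneg)
  moreover have "integrable \<pi> (\<lambda>x. \<bar>Qint 0 h x - h x\<bar>)"
    using Qint_L1(1)[OF order_refl h] h(2) by simp
  ultimately have "AE x in \<pi>. \<bar>Qint 0 h x - h x\<bar> = 0"
    by (subst (asm) integral_nonneg_eq_0_iff_AE) auto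
  then show ?thesis by eventually_elim simp
qed

lemma Qint_tendsto:
  assumes h: "h \<in> borel_measurable borel" "integrable \<pi> h"
  shows "((\<lambda>t. \<integral>x. \<bar>Qint t h x - h x\<bar> \<partial>\<pi>) \<longlongrightarrow> 0) (at_right 0)"
proof (rule tendstoI)
  fix e :: real assume e: "0 < e"
  obtain g :: "'a \<Rightarrow>\<^sub>C real" where g: "\<And>t. 0 \<le> t \<Longrightarrow> (\<integral>x. \<bar>Qint t h x - h x\<bar> \<partial>\<pi>) \<le> e / 2 + norm (Q t g - g)"
    using Qint_continuous_approximation[OF h, of "e / 2"] e by auto
  have "\<forall>\<^sub>F t in at_right 0. dist (Q t g) g < e / 2" using tendstoD[OF cont0, of "e / 2"] e by simp
  moreover have "\<forall>\<^sub>F t in at_right (0::real). 0 < t" by (simp add: eventually_at_right_less)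
  ultimately show "\<forall>\<^sub>F t in at_right 0. dist (\<integral>x. \<bar>Qint t h x - h x\<bar> \<partial>\<pi>) 0 < e"
  proof eventually_elim
    case (elim t)
    have "0 \<le> (\<integral>x. \<bar>Qint t h x - h x\<bar> \<partial>\<pi>)" by (intro Bochner_Integration.integral_nonneg) simp
    then show ?case using g[of t] elim by (simp add: dist_norm)
  qed
qed

subsection \<open>The ground state transform\<close>

definition transform :: "real \<Rightarrow> ('a \<Rightarrow> real) \<Rightarrow> 'a \<Rightarrow> real" where
  "transform t f x = Qint t (\<lambda>y. f y * \<psi> y) x / \<psi> x"

lemma integrable_times_\<psi>:
  assumes "integrable \<mu> f"
  shows "f \<in> borel_measurable borel" "(\<lambda>x. f x * \<psi> x) \<in> borel_measurable borel" "integrable \<pi> (\<lambda>x. f x * \<psi> x)"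
proof -
  show f: "f \<in> borel_measurable borel" using assms by (auto simp flip: borel_\<mu>)
  then show "(\<lambda>x. f x * \<psi> x) \<in> borel_measurable borel" by measurable
  show "integrable \<pi> (\<lambda>x. f x * \<psi> x)" using assms integrable_\<mu>[OF f] by simp
qed

lemma transform_measurable: "0 \<le> t \<Longrightarrow> integrable \<mu> f \<Longrightarrow> transform t f \<in> borel_measurable borel"
  unfolding transform_def[abs_def]
  using Qint_measurable[OF _ integrable_times_\<psi>(2), of t f] by measurable

text \<open>
  Multiplication by \<open>\<psi>\<close> maps \<open>L\<^sup>1(\<mu>)\<close> isometrically into \<open>L\<^sup>1(\<pi>)\<close> and turns the transform into \<open>Q t\<close>;
  all its properties are transported along this map.
\<close>

lemma transform_times_\<psi>:
  assumes "0 \<le> t" "integrable \<mu> f"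
  shows "AE x in \<pi>. transform t f x * \<psi> x = Qint t (\<lambda>y. f y * \<psi> y) x"
  using Qint_\<psi>_multiple_eq_0[OF assms(1) integrable_times_\<psi>(1)[OF assms(2)]]
  by eventually_elim (auto simp: transform_def)

lemma integrable_transform:
  assumes "0 \<le> t" "integrable \<mu> f"
  shows "integrable \<mu> (transform t f)"
proof -
  note f = integrable_times_\<psi>[OF assms(2)]
  have "integrable \<pi> (\<lambda>x. transform t f x * \<psi> x)"
    using transform_times_\<psi>[OF assms] Qint_L1(1)[OF assms(1) f(2,3)] transform_measurable[OF assms]
      Qint_measurable[OF assms(1) f(2)]
    by (subst integrable_cong_AE) (auto simp: borel_\<pi>)
  then show ?thesis by (simp add: integrable_\<mu>[OF transform_measurable[OF assms]])
qed

lemma integral_transform: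
  assumes "0 \<le> t" "integrable \<mu> f"
  shows "(\<integral>x. transform t f x \<partial>\<mu>) = (\<integral>x. f x \<partial>\<mu>)"
proof -
  note f = integrable_times_\<psi>[OF assms(2)]
  have "(\<integral>x. transform t f x \<partial>\<mu>) = (\<integral>x. transform t f x * \<psi> x \<partial>\<pi>)"
    by (rule integral_\<mu>[OF transform_measurable[OF assms]])
  also have "\<dots> = (\<integral>x. Qint t (\<lambda>y. f y * \<psi> y) x \<partial>\<pi>)"
    using transform_measurable[OF assms] Qint_measurable[OF assms(1) f(2)]
    by (intro integral_cong_AE transform_times_\<psi>[OF assms]) (auto simp: borel_\<pi>)
  also have "\<dots> = (\<integral>x. f x \<partial>\<mu>)"
    using Qint_L1(3)[OF assms(1) f(2,3)] integral_\<mu>[OF f(1)] by simp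
  finally show ?thesis .
qed

lemma transform_distance:
  assumes g: "g \<in> borel_measurable borel" and t: "0 \<le> t" and f: "integrable \<mu> f"
  shows "(\<integral>x. \<bar>transform t f x - g x\<bar> \<partial>\<mu>) = (\<integral>x. \<bar>Qint t (\<lambda>y. f y * \<psi> y) x - g x * \<psi> x\<bar> \<partial>\<pi>)"
proof -
  note [measurable] = transform_measurable[OF t f] Qint_measurable[OF t integrable_times_\<psi>(2)[OF f]] g
  have "(\<integral>x. \<bar>transform t f x - g x\<bar> \<partial>\<mu>) = (\<integral>x. \<bar>transform t f x - g x\<bar> * \<psi> x \<partial>\<pi>)"
    by (rule integral_\<mu>) measurable
  also have "\<dots> = (\<integral>x. \<bar>Qint t (\<lambda>y. f y * \<psi> y) x - g x * \<psi> x\<bar> \<partial>\<pi>)"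
  proof (rule integral_cong_AE)
    show "AE x in \<pi>. \<bar>transform t f x - g x\<bar> * \<psi> x = \<bar>Qint t (\<lambda>y. f y * \<psi> y) x - g x * \<psi> x\<bar>"
      using transform_times_\<psi>[OF t f]
    proof eventually_elim
      case (elim x)
      have "\<bar>transform t f x - g x\<bar> * \<psi> x = \<bar>(transform t f x - g x) * \<psi> x\<bar>" by (simp add: abs_mult)
      then show ?case using elim by (simp add: left_diff_distrib)
    qed
  qed (simp_all add: borel_\<pi>)
  finally show ?thesis .
qed

lemma transform_bounded:
  assumes "0 \<le> t" "integrable \<mu> f"
  shows "(\<integral>x. \<bar>transform t f x\<bar> \<partial>\<mu>) \<le> (\<integral>x. \<bar>f x\<bar> \<partial>\<mu>)"
proof -
  note f = integrable_times_\<psi>[OF assms(2)]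
  have "(\<integral>x. \<bar>transform t f x\<bar> \<partial>\<mu>) = (\<integral>x. \<bar>Qint t (\<lambda>y. f y * \<psi> y) x\<bar> \<partial>\<pi>)"
    using transform_distance[OF _ assms, of "\<lambda>_. 0"] by simp
  also have "\<dots> \<le> (\<integral>x. \<bar>f x * \<psi> x\<bar> \<partial>\<pi>)" by (rule Qint_L1(2)[OF assms(1) f(2,3)])
  also have "\<dots> = (\<integral>x. \<bar>f x\<bar> \<partial>\<mu>)"
    using f(1) by (subst integral_\<mu>) (auto simp: abs_mult)
  finally show ?thesis .
qed

lemma transform_cong_AE:
  assumes t: "0 \<le> t" and f: "integrable \<mu> f" and g: "integrable \<mu> g" and eq: "AE x in \<mu>. f x = g x"
  shows "AE x in \<mu>. transform t f x = transform t g x"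
proof -
  have "AE x in \<pi>. f x * \<psi> x = g x * \<psi> x"
    using eq unfolding AE_\<mu>_iff
  proof eventually_elim
    case (elim x)
    then show ?case by (cases "\<psi> x = 0") (auto simp: less_le)
  qed
  then have "AE x in \<pi>. Qint t (\<lambda>y. f y * \<psi> y) x = Qint t (\<lambda>y. g y * \<psi> y) x"
    by (rule Qint_cong_AE[OF t integrable_times_\<psi>(2,3)[OF f] integrable_times_\<psi>(2,3)[OF g]])
  then have "AE x in \<pi>. transform t f x = transform t g x" by eventually_elim (simp add: transform_def)
  then show ?thesis by (rule AE_\<pi>_imp_\<mu>)
qed

lemma transform_lincomb:
  assumes t: "0 \<le> t" and f: "integrable \<mu> f" and g: "integrable \<mu> g"
  shows "AE x in \<mu>. transform t (\<lambda>y. a * f y + b * g y) x = a * transform t f x + b * transform t g x"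
proof -
  have "AE x in \<pi>. transform t (\<lambda>y. a * f y + b * g y) x = a * transform t f x + b * transform t g x"
    using Qint_lincomb[OF t integrable_times_\<psi>(2,3)[OF f] integrable_times_\<psi>(2,3)[OF g], of a b]
    by eventually_elim (simp add: transform_def distrib_right mult.assoc add_divide_distrib)
  then show ?thesis by (rule AE_\<pi>_imp_\<mu>)
qed

lemma transform_add:
  assumes s: "0 \<le> s" and t: "0 \<le> t" and f: "integrable \<mu> f"
  shows "AE x in \<mu>. transform (s + t) f x = transform s (transform t f) x"
proof -
  note h = integrable_times_\<psi>(2,3)[OF f]
  have "AE x in \<pi>. Qint s (\<lambda>y. transform t f y * \<psi> y) x = Qint s (Qint t (\<lambda>y. f y * \<psi> y)) x"
    by (rule Qint_cong_AE[OF s integrable_times_\<psi>(2,3)[OF integrable_transform[OF t f]]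
        Qint_measurable[OF t h(1)] Qint_L1(1)[OF t h] transform_times_\<psi>[OF t f]])
  then have "AE x in \<pi>. transform (s + t) f x = transform s (transform t f) x"
    using Qint_add[OF s t h] by eventually_elim (simp add: transform_def)
  then show ?thesis by (rule AE_\<pi>_imp_\<mu>)
qed

lemma transform_0:
  assumes f: "integrable \<mu> f"
  shows "AE x in \<mu>. transform 0 f x = f x"
  using AE_\<pi>_imp_\<mu>[OF Qint_0[OF integrable_times_\<psi>(2,3)[OF f]]] AE_\<psi>_pos
  by eventually_elim (simp add: transform_def)

lemma transform_nonneg:
  assumes t: "0 \<le> t" and f: "integrable \<mu> f" and nn: "AE x in \<mu>. 0 \<le> f x"
  shows "AE x in \<mu>. 0 \<le> transform t f x"
proof -
  have "AE x in \<mu>. f x = max 0 (f x)" using nn by eventually_elim simp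
  then have "AE x in \<mu>. transform t f x = transform t (\<lambda>x. max 0 (f x)) x"
    using f by (intro transform_cong_AE[OF t]) auto
  then show ?thesis
  proof eventually_elim
    case (elim x)
    have "0 \<le> transform t (\<lambda>x. max 0 (f x)) x"
      unfolding transform_def Qint_def
      by (intro divide_nonneg_nonneg Bochner_Integration.integral_nonneg) auto
    then show ?case using elim by simp
  qed
qed

lemma transform_one:
  assumes "0 \<le> t"
  shows "AE x in \<mu>. transform t (\<lambda>_. 1) x = 1"
  using Q_\<psi>[OF assms] AE_\<psi>_pos by eventually_elim (simp add: transform_def)

lemma transform_tendsto:
  assumes f: "integrable \<mu> f"
  shows "((\<lambda>t. \<integral>x. \<bar>transform t f x - f x\<bar> \<partial>\<mu>) \<longlongrightarrow> 0) (at_right 0)"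
proof (rule Lim_transform_eventually[OF Qint_tendsto[OF integrable_times_\<psi>(2,3)[OF f]]])
  have "\<forall>\<^sub>F t in at_right (0::real). 0 < t" by (simp add: eventually_at_right_less)
  then show "\<forall>\<^sub>F t in at_right 0. (\<integral>x. \<bar>Qint t (\<lambda>y. f y * \<psi> y) x - f x * \<psi> x\<bar> \<partial>\<pi>)
      = (\<integral>x. \<bar>transform t f x - f x\<bar> \<partial>\<mu>)"
    by eventually_elim (simp add: transform_distance[OF integrable_times_\<psi>(1)[OF f] _ f])
qed

theorem transform_L1_markov_semigroup: "L1_markov_semigroup \<mu> transform"
  unfolding L1_markov_semigroup_def L1_bounded_operator_def
proof (intro conjI allI impI)
  show "\<exists>K. \<forall>f. integrable \<mu> f \<longrightarrow> (\<integral>x. \<bar>transform t f x\<bar> \<partial>\<mu>) \<le> K * (\<integral>x. \<bar>f x\<bar> \<partial>\<mu>)" if "0 \<le> t" for t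
    using transform_bounded[OF that] by (intro exI[of _ 1]) simp
qed (fact integrable_transform transform_cong_AE transform_lincomb transform_0 transform_add
    transform_nonneg transform_tendsto transform_one)+

lemma transform_defined:
  assumes t: "0 \<le> t" and f: "integrable \<mu> f"
  shows "AE x in \<mu>. (\<integral>\<^sup>+y. ennreal (\<bar>f y\<bar> * \<psi> y) \<partial>k t x) < \<infinity> \<and> 0 < \<psi> x"
proof -
  have "AE x in \<pi>. (\<integral>\<^sup>+y. ennreal \<bar>f y * \<psi> y\<bar> \<partial>k t x) < \<infinity>"
    by (rule Qint_finite_AE[OF t integrable_times_\<psi>(2,3)[OF f]])
  then have "AE x in \<pi>. (\<integral>\<^sup>+y. ennreal (\<bar>f y\<bar> * \<psi> y) \<partial>k t x) < \<infinity>"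
    by (simp add: abs_mult)
  from AE_\<pi>_imp_\<mu>[OF this] AE_\<psi>_pos show ?thesis by eventually_elim simp
qed

end

section \<open>Normalisation by the principal eigenvalue\<close>

text \<open>
  Both sides are \<open>0\<close> by convention if \<open>h\<close> is not integrable, so the eigenvalue factor can be absorbed
  into the kernel without any measurability condition.
\<close>

lemma integral_density_const:
  fixes h :: "'a \<Rightarrow> real"
  assumes "0 \<le> a"
  shows "(\<integral>x. h x \<partial>density M (\<lambda>_. ennreal a)) = a * (\<integral>x. h x \<partial>M)"
proof (cases "h \<in> borel_measurable M")
  case True
  then show ?thesis using assms by (subst integral_density) auto
next
  case False
  then have "\<not> integrable (density M (\<lambda>_. ennreal a)) h" "\<not> integrable M h"
    by (auto dest: borel_measurable_integrable)
  then show ?thesis by (simp add: not_integrable_integral_eq)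
qed

text \<open>
  Unfolding the rate function; its infimum is finite because otherwise the extended real on the
  right-hand side of the equilibrium condition would be infinite.
\<close>

lemma equilibrium_generator_integral:
  fixes P :: "'a::metric_space op_family"
  assumes eq: "equilibrium_measure P V \<mu>" and u: "u \<in> pos_gen_domain P"
  shows "principal_eigenvalue P V \<le> (\<integral>x. V x \<partial>\<mu>) + (\<integral>x. gen P u x / u x \<partial>\<mu>)"
proof -
  define J where "J = (INF u\<in>pos_gen_domain P. ereal (\<integral>x. gen P u x / u x \<partial>\<mu>))"
  have "ereal (principal_eigenvalue P V) = ereal (\<integral>x. V x \<partial>\<mu>) - (- J)"
    using eq by (simp add: equilibrium_measure_def rate_function_def J_def)
  moreover have "J \<le> ereal (\<integral>x. gen P u x / u x \<partial>\<mu>)" unfolding J_def by (rule INF_lower[OF u])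
  ultimately show ?thesis by (cases J) auto
qed

lemma schrodinger_kernel_exists:
  fixes P :: "'a::metric_space op_family"
  assumes cpt: "compact (UNIV :: 'a set)" and S: "positive_C0_semigroup (schrodinger P V)" and t: "0 \<le> t"
  shows "sets (schrodinger_kernel P V t x) = sets borel \<and> finite_measure (schrodinger_kernel P V t x) \<and>
    (\<forall>f :: 'a \<Rightarrow>\<^sub>C real. schrodinger P V t f x = (\<integral>y. f y \<partial>schrodinger_kernel P V t x))"
proof -
  interpret positive_functional "\<lambda>f. schrodinger P V t f x"
  proof
    show "compact (UNIV :: 'a set)" by (rule cpt)
    show "0 \<le> schrodinger P V t f x" if "\<And>x. 0 \<le> apply_bcontfun f x" for f
      using S that t by (simp add: positive_C0_semigroup_def)
  qed (simp_all add: blinfun.add_right blinfun.scaleR_right)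
  obtain m where m: "sets m = sets borel" "finite_measure m" "\<And>f. schrodinger P V t f x = (\<integral>y. apply_bcontfun f y \<partial>m)"
    using riesz_representation by metis
  then have "sets m = sets borel \<and> finite_measure m \<and>
    (\<forall>f :: 'a \<Rightarrow>\<^sub>C real. schrodinger P V t f x = (\<integral>y. f y \<partial>m))" by simp
  then show ?thesis unfolding schrodinger_kernel_def by (rule someI)
qed

theorem theorem2:
  fixes P :: "'a::metric_space op_family"
    and V :: "'a \<Rightarrow>\<^sub>C real"
    and \<mu> :: "'a measure"
  assumes "compact (UNIV :: 'a set)"
    and "markov_semigroup P"
    and "bdd_above ((\<lambda>t. exp (- principal_eigenvalue P V * t) * norm (schrodinger P V t)) ` {0..})"
    and "equilibrium_measure P V \<mu>"
  shows "\<exists>\<psi> \<pi>. ground_state P V \<mu> \<psi> \<and> ground_measure P V \<pi> \<and>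
    integrable \<mu> (\<lambda>x. ln (\<psi> x)) \<and>
    absolutely_continuous \<pi> \<mu> \<and> (AE x in \<pi>. RN_deriv \<pi> \<mu> x = ennreal (\<psi> x)) \<and>
    (\<forall>t\<ge>0. \<forall>f. integrable \<mu> f \<longrightarrow> (AE x in \<mu>. doob_defined P V \<psi> t f x)) \<and>
    L1_markov_semigroup \<mu> (doob P V \<psi>) \<and>
    (\<forall>t\<ge>0. \<forall>f. integrable \<mu> f \<longrightarrow> (\<integral>x. doob P V \<psi> t f x \<partial>\<mu>) = (\<integral>x. f x \<partial>\<mu>))"
proof -
  define l where "l = principal_eigenvalue P V"
  define S where "S = schrodinger P V"
  define Q where "Q t = exp ((- l) * t) *\<^sub>R S t" for t
  (* absorbing the factor into the kernel, also for t < 0, makes doob equal to the transform as a function *)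
  define k where "k t x = density (schrodinger_kernel P V t x) (\<lambda>_. ennreal (exp ((- l) * t)))" for t x
  have S: "is_schrodinger_semigroup P V S"
    unfolding S_def schrodinger_def using schrodinger_semigroup_exists[OF assms(2)] by (rule someI_ex)
  have S0: "positive_C0_semigroup S" using S by (simp add: is_schrodinger_semigroup_def)
  obtain C where C: "\<And>t. 0 \<le> t \<Longrightarrow> exp ((- l) * t) * norm (S t) \<le> C"
    using assms(3) unfolding bdd_above_def l_def S_def by auto
  have "bounded_semigroup (\<lambda>t. exp ((- l) * t) *\<^sub>R S t) C"
    by (rule bounded_semigroup_positive_C0[OF S0]) (use C in simp)
  then have Q_semigroup: "bounded_semigroup Q C" unfolding Q_def .
  have Q_apply: "Q t f x = exp (- l * t) * S t f x" for t f x
    by (simp add: Q_def blinfun.scaleR_left)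
  have Q_pos: "0 \<le> Q t f x" if "0 \<le> t" "\<And>x. 0 \<le> apply_bcontfun f x" for t f x
    using S0 that by (simp add: Q_apply positive_C0_semigroup_def)
  have \<mu>: "prob_space \<mu>" "sets \<mu> = sets borel"
    using assms(4) by (auto simp: equilibrium_measure_def borel_probability_def)
  have gen_nonneg: "0 \<le> (\<integral>x. g x / u x \<partial>\<mu>)"
    if g: "has_generator_value Q u g" and u: "\<And>x. 0 < apply_bcontfun u x" for u g
  proof -
    have SQ: "(\<lambda>t. exp (l * t) *\<^sub>R Q t) = S" by (simp add: Q_def fun_eq_iff flip: exp_add)
    have gS: "has_generator_value S u (g + l *\<^sub>R u)"
      using has_generator_value_exp_scale[OF g, of l] unfolding SQ .
    then have dom: "u \<in> gen_domain P"
      using S by (auto simp: is_schrodinger_semigroup_def gen_domain_iff)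
    have gen_eq': "gen S u x = gen P u x + V x * u x" for x
      using S dom by (simp add: is_schrodinger_semigroup_def)
    have gx: "g x / u x = gen P u x / u x + V x - l" for x
    proof -
      have "g x + l * u x = gen P u x + V x * u x"
        using gen_eq'[of x] gen_eq[OF gS] by simp
      then show ?thesis using u[of x] by (simp add: field_simps)
    qed
    interpret \<mu>: prob_space \<mu> by (rule \<mu>(1))
    obtain z where z: "\<And>x. u z \<le> u x"
      using continuous_attains_inf[OF assms(1) _ continuous_on_apply_bcontfun, of u] by auto
    have bc: "apply_bcontfun f \<in> borel_measurable \<mu>" for f :: "'a \<Rightarrow>\<^sub>C real"
      unfolding measurable_cong_sets[OF \<mu>(2) refl] by (intro borel_measurable_continuous_onI) auto
    have i1: "integrable \<mu> (\<lambda>x. gen P u x / u x)"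
    proof (rule \<mu>.integrable_const_bound[of _ "norm (gen P u) / u z"])
      show "AE x in \<mu>. norm (gen P u x / u x) \<le> norm (gen P u) / u z"
      proof (rule AE_I2)
        fix x show "norm (gen P u x / u x) \<le> norm (gen P u) / u z"
          using norm_bounded[of "gen P u" x] z[of x] u[of x] u[of z] by (simp add: frac_le)
      qed
    qed (intro borel_measurable_divide bc)
    have i2: "integrable \<mu> V" by (rule integrable_bcontfun_finite[OF \<mu>.finite_measure_axioms \<mu>(2)])
    have "u \<in> pos_gen_domain P" using dom u by (simp add: pos_gen_domain_def)
    then have "l \<le> (\<integral>x. V x \<partial>\<mu>) + (\<integral>x. gen P u x / u x \<partial>\<mu>)"
      unfolding l_def by (rule equilibrium_generator_integral[OF assms(4)])
    moreover have "(\<integral>x. g x / u x \<partial>\<mu>) = (\<integral>x. gen P u x / u x \<partial>\<mu>) + (\<integral>x. V x \<partial>\<mu>) - l"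
      unfolding gx using i1 i2 by (simp add: \<mu>.prob_space)
    ultimately show ?thesis by simp
  qed
  have kernel_props: "sets (schrodinger_kernel P V t x) = sets borel"
      "finite_measure (schrodinger_kernel P V t x)"
      "\<And>f. S t f x = (\<integral>y. apply_bcontfun f y \<partial>schrodinger_kernel P V t x)" if "0 \<le> t" for t x
    using schrodinger_kernel_exists[OF assms(1) S0[unfolded S_def] that, of x] by (auto simp: S_def)
  have kernel_k: "kernel (k t) (blinfun_apply (Q t))" if t: "0 \<le> t" for t
  proof (rule kernel.intro)
    show "sets (k t x) = sets borel" for x by (simp add: k_def kernel_props(1)[OF t])
    show "finite_measure (k t x)" for x
    proof -
      interpret s: finite_measure "schrodinger_kernel P V t x" by (rule kernel_props(2)[OF t])
      have "emeasure (k t x) (space (k t x)) < \<infinity>"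
        by (simp add: k_def emeasure_density_const s.emeasure_eq_measure ennreal_mult_less_top)
      then show ?thesis by (intro finite_measureI) simp
    qed
    show "Q t f x = (\<integral>y. f y \<partial>k t x)" for f x
      by (simp add: k_def integral_density_const Q_apply kernel_props(3)[OF t])
  qed
  have eqm: "equilibrium Q C \<mu>"
    by (intro equilibrium.intro positive_semigroup.intro positive_semigroup_axioms.intro
        equilibrium_axioms.intro Q_semigroup assms(1) Q_pos \<mu> gen_nonneg)
  then interpret E: equilibrium Q C \<mu> .
  obtain \<pi> c where \<pi>: "prob_space \<pi>" "sets \<pi> = sets borel"
    "\<forall>t\<ge>0. \<forall>f. (\<integral>x. Q t f x \<partial>\<pi>) = (\<integral>x. f x \<partial>\<pi>)"
    "\<forall>w :: 'a \<Rightarrow>\<^sub>C real. (\<forall>x. 0 < w x) \<longrightarrow> (\<integral>x. ln (w x) \<partial>\<mu>) \<le> c + ln (\<integral>x. w x \<partial>\<pi>)"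
    using E.invariant_probability_exists by (elim exE conjE)
  interpret G: ground Q C \<mu> k \<pi> c
    by (intro ground.intro eqm ground_axioms.intro kernel_k) (use \<pi> in auto)
  have nn_eq: "(\<integral>\<^sup>+y. ennreal (h y) \<partial>k t x) = ennreal (exp (- l * t)) * schrodinger_nn P V t h x"
    if "0 \<le> t" "h \<in> borel_measurable borel" for t h x
  proof -
    have "(\<lambda>y. ennreal (h y)) \<in> borel_measurable (schrodinger_kernel P V t x)"
      using that(2) by (simp add: measurable_cong_sets[OF kernel_props(1)[OF that(1)] refl])
    then show ?thesis by (simp add: k_def nn_integral_density nn_integral_cmult schrodinger_nn_def)
  qed
  have doob_eq: "doob P V G.\<psi> = G.transform"
    by (simp add: fun_eq_iff doob_def G.transform_def G.Qint_def k_def integral_density_const l_def)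
  have "ground_state P V \<mu> G.\<psi>"
    unfolding ground_state_def l_def[symmetric]
    using G.Qnn_\<psi> G.AE_\<psi>_pos by (simp add: G.Qnn_def nn_eq)
  moreover have "ground_measure P V \<pi>"
    unfolding ground_measure_def borel_probability_def l_def[symmetric] S_def[symmetric]
    using \<pi>(1-3) by (simp add: Q_apply)
  moreover have "AE x in \<mu>. doob_defined P V G.\<psi> t f x" if t: "0 \<le> t" and f: "integrable \<mu> f" for t f
    using G.transform_defined[OF t f]
  proof eventually_elim
    case (elim x)
    have "(\<lambda>y. \<bar>f y\<bar> * G.\<psi> y) \<in> borel_measurable borel"
      using G.integrable_times_\<psi>(1)[OF f] by measurable
    then have "ennreal (exp (- l * t)) * schrodinger_nn P V t (\<lambda>y. \<bar>f y\<bar> * G.\<psi> y) x < \<infinity>"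
      using elim by (simp add: nn_eq[OF t])
    then show ?case using elim by (auto simp: doob_defined_def ennreal_mult_less_top)
  qed
  ultimately show ?thesis
    using G.integrable_ln_\<psi> G.\<mu>_absolutely_continuous G.RN_deriv_\<psi>
      G.transform_L1_markov_semigroup G.integral_transform
    by (intro exI[of _ G.\<psi>] exI[of _ \<pi>]) (simp add: doob_eq)
qed

end
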